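(* Let $\mathfrak g$ be a Lie algebra over a field $\mathbb F$, $I\subset\mathfrak g$ an ideal, $\mathfrak k\subset\mathfrak g$ a subalgebra reductive in $\mathfrak g$, $I_{\mathfrak k}=I\cap\mathfrak k$, and $M$ a $\mathfrak g$-module. Under the isomorphism $\phi:E_1^{pq}\to C^p(\mathfrak g/I,\mathfrak k/I_{\mathfrak k};H^q(I,I_{\mathfrak k};M))$, the spectral sequence differential $d_1$ corresponds to the Lie algebra cohomology differential $d_+$ (for the $\mathfrak g/I$-module $H^q(I,I_{\mathfrak k};M)$), i.e., $\phi(d_1e)=d_+\phi(e)$ for all $e\in E_1^{pq}$.
   Context: "Reductive in $\mathfrak g$": any $\mathfrak k$-submodules $U\subset V$ of $\mathfrak g$ admit a $\mathfrak k$-invariant complement of $U$ in $V$. Relative cochains: $C^n=C^n(\mathfrak g,\mathfrak k;M)\subset\mathrm{Hom}(\Lambda^n\mathfrak g,M)$ is the subcomplex (Chevalley-Eilenberg differential $d$) of $f$ with $i_xf=0$ and $\theta_xf=0$ for all $x\in\mathfrak k$ ($i_x$ = insertion in first slot; $(\theta_xf)(x_1,\dots,x_n)=x\cdot f(x_1,\dots,x_n)-\sum_jf(\dots,[x,x_j],\dots)$). Similarly for other pairs; $Z^n,B^n,H^n$ denote cocycles, coboundaries, cohomology. Action of $\mathfrak g/I$ on $H^q(I,I_{\mathfrak k};M)$: fix a $\mathfrak k$-module decomposition $\mathfrak g=I_{\mathfrak k}\oplus I_L\oplus J_{\mathfrak k}\oplus J_L$ with $I=I_{\mathfrak k}\oplus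 I_L$, $\mathfrak k=I_{\mathfrak k}\oplus J_{\mathfrak k}$; let $J=J_{\mathfrak k}\oplus J_L$, $x\mapsto x^+$ the projection $\mathfrak g=I\oplus J\to J$; then $x\cdot[c]=[\theta_{x^+}c]$. The map $d_+:C^p(\mathfrak g/I,\mathfrak k/I_{\mathfrak k};H^q(I,I_{\mathfrak k};M))\to C^{p+1}(\mathfrak g/I,\mathfrak k/I_{\mathfrak k};H^q(I,I_{\mathfrak k};M))$ is the relative Lie algebra cohomology differential for this module. Filtration: $F_pC^n=\{f\in C^n: f$ vanishes when at least $n-p+1$ arguments lie in $I\}$ ($=C^n$ for $p\le0$). $Z_1^{pq}=\{c\in F_pC^{p+q}:dc\in F_{p+1}C^{p+q+1}\}$, $B_1^{pq}=d F_pC^{p+q-1}+F_{p+1}C^{p+q}$, $E_1^{pq}=Z_1^{pq}/B_1^{pq}$, and $d_1(c+B_1^{pq})=dc+B_1^{p+1,q}$. The map $\phi$ is $\phi(c+B_1^{pq})=\alpha s_p(c)$, where $s_p:F_pC^{p+q}\to C^p(\mathfrak g/I,\mathfrak k/I_{\mathfrak k};C^q(I,I_{\mathfrak k};M))$ is $(s_pf)(x_1,\dots,x_p)(x_{p+1},\dots,x_{p+q})=f(x_1,\dots,x_{p+q})$ for $x_1,\dots,x_p\in\mathfrak g$, $x_{p+1},\dots,x_{p+q}\in I$ ($\mathfrak k$ acts on $C^q(I,I_{\mathfrak k};M)$ by $\theta$, with $I_{\mathfrak k}$ trivial; $s_p$ maps $Z_1^{pq}$ into cochains with values in $Z^q(I,I_{\mathfrak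 k};M)$), and $\alpha:C^p(\mathfrak g/I,\mathfrak k/I_{\mathfrak k};Z^q(I,I_{\mathfrak k};M))\to C^p(\mathfrak g/I,\mathfrak k/I_{\mathfrak k};H^q(I,I_{\mathfrak k};M))$ is induced by passing from cocycles to cohomology. *)

theory Defs
  imports "HOL-Algebra.Module" "HOL-Algebra.AbelCoset"
begin

text \<open>
  Vector spaces over a field \<open>F\<close> are modules over \<open>F\<close> in the sense of \<^theory>\<open>HOL-Algebra.Module\<close>;
  the record fields \<^const>\<open>mult\<close> and \<^const>\<open>one\<close> that a module record inherits from
  rings carry no meaning.  All dimensions may be infinite and \<open>F\<close> may have any characteristic.
\<close>

section \<open>Lie algebras and modules over them\<close>

record ('a, 'b) lie = "('a, 'b) module" +
  bracket :: "'b \<Rightarrow> 'b \<Rightarrow> 'b"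

locale lie_algebra = field F + module F L
  for F :: "('a, 'c) ring_scheme" (structure) and L :: "('a, 'b, 'd) lie_scheme" (structure) +
  assumes bracket_closed:
      "\<lbrakk>x \<in> carrier L; y \<in> carrier L\<rbrakk> \<Longrightarrow> bracket L x y \<in> carrier L"
    and bracket_add_left: "\<lbrakk>x \<in> carrier L; y \<in> carrier L; z \<in> carrier L\<rbrakk>
      \<Longrightarrow> bracket L (x \<oplus>\<^bsub>L\<^esub> y) z = bracket L x z \<oplus>\<^bsub>L\<^esub> bracket L y z"
    and bracket_add_right: "\<lbrakk>x \<in> carrier L; y \<in> carrier L; z \<in> carrier L\<rbrakk>
      \<Longrightarrow> bracket L x (y \<oplus>\<^bsub>L\<^esub> z) = bracket L x y \<oplus>\<^bsub>L\<^esub> bracket L x z"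
    and bracket_smult_left: "\<lbrakk>a \<in> carrier F; x \<in> carrier L; y \<in> carrier L\<rbrakk>
      \<Longrightarrow> bracket L (a \<odot>\<^bsub>L\<^esub> x) y = a \<odot>\<^bsub>L\<^esub> bracket L x y"
    and bracket_smult_right: "\<lbrakk>a \<in> carrier F; x \<in> carrier L; y \<in> carrier L\<rbrakk>
      \<Longrightarrow> bracket L x (a \<odot>\<^bsub>L\<^esub> y) = a \<odot>\<^bsub>L\<^esub> bracket L x y"
    and bracket_self: "x \<in> carrier L \<Longrightarrow> bracket L x x = \<zero>\<^bsub>L\<^esub>"
    and jacobi: "\<lbrakk>x \<in> carrier L; y \<in> carrier L; z \<in> carrier L\<rbrakk>
      \<Longrightarrow> bracket L x (bracket L y z) \<oplus>\<^bsub>L\<^esub> bracket L y (bracket L z x)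
            \<oplus>\<^bsub>L\<^esub> bracket L z (bracket L x y) = \<zero>\<^bsub>L\<^esub>"

locale lie_module = lie_algebra F L + M: module F M
  for F :: "('a, 'c) ring_scheme" (structure) and L :: "('a, 'b, 'd) lie_scheme" (structure)
    and M :: "('a, 'm, 'e) module_scheme" (structure) +
  fixes act :: "'b \<Rightarrow> 'm \<Rightarrow> 'm"
  assumes act_closed: "\<lbrakk>x \<in> carrier L; u \<in> carrier M\<rbrakk> \<Longrightarrow> act x u \<in> carrier M"
    and act_add_left: "\<lbrakk>x \<in> carrier L; y \<in> carrier L; u \<in> carrier M\<rbrakk>
      \<Longrightarrow> act (x \<oplus>\<^bsub>L\<^esub> y) u = act x u \<oplus>\<^bsub>M\<^esub> act y u"
    and act_add_right: "\<lbrakk>x \<in> carrier L; u \<in> carrier M; v \<in> carrier M\<rbrakk>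
      \<Longrightarrow> act x (u \<oplus>\<^bsub>M\<^esub> v) = act x u \<oplus>\<^bsub>M\<^esub> act x v"
    and act_smult_left: "\<lbrakk>a \<in> carrier F; x \<in> carrier L; u \<in> carrier M\<rbrakk>
      \<Longrightarrow> act (a \<odot>\<^bsub>L\<^esub> x) u = a \<odot>\<^bsub>M\<^esub> act x u"
    and act_smult_right: "\<lbrakk>a \<in> carrier F; x \<in> carrier L; u \<in> carrier M\<rbrakk>
      \<Longrightarrow> act x (a \<odot>\<^bsub>M\<^esub> u) = a \<odot>\<^bsub>M\<^esub> act x u"
    and act_bracket: "\<lbrakk>x \<in> carrier L; y \<in> carrier L; u \<in> carrier M\<rbrakk>
      \<Longrightarrow> act (bracket L x y) u = act x (act y u) \<ominus>\<^bsub>M\<^esub> act y (act x u)"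

definition lie_subalgebra ::
    "('a, 'c) ring_scheme \<Rightarrow> ('a, 'b, 'd) lie_scheme \<Rightarrow> 'b set \<Rightarrow> bool" where
  "lie_subalgebra F L K \<longleftrightarrow>
     submodule K F L \<and> (\<forall>x\<in>K. \<forall>y\<in>K. bracket L x y \<in> K)"

definition lie_ideal ::
    "('a, 'c) ring_scheme \<Rightarrow> ('a, 'b, 'd) lie_scheme \<Rightarrow> 'b set \<Rightarrow> bool" where
  "lie_ideal F L I \<longleftrightarrow>
     submodule I F L \<and> (\<forall>x\<in>carrier L. \<forall>y\<in>I. bracket L x y \<in> I)"

definition ad_submodule ::
    "('a, 'c) ring_scheme \<Rightarrow> ('a, 'b, 'd) lie_scheme \<Rightarrow> 'b set \<Rightarrow> 'b set \<Rightarrow> bool" where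
  "ad_submodule F L K V \<longleftrightarrow>
     submodule V F L \<and> (\<forall>x\<in>K. \<forall>v\<in>V. bracket L x v \<in> V)"

definition direct_decomp ::
    "('a, 'b, 'd) lie_scheme \<Rightarrow> 'b set \<Rightarrow> 'b set \<Rightarrow> 'b set \<Rightarrow> bool" where
  "direct_decomp L V U W \<longleftrightarrow> V = U <+>\<^bsub>L\<^esub> W \<and> U \<inter> W = {\<zero>\<^bsub>L\<^esub>}"

definition reductive_in ::
    "('a, 'c) ring_scheme \<Rightarrow> ('a, 'b, 'd) lie_scheme \<Rightarrow> 'b set \<Rightarrow> bool" where
  "reductive_in F L K \<longleftrightarrow>
     (\<forall>U V. ad_submodule F L K U \<and> ad_submodule F L K V \<and> U \<subseteq> V \<longrightarrow>
        (\<exists>W. ad_submodule F L K W \<and> direct_decomp L V U W))"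

text \<open>
  Cosets are those of the additive group.  As for \<^const>\<open>FactGroup\<close> in HOL-Algebra, a map on
  cosets given by a formula on representatives is written with \<^const>\<open>the_elem\<close>: the common
  value of the formula on all representatives.
\<close>

definition quotient_module ::
    "('a, 'b, 'd) module_scheme \<Rightarrow> 'b set \<Rightarrow> ('a, 'b set) module" where
  "quotient_module V U =
     \<lparr>carrier = a_rcosets\<^bsub>V\<^esub> U, mult = undefined, one = undefined,
      zero = U, add = set_add V,
      smult = (\<lambda>a X. the_elem ((\<lambda>x. U +>\<^bsub>V\<^esub> (a \<odot>\<^bsub>V\<^esub> x)) ` X))\<rparr>"

definition quotient_lie ::
    "('a, 'b, 'd) lie_scheme \<Rightarrow> 'b set \<Rightarrow> ('a, 'b set) lie" where
  "quotient_lie L I =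
     \<lparr>carrier = a_rcosets\<^bsub>L\<^esub> I, mult = undefined, one = undefined,
      zero = I, add = set_add L,
      smult = (\<lambda>a X. the_elem ((\<lambda>x. I +>\<^bsub>L\<^esub> (a \<odot>\<^bsub>L\<^esub> x)) ` X)),
      bracket = (\<lambda>X Y. the_elem ((\<lambda>(x, y). I +>\<^bsub>L\<^esub> bracket L x y) ` (X \<times> Y)))\<rparr>"


section \<open>Relative Lie algebra cochains\<close>

definition tuples :: "'b set \<Rightarrow> nat \<Rightarrow> 'b list set" where
  "tuples D n = {xs. length xs = n \<and> set xs \<subseteq> D}"

text \<open>\<open>Hom(\<Lambda>\<^sup>n L, M)\<close>: alternating multilinear maps, made extensional.\<close>

definition alternating_maps ::
    "('a, 'c) ring_scheme \<Rightarrow> ('a, 'b, 'd) lie_scheme \<Rightarrow> ('a, 'm, 'e) module_scheme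
      \<Rightarrow> nat \<Rightarrow> ('b list \<Rightarrow> 'm) set" where
  "alternating_maps F L M n =
     {f \<in> tuples (carrier L) n \<rightarrow>\<^sub>E carrier M.
        (\<forall>xs\<in>tuples (carrier L) n. \<forall>i<n. \<forall>x\<in>carrier L. \<forall>y\<in>carrier L.
           f (xs[i := x \<oplus>\<^bsub>L\<^esub> y]) = f (xs[i := x]) \<oplus>\<^bsub>M\<^esub> f (xs[i := y])) \<and>
        (\<forall>xs\<in>tuples (carrier L) n. \<forall>i<n. \<forall>a\<in>carrier F. \<forall>x\<in>carrier L.
           f (xs[i := a \<odot>\<^bsub>L\<^esub> x]) = a \<odot>\<^bsub>M\<^esub> f (xs[i := x])) \<and>
        (\<forall>xs\<in>tuples (carrier L) n. \<forall>i j. i < j \<and> j < n \<and> xs ! i = xs ! j \<longrightarrow>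
           f xs = \<zero>\<^bsub>M\<^esub>)}"

definition zero_cochain ::
    "('a, 'm, 'e) module_scheme \<Rightarrow> 'b set \<Rightarrow> nat \<Rightarrow> 'b list \<Rightarrow> 'm" where
  "zero_cochain M D n = (\<lambda>xs\<in>tuples D n. \<zero>\<^bsub>M\<^esub>)"

text \<open>\<open>i\<^sub>x\<close>, from degree \<open>n + 1\<close> to degree \<open>n\<close>.\<close>

definition insertion :: "'b set \<Rightarrow> nat \<Rightarrow> 'b \<Rightarrow> ('b list \<Rightarrow> 'm) \<Rightarrow> 'b list \<Rightarrow> 'm" where
  "insertion D n x f = (\<lambda>xs\<in>tuples D n. f (x # xs))"

text \<open>
  \<open>\<theta>\<^sub>x f\<close> in degree \<open>n\<close>.  The arguments of \<open>f\<close> range over \<open>D\<close>, while \<open>x\<close> may be any element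
  of \<open>L\<close> whose bracket maps \<open>D\<close> into \<open>D\<close>; this is how \<open>L\<close> acts on cochains of an ideal \<open>D\<close>.
\<close>

definition lie_deriv ::
    "('a, 'b, 'd) lie_scheme \<Rightarrow> ('a, 'm, 'e) module_scheme \<Rightarrow> ('b \<Rightarrow> 'm \<Rightarrow> 'm)
      \<Rightarrow> 'b set \<Rightarrow> nat \<Rightarrow> 'b \<Rightarrow> ('b list \<Rightarrow> 'm) \<Rightarrow> 'b list \<Rightarrow> 'm" where
  "lie_deriv L M act D n x f =
     (\<lambda>xs\<in>tuples D n.
        act x (f xs) \<ominus>\<^bsub>M\<^esub> (\<Oplus>\<^bsub>M\<^esub>j\<in>{..<n}. f (xs[j := bracket L x (xs ! j)])))"

definition rel_cochains ::
    "('a, 'c) ring_scheme \<Rightarrow> ('a, 'b, 'd) lie_scheme \<Rightarrow> 'b set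
      \<Rightarrow> ('a, 'm, 'e) module_scheme \<Rightarrow> ('b \<Rightarrow> 'm \<Rightarrow> 'm) \<Rightarrow> nat \<Rightarrow> ('b list \<Rightarrow> 'm) set" where
  "rel_cochains F L K M act n =
     {f \<in> alternating_maps F L M n. \<forall>x\<in>K.
        (\<forall>m. n = Suc m \<longrightarrow>
           insertion (carrier L) m x f = zero_cochain M (carrier L) m) \<and>
        lie_deriv L M act (carrier L) n x f = zero_cochain M (carrier L) n}"

definition alt_sign :: "('a, 'm, 'e) module_scheme \<Rightarrow> nat \<Rightarrow> 'm \<Rightarrow> 'm" where
  "alt_sign M i u = (if even i then u else \<ominus>\<^bsub>M\<^esub> u)"

text \<open>
  Chevalley-Eilenberg differential, from degree \<open>n\<close> to degree \<open>n + 1\<close>.  Positions are counted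
  from \<open>0\<close>; \<open>nths xs (- {i, j})\<close> is \<open>xs\<close> with the entries at positions \<open>i\<close> and \<open>j\<close> omitted.
\<close>

definition ce_diff ::
    "('a, 'b, 'd) lie_scheme \<Rightarrow> ('a, 'm, 'e) module_scheme \<Rightarrow> ('b \<Rightarrow> 'm \<Rightarrow> 'm)
      \<Rightarrow> nat \<Rightarrow> ('b list \<Rightarrow> 'm) \<Rightarrow> 'b list \<Rightarrow> 'm" where
  "ce_diff L M act n f =
     (\<lambda>xs\<in>tuples (carrier L) (Suc n).
        (\<Oplus>\<^bsub>M\<^esub>i\<in>{..n}. alt_sign M i (act (xs ! i) (f (nths xs (- {i})))))
        \<oplus>\<^bsub>M\<^esub>
        (\<Oplus>\<^bsub>M\<^esub>j\<in>{..n}. \<Oplus>\<^bsub>M\<^esub>i\<in>{..<j}.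
           alt_sign M (i + j) (f (bracket L (xs ! i) (xs ! j) # nths xs (- {i, j})))))"

definition cochain_module ::
    "('a, 'c) ring_scheme \<Rightarrow> ('a, 'b, 'd) lie_scheme \<Rightarrow> 'b set
      \<Rightarrow> ('a, 'm, 'e) module_scheme \<Rightarrow> ('b \<Rightarrow> 'm \<Rightarrow> 'm) \<Rightarrow> nat
      \<Rightarrow> ('a, 'b list \<Rightarrow> 'm) module" where
  "cochain_module F L K M act n =
     \<lparr>carrier = rel_cochains F L K M act n, mult = undefined, one = undefined,
      zero = zero_cochain M (carrier L) n,
      add = (\<lambda>f g. \<lambda>xs\<in>tuples (carrier L) n. f xs \<oplus>\<^bsub>M\<^esub> g xs),
      smult = (\<lambda>a f. \<lambda>xs\<in>tuples (carrier L) n. a \<odot>\<^bsub>M\<^esub> f xs)\<rparr>"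

definition rel_cocycles ::
    "('a, 'c) ring_scheme \<Rightarrow> ('a, 'b, 'd) lie_scheme \<Rightarrow> 'b set
      \<Rightarrow> ('a, 'm, 'e) module_scheme \<Rightarrow> ('b \<Rightarrow> 'm \<Rightarrow> 'm) \<Rightarrow> nat \<Rightarrow> ('b list \<Rightarrow> 'm) set" where
  "rel_cocycles F L K M act n =
     {f \<in> rel_cochains F L K M act n.
        ce_diff L M act n f = zero_cochain M (carrier L) (Suc n)}"

definition rel_coboundaries ::
    "('a, 'c) ring_scheme \<Rightarrow> ('a, 'b, 'd) lie_scheme \<Rightarrow> 'b set
      \<Rightarrow> ('a, 'm, 'e) module_scheme \<Rightarrow> ('b \<Rightarrow> 'm \<Rightarrow> 'm) \<Rightarrow> nat \<Rightarrow> ('b list \<Rightarrow> 'm) set" where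
  "rel_coboundaries F L K M act n =
     (case n of 0 \<Rightarrow> {zero_cochain M (carrier L) 0}
      | Suc m \<Rightarrow> ce_diff L M act m ` rel_cochains F L K M act m)"

definition rel_cohomology ::
    "('a, 'c) ring_scheme \<Rightarrow> ('a, 'b, 'd) lie_scheme \<Rightarrow> 'b set
      \<Rightarrow> ('a, 'm, 'e) module_scheme \<Rightarrow> ('b \<Rightarrow> 'm \<Rightarrow> 'm) \<Rightarrow> nat
      \<Rightarrow> ('a, ('b list \<Rightarrow> 'm) set) module" where
  "rel_cohomology F L K M act n =
     quotient_module
       ((cochain_module F L K M act n)\<lparr>carrier := rel_cocycles F L K M act n\<rparr>)
       (rel_coboundaries F L K M act n)"


section \<open>The module of cohomology classes of an ideal\<close>

text \<open>The cohomology space \<open>H\<^sup>q(I, I\<^sub>k; M)\<close>, where \<open>I\<^sub>k = I \<inter> k\<close>.\<close>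

definition ideal_cohomology ::
    "('a, 'c) ring_scheme \<Rightarrow> ('a, 'b, 'd) lie_scheme \<Rightarrow> 'b set \<Rightarrow> 'b set
      \<Rightarrow> ('a, 'm, 'e) module_scheme \<Rightarrow> ('b \<Rightarrow> 'm \<Rightarrow> 'm) \<Rightarrow> nat
      \<Rightarrow> ('a, ('b list \<Rightarrow> 'm) set) module" where
  "ideal_cohomology F g I k M act q =
     rel_cohomology F (g\<lparr>carrier := I\<rparr>) (I \<inter> k) M act q"

definition cohomology_class ::
    "('a, 'c) ring_scheme \<Rightarrow> ('a, 'b, 'd) lie_scheme \<Rightarrow> 'b set \<Rightarrow> 'b set
      \<Rightarrow> ('a, 'm, 'e) module_scheme \<Rightarrow> ('b \<Rightarrow> 'm \<Rightarrow> 'm) \<Rightarrow> nat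
      \<Rightarrow> ('b list \<Rightarrow> 'm) \<Rightarrow> ('b list \<Rightarrow> 'm) set" where
  "cohomology_class F g I k M act q c =
     rel_coboundaries F (g\<lparr>carrier := I\<rparr>) (I \<inter> k) M act q
       +>\<^bsub>cochain_module F (g\<lparr>carrier := I\<rparr>) (I \<inter> k) M act q\<^esub> c"

text \<open>
  The decomposition \<open>g = I\<^sub>k \<oplus> I\<^sub>L \<oplus> J\<^sub>k \<oplus> J\<^sub>L\<close> into \<open>k\<close>-submodules with \<open>I = I\<^sub>k \<oplus> I\<^sub>L\<close>,
  \<open>k = I\<^sub>k \<oplus> J\<^sub>k\<close>, written as nested two-term decompositions.
\<close>

definition adapted_decomp ::
    "('a, 'c) ring_scheme \<Rightarrow> ('a, 'b, 'd) lie_scheme \<Rightarrow> 'b set \<Rightarrow> 'b set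
      \<Rightarrow> 'b set \<Rightarrow> 'b set \<Rightarrow> 'b set \<Rightarrow> bool" where
  "adapted_decomp F g I k I\<^sub>L J\<^sub>k J\<^sub>L \<longleftrightarrow>
     ad_submodule F g k (I \<inter> k) \<and> ad_submodule F g k I\<^sub>L \<and>
     ad_submodule F g k J\<^sub>k \<and> ad_submodule F g k J\<^sub>L \<and>
     direct_decomp g I (I \<inter> k) I\<^sub>L \<and>
     direct_decomp g k (I \<inter> k) J\<^sub>k \<and>
     direct_decomp g (J\<^sub>k <+>\<^bsub>g\<^esub> J\<^sub>L) J\<^sub>k J\<^sub>L \<and>
     direct_decomp g (carrier g) I (J\<^sub>k <+>\<^bsub>g\<^esub> J\<^sub>L)"

text \<open>\<open>x \<mapsto> x\<^sup>+\<close>, the projection onto \<open>J\<close> along \<open>I\<close>.\<close>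

definition plus_part :: "('a, 'b, 'd) lie_scheme \<Rightarrow> 'b set \<Rightarrow> 'b set \<Rightarrow> 'b \<Rightarrow> 'b" where
  "plus_part g I J x = (THE j. j \<in> J \<and> (\<exists>i\<in>I. x = i \<oplus>\<^bsub>g\<^esub> j))"

text \<open>\<open>x \<cdot> [c] = [\<theta>\<^bsub>x\<^sup>+\<^esub> c]\<close>, for \<open>X = x + I\<close> and \<open>h = [c]\<close>.\<close>

definition cohomology_action ::
    "('a, 'c) ring_scheme \<Rightarrow> ('a, 'b, 'd) lie_scheme \<Rightarrow> 'b set \<Rightarrow> 'b set
      \<Rightarrow> ('a, 'm, 'e) module_scheme \<Rightarrow> ('b \<Rightarrow> 'm \<Rightarrow> 'm) \<Rightarrow> 'b set \<Rightarrow> nat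
      \<Rightarrow> 'b set \<Rightarrow> ('b list \<Rightarrow> 'm) set \<Rightarrow> ('b list \<Rightarrow> 'm) set" where
  "cohomology_action F g I k M act J q X h =
     the_elem ((\<lambda>(x, c). cohomology_class F g I k M act q
                  (lie_deriv g M act I q (plus_part g I J x) c)) ` (X \<times> h))"

text \<open>
  \<open>C\<^sup>p(g/I, k/I\<^sub>k; H\<^sup>q(I, I\<^sub>k; M))\<close>, with \<open>k/I\<^sub>k\<close> embedded in \<open>g/I\<close> as the image of \<open>k\<close>.
\<close>

definition quotient_cochains ::
    "('a, 'c) ring_scheme \<Rightarrow> ('a, 'b, 'd) lie_scheme \<Rightarrow> 'b set \<Rightarrow> 'b set
      \<Rightarrow> ('a, 'm, 'e) module_scheme \<Rightarrow> ('b \<Rightarrow> 'm \<Rightarrow> 'm) \<Rightarrow> 'b set \<Rightarrow> nat \<Rightarrow> nat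
      \<Rightarrow> ('b set list \<Rightarrow> ('b list \<Rightarrow> 'm) set) set" where
  "quotient_cochains F g I k M act J p q =
     rel_cochains F (quotient_lie g I) ((\<lambda>x. I +>\<^bsub>g\<^esub> x) ` k)
       (ideal_cohomology F g I k M act q) (cohomology_action F g I k M act J q) p"

definition d_plus ::
    "('a, 'c) ring_scheme \<Rightarrow> ('a, 'b, 'd) lie_scheme \<Rightarrow> 'b set \<Rightarrow> 'b set
      \<Rightarrow> ('a, 'm, 'e) module_scheme \<Rightarrow> ('b \<Rightarrow> 'm \<Rightarrow> 'm) \<Rightarrow> 'b set \<Rightarrow> nat \<Rightarrow> nat
      \<Rightarrow> ('b set list \<Rightarrow> ('b list \<Rightarrow> 'm) set) \<Rightarrow> 'b set list \<Rightarrow> ('b list \<Rightarrow> 'm) set" where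
  "d_plus F g I k M act J p q =
     ce_diff (quotient_lie g I) (ideal_cohomology F g I k M act q)
       (cohomology_action F g I k M act J q) p"


section \<open>The first page of the spectral sequence\<close>

text \<open>
  The condition ``at least \<open>n - p + 1\<close> arguments lie in \<open>I\<close>'' is written without subtraction.
\<close>

definition filtration ::
    "('a, 'c) ring_scheme \<Rightarrow> ('a, 'b, 'd) lie_scheme \<Rightarrow> 'b set \<Rightarrow> 'b set
      \<Rightarrow> ('a, 'm, 'e) module_scheme \<Rightarrow> ('b \<Rightarrow> 'm \<Rightarrow> 'm) \<Rightarrow> nat \<Rightarrow> nat
      \<Rightarrow> ('b list \<Rightarrow> 'm) set" where
  "filtration F g I k M act p n =
     {f \<in> rel_cochains F g k M act n.
        \<forall>xs\<in>tuples (carrier g) n.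
          n + 1 \<le> p + card {i. i < n \<and> xs ! i \<in> I} \<longrightarrow> f xs = \<zero>\<^bsub>M\<^esub>}"

definition Z1 ::
    "('a, 'c) ring_scheme \<Rightarrow> ('a, 'b, 'd) lie_scheme \<Rightarrow> 'b set \<Rightarrow> 'b set
      \<Rightarrow> ('a, 'm, 'e) module_scheme \<Rightarrow> ('b \<Rightarrow> 'm \<Rightarrow> 'm) \<Rightarrow> nat \<Rightarrow> nat
      \<Rightarrow> ('b list \<Rightarrow> 'm) set" where
  "Z1 F g I k M act p q =
     {c \<in> filtration F g I k M act p (p + q).
        ce_diff g M act (p + q) c \<in> filtration F g I k M act (p + 1) (p + q + 1)}"

text \<open>For \<open>p + q = 0\<close> the summand \<open>d F\<^sub>p C\<^bsup>p+q-1\<^esup>\<close> is zero.\<close>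

definition B1 ::
    "('a, 'c) ring_scheme \<Rightarrow> ('a, 'b, 'd) lie_scheme \<Rightarrow> 'b set \<Rightarrow> 'b set
      \<Rightarrow> ('a, 'm, 'e) module_scheme \<Rightarrow> ('b \<Rightarrow> 'm \<Rightarrow> 'm) \<Rightarrow> nat \<Rightarrow> nat
      \<Rightarrow> ('b list \<Rightarrow> 'm) set" where
  "B1 F g I k M act p q =
     (case p + q of 0 \<Rightarrow> {zero_cochain M (carrier g) 0}
      | Suc n \<Rightarrow> ce_diff g M act n ` filtration F g I k M act p n)
     <+>\<^bsub>cochain_module F g k M act (p + q)\<^esub> filtration F g I k M act (p + 1) (p + q)"

definition E1 ::
    "('a, 'c) ring_scheme \<Rightarrow> ('a, 'b, 'd) lie_scheme \<Rightarrow> 'b set \<Rightarrow> 'b set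
      \<Rightarrow> ('a, 'm, 'e) module_scheme \<Rightarrow> ('b \<Rightarrow> 'm \<Rightarrow> 'm) \<Rightarrow> nat \<Rightarrow> nat
      \<Rightarrow> ('a, ('b list \<Rightarrow> 'm) set) module" where
  "E1 F g I k M act p q =
     quotient_module
       ((cochain_module F g k M act (p + q))\<lparr>carrier := Z1 F g I k M act p q\<rparr>)
       (B1 F g I k M act p q)"

definition d1 ::
    "('a, 'c) ring_scheme \<Rightarrow> ('a, 'b, 'd) lie_scheme \<Rightarrow> 'b set \<Rightarrow> 'b set
      \<Rightarrow> ('a, 'm, 'e) module_scheme \<Rightarrow> ('b \<Rightarrow> 'm \<Rightarrow> 'm) \<Rightarrow> nat \<Rightarrow> nat
      \<Rightarrow> ('b list \<Rightarrow> 'm) set \<Rightarrow> ('b list \<Rightarrow> 'm) set" where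
  "d1 F g I k M act p q e =
     the_elem ((\<lambda>c. B1 F g I k M act (p + 1) q
                 +>\<^bsub>cochain_module F g k M act (p + q + 1)\<^esub> ce_diff g M act (p + q) c) ` e)"


section \<open>The comparison map\<close>

text \<open>
  \<open>s\<^sub>p f\<close> as a function on tuples of cosets: \<open>listset Xs\<close> is the set of tuples of
  representatives of \<open>Xs\<close>.
\<close>

definition s_map ::
    "('a, 'b, 'd) lie_scheme \<Rightarrow> 'b set \<Rightarrow> nat \<Rightarrow> nat \<Rightarrow> ('b list \<Rightarrow> 'm)
      \<Rightarrow> 'b set list \<Rightarrow> 'b list \<Rightarrow> 'm" where
  "s_map g I p q f =
     (\<lambda>Xs\<in>tuples (carrier (quotient_lie g I)) p.
        the_elem ((\<lambda>xs. \<lambda>ys\<in>tuples I q. f (xs @ ys)) ` listset Xs))"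

definition alpha ::
    "('a, 'c) ring_scheme \<Rightarrow> ('a, 'b, 'd) lie_scheme \<Rightarrow> 'b set \<Rightarrow> 'b set
      \<Rightarrow> ('a, 'm, 'e) module_scheme \<Rightarrow> ('b \<Rightarrow> 'm \<Rightarrow> 'm) \<Rightarrow> nat \<Rightarrow> nat
      \<Rightarrow> ('b set list \<Rightarrow> 'b list \<Rightarrow> 'm) \<Rightarrow> 'b set list \<Rightarrow> ('b list \<Rightarrow> 'm) set" where
  "alpha F g I k M act p q \<psi> =
     (\<lambda>Xs\<in>tuples (carrier (quotient_lie g I)) p. cohomology_class F g I k M act q (\<psi> Xs))"

definition phi ::
    "('a, 'c) ring_scheme \<Rightarrow> ('a, 'b, 'd) lie_scheme \<Rightarrow> 'b set \<Rightarrow> 'b set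
      \<Rightarrow> ('a, 'm, 'e) module_scheme \<Rightarrow> ('b \<Rightarrow> 'm \<Rightarrow> 'm) \<Rightarrow> nat \<Rightarrow> nat
      \<Rightarrow> ('b list \<Rightarrow> 'm) set \<Rightarrow> 'b set list \<Rightarrow> ('b list \<Rightarrow> 'm) set" where
  "phi F g I k M act p q e =
     the_elem ((\<lambda>c. alpha F g I k M act p q (s_map g I p q c)) ` e)"

end

theory Submission
  imports Defs
begin

text \<open>
  For a cochain \<open>f\<close> and a tuple \<open>xs\<close> write \<open>f\<^sub>x\<^sub>s\<close> for the function \<open>ys \<mapsto> f (xs @ ys)\<close> on tuples of
  elements of \<open>I\<close>.  Cartan's formula \<open>i\<^sub>x d + d i\<^sub>x = \<theta>\<^sub>x\<close> gives, by induction on the length \<open>a + 1\<close> of \<open>xs\<close>,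
  \<open>(d f)\<^sub>x\<^sub>s = (d\<^sub>W f) xs + (-1)\<^sup>a\<^sup>+\<^sup>1 d\<^sub>I (f\<^sub>x\<^sub>s)\<close>, where \<open>d\<^sub>W\<close> is the Chevalley-Eilenberg formula for the
  function \<open>xs \<mapsto> f\<^sub>x\<^sub>s\<close>, with \<open>g\<close> acting on its values by \<open>\<theta>\<close>.  If \<open>f\<close> represents a class of the first page
  and \<open>a = p\<close>, evaluate this on representatives \<open>xs\<close> taken from \<open>J\<close>.  Since \<open>[I\<^sub>k, J] = 0\<close> (the bracket lies in
  \<open>I \<inter> J\<close>), the cochain \<open>f\<^sub>x\<^sub>s\<close> is then relative, so the last summand is a relative coboundary, and on
  cohomology classes the identity becomes \<open>\<phi> (d\<^sub>1 e) = d\<^sub>+ (\<phi> e)\<close>.  The same identity with \<open>a + 1 = p\<close> shows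
  that \<open>f\<^sub>x\<^sub>s\<close> is a cocycle and that \<open>\<phi>\<close> is well defined.
\<close>

section \<open>Cartan's formula for alternating maps\<close>

text \<open>Representatives from \<open>J\<close> are forced by a count. A cochain in
  \<open>Fil p (p + q)\<close> vanishes once q + 1 arguments lie in \<open>I\<close>. With p entries
  in front, replacing an entry x_j by [y, x_j], y in \<open>I \<inter> k\<close>, gives 1 + q such
  arguments, so f_xs is relative for every choice of representatives. With p + 1 entries in front it
  gives only q, and for arbitrary representatives the term with d_I need not be a relative
  coboundary. \<open>J\<close> need not be closed under the bracket, but the bracket terms of d_W
  have only p entries in front, where any representatives may be used. The values f_xs are treated
  inside the space of all functions on tuples from \<open>I\<close>; there \<theta> need not be a
  representation, so Cartan's formula is proved from the defining sums alone. On alternating maps,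
  the commutation of \<theta> with d, the alternation of d f and d d = 0 are then inductions on the
  degree in which the first argument is split off.\<close>

lemma tuples_0: "tuples D 0 = {[]}"
  by (auto simp: tuples_def)

lemma Cons_in_tuples [simp]: "x # xs \<in> tuples D (Suc n) \<longleftrightarrow> x \<in> D \<and> xs \<in> tuples D n"
  by (auto simp: tuples_def)

lemma Nil_in_tuples [simp]: "[] \<in> tuples D n \<longleftrightarrow> n = 0"
  by (auto simp: tuples_def)

lemma tuples_SucE:
  assumes "xs \<in> tuples D (Suc n)"
  obtains y ys where "xs = y # ys" "y \<in> D" "ys \<in> tuples D n"
  using assms by (cases xs) (auto simp: tuples_def)

lemma length_tuples: "xs \<in> tuples D n \<Longrightarrow> length xs = n"
  by (simp add: tuples_def)

lemma nth_tuples [simp]: "xs \<in> tuples D n \<Longrightarrow> i < n \<Longrightarrow> xs ! i \<in> D"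
  by (auto simp: tuples_def)

lemma update_tuples [simp]: "xs \<in> tuples D n \<Longrightarrow> x \<in> D \<Longrightarrow> xs[i := x] \<in> tuples D n"
  using set_update_subset_insert[of xs i x] by (auto simp: tuples_def)

lemma append_tuples [simp]: "xs \<in> tuples D m \<Longrightarrow> ys \<in> tuples D n \<Longrightarrow> xs @ ys \<in> tuples D (m + n)"
  by (auto simp: tuples_def)

lemma tuples_mono: "xs \<in> tuples D n \<Longrightarrow> D \<subseteq> E \<Longrightarrow> xs \<in> tuples E n"
  by (auto simp: tuples_def)

lemma nths_tuples1:
  assumes "xs \<in> tuples D (Suc n)" "i \<le> n"
  shows "nths xs (- {i}) \<in> tuples D n"
proof -
  have "{k. k < length xs \<and> k \<in> - {i}} = {..<length xs} - {i}" by auto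
  with assms show ?thesis
    using set_nths_subset[of xs "- {i}"] by (auto simp: tuples_def length_nths)
qed

lemma nths_tuples2:
  assumes "xs \<in> tuples D (Suc n)" "j \<le> n" "i < j" "z \<in> D"
  shows "z # nths xs (- {i, j}) \<in> tuples D n"
proof -
  have "{k. k < length xs \<and> k \<in> - {i, j}} = {..<length xs} - {i, j}" by auto
  with assms show ?thesis
    using set_nths_subset[of xs "- {i, j}"] by (auto simp: tuples_def length_nths)
qed

text \<open>These are the four cases that occur when position 0 is split off from the sums in
  \<open>ce_diff\<close>.\<close>

lemma nths_Cons_delete:
  "nths (x # xs) (- {0}) = xs"
  "nths (x # xs) (- {Suc k}) = x # nths xs (- {k})"
  "nths (x # xs) (- {0, Suc k}) = nths xs (- {k})"
  "nths (x # xs) (- {Suc l, Suc k}) = x # nths xs (- {l, k})"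
proof -
  have *: "{j. Suc j \<in> - {0}} = UNIV" "{j. Suc j \<in> - {Suc k}} = - {k}"
    "{j. Suc j \<in> - {0, Suc k}} = - {k}" "{j. Suc j \<in> - {Suc l, Suc k}} = - {l, k}" by auto
  show "nths (x # xs) (- {0}) = xs"
    "nths (x # xs) (- {Suc k}) = x # nths xs (- {k})"
    "nths (x # xs) (- {0, Suc k}) = nths xs (- {k})"
    "nths (x # xs) (- {Suc l, Suc k}) = x # nths xs (- {l, k})"
    unfolding nths_Cons * by (simp_all add: nths_all)
qed

section \<open>Finite sums and signs in abelian groups\<close>

context abelian_group
begin

lemma a_inv_zero [simp]: "\<ominus> \<zero> = \<zero>"
  by (metis l_zero minus_equality zero_closed)

lemma finsum_a_inv:
  assumes "finite A" "f \<in> A \<rightarrow> carrier G"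
  shows "(\<Oplus>i\<in>A. \<ominus> f i) = \<ominus> finsum G f A"
  using assms
proof (induction rule: finite_induct)
  case (insert x A)
  then have "f \<in> A \<rightarrow> carrier G" "f x \<in> carrier G" by auto
  with insert show ?case
    by (simp add: Pi_def minus_add a_comm)
qed simp

lemma finsum_const_zero: "(\<And>i. i \<in> A \<Longrightarrow> f i = \<zero>) \<Longrightarrow> finsum G f A = \<zero>"
  using finsum_cong'[of A A "\<lambda>_. \<zero>" f] by simp

text \<open>Half-open ranges allow the remaining sum to be empty, as happens for the inner sums of
  \<open>ce_diff\<close>.\<close>

lemma finsum_lessThan_Suc2:
  assumes "f \<in> {..<Suc n} \<rightarrow> carrier G"
  shows "finsum G f {..<Suc n} = f 0 \<oplus> (\<Oplus>i\<in>{..<n}. f (Suc i))"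
proof (cases n)
  case 0
  with assms show ?thesis by (simp add: lessThan_Suc_atMost)
next
  case (Suc m)
  with assms have "finsum G f {..Suc m} = (\<Oplus>i\<in>{..m}. f (Suc i)) \<oplus> f 0"
    by (intro finsum_Suc2) (auto simp: lessThan_Suc_atMost)
  moreover have "(\<Oplus>i\<in>{..m}. f (Suc i)) \<in> carrier G" "f 0 \<in> carrier G"
    using assms Suc by (auto intro!: finsum_closed)
  ultimately show ?thesis using Suc by (simp add: lessThan_Suc_atMost a_comm)
qed

lemma finsum_lessThan_Suc_last:
  assumes "f \<in> {..<Suc n} \<rightarrow> carrier G"
  shows "finsum G f {..<Suc n} = finsum G f {..<n} \<oplus> f n"
proof -
  have "finsum G f (insert n {..<n}) = f n \<oplus> finsum G f {..<n}"
    using assms by (intro finsum_insert) auto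
  moreover have "finsum G f {..<n} \<in> carrier G" "f n \<in> carrier G"
    using assms by (auto intro!: finsum_closed)
  ultimately show ?thesis by (simp add: lessThan_Suc a_comm)
qed

lemma finsum_lessThan_add:
  fixes m n :: nat
  assumes "f \<in> {..<m + n} \<rightarrow> carrier G"
  shows "finsum G f {..<m + n} = finsum G f {..<m} \<oplus> (\<Oplus>i\<in>{..<n}. f (m + i))"
  using assms
proof (induction n)
  case 0
  then show ?case by (simp add: finsum_closed)
next
  case (Suc n)
  then have f: "\<And>i. i < m + Suc n \<Longrightarrow> f i \<in> carrier G" by auto
  then have "f \<in> {..<m} \<rightarrow> carrier G" "(\<lambda>i. f (m + i)) \<in> {..<n} \<rightarrow> carrier G"
    "(\<lambda>i. f (m + i)) \<in> {..<Suc n} \<rightarrow> carrier G" "f \<in> {..<Suc (m + n)} \<rightarrow> carrier G" by auto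
  with Suc f show ?case
    by (simp add: finsum_lessThan_Suc_last a_assoc finsum_closed Pi_def)
qed

end

locale signed_group = abelian_group M for M :: "('a, 'm, 'e) module_scheme"
begin

lemma alt_sign_closed [simp, intro]: "u \<in> carrier M \<Longrightarrow> alt_sign M i u \<in> carrier M"
  by (simp add: alt_sign_def)

lemma alt_sign_Suc: "u \<in> carrier M \<Longrightarrow> alt_sign M (Suc i) u = \<ominus>\<^bsub>M\<^esub> alt_sign M i u"
  by (simp add: alt_sign_def)

lemma alt_sign_0 [simp]: "alt_sign M 0 u = u"
  by (simp add: alt_sign_def)

lemma alt_sign_zero [simp]: "alt_sign M i \<zero>\<^bsub>M\<^esub> = \<zero>\<^bsub>M\<^esub>"
  by (simp add: alt_sign_def)

lemma alt_sign_add: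
  "u \<in> carrier M \<Longrightarrow> v \<in> carrier M \<Longrightarrow> alt_sign M i (u \<oplus>\<^bsub>M\<^esub> v) = alt_sign M i u \<oplus>\<^bsub>M\<^esub> alt_sign M i v"
  by (simp add: alt_sign_def minus_add a_comm)

lemma alt_sign_minus: "u \<in> carrier M \<Longrightarrow> alt_sign M i (\<ominus>\<^bsub>M\<^esub> u) = \<ominus>\<^bsub>M\<^esub> alt_sign M i u"
  by (simp add: alt_sign_def)

end

text \<open>No Jacobi identity and no action law: Cartan's formula is also used for values in \<open>W\<close>.\<close>

locale bracket_action = M: signed_group M
  for F :: "('a, 'c) ring_scheme" and L :: "('a, 'b, 'd) lie_scheme"
    and M :: "('a, 'm, 'e) module_scheme" and act :: "'b \<Rightarrow> 'm \<Rightarrow> 'm" +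
  assumes L_add: "\<And>x y. x \<in> carrier L \<Longrightarrow> y \<in> carrier L \<Longrightarrow> x \<oplus>\<^bsub>L\<^esub> y \<in> carrier L"
    and L_smult: "\<And>a x. a \<in> carrier F \<Longrightarrow> x \<in> carrier L \<Longrightarrow> a \<odot>\<^bsub>L\<^esub> x \<in> carrier L"
    and L_bracket: "\<And>x y. x \<in> carrier L \<Longrightarrow> y \<in> carrier L \<Longrightarrow> bracket L x y \<in> carrier L"
    and L_act: "\<And>x u. x \<in> carrier L \<Longrightarrow> u \<in> carrier M \<Longrightarrow> act x u \<in> carrier M"
begin

lemma alternating_closed:
  "f \<in> alternating_maps F L M n \<Longrightarrow> xs \<in> tuples (carrier L) n \<Longrightarrow> f xs \<in> carrier M"
  by (auto simp: alternating_maps_def)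

lemma alternating_add:
  "f \<in> alternating_maps F L M n \<Longrightarrow> xs \<in> tuples (carrier L) n \<Longrightarrow> i < n \<Longrightarrow> x \<in> carrier L
    \<Longrightarrow> y \<in> carrier L \<Longrightarrow> f (xs[i := x \<oplus>\<^bsub>L\<^esub> y]) = f (xs[i := x]) \<oplus>\<^bsub>M\<^esub> f (xs[i := y])"
  by (auto simp: alternating_maps_def)

lemma alternating_smult:
  "f \<in> alternating_maps F L M n \<Longrightarrow> xs \<in> tuples (carrier L) n \<Longrightarrow> i < n \<Longrightarrow> x \<in> carrier L
    \<Longrightarrow> a \<in> carrier F \<Longrightarrow> f (xs[i := a \<odot>\<^bsub>L\<^esub> x]) = a \<odot>\<^bsub>M\<^esub> f (xs[i := x])"
  by (auto simp: alternating_maps_def)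

lemma alternating_eq:
  "f \<in> alternating_maps F L M n \<Longrightarrow> xs \<in> tuples (carrier L) n \<Longrightarrow> i < j \<Longrightarrow> j < n
    \<Longrightarrow> xs ! i = xs ! j \<Longrightarrow> f xs = \<zero>\<^bsub>M\<^esub>"
  by (auto simp: alternating_maps_def)

lemma alternating_head_add:
  assumes "f \<in> alternating_maps F L M (Suc n)" "x \<in> carrier L" "y \<in> carrier L" "xs \<in> tuples (carrier L) n"
  shows "f ((x \<oplus>\<^bsub>L\<^esub> y) # xs) = f (x # xs) \<oplus>\<^bsub>M\<^esub> f (y # xs)"
  using alternating_add[of f "Suc n" "x # xs" 0 x y] assms by simp

lemma alternating_head_smult:
  assumes "f \<in> alternating_maps F L M (Suc n)" "x \<in> carrier L" "a \<in> carrier F" "xs \<in> tuples (carrier L) n"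
  shows "f ((a \<odot>\<^bsub>L\<^esub> x) # xs) = a \<odot>\<^bsub>M\<^esub> f (x # xs)"
  using alternating_smult[of f "Suc n" "x # xs" 0 x a] assms by simp

text \<open>Polarisation: the value with x + y in both slots is zero, and bilinear expansion leaves
  the two mixed terms. \<open>alternating_maps\<close> postulates vanishing on repeated entries, so
  no division by 2 occurs.\<close>

lemma alternating_swap:
  assumes f: "f \<in> alternating_maps F L M n" and xs: "xs \<in> tuples (carrier L) n"
    and ij: "i < j" "j < n" and xy: "x \<in> carrier L" "y \<in> carrier L"
  shows "f (xs[i := x, j := y]) = \<ominus>\<^bsub>M\<^esub> f (xs[i := y, j := x])"
proof -
  define h where "h u v = f (xs[i := u, j := v])" for u v
  have add2: "h u (v \<oplus>\<^bsub>L\<^esub> w) = h u v \<oplus>\<^bsub>M\<^esub> h u w"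
    if "u \<in> carrier L" "v \<in> carrier L" "w \<in> carrier L" for u v w
    unfolding h_def using that f xs ij by (intro alternating_add) auto
  have add1: "h (v \<oplus>\<^bsub>L\<^esub> w) u = h v u \<oplus>\<^bsub>M\<^esub> h w u"
    if "u \<in> carrier L" "v \<in> carrier L" "w \<in> carrier L" for u v w
    using alternating_add[OF f, of "xs[j := u]" i v w] that xs ij
    by (simp add: h_def list_update_swap[of i j])
  have diag: "h u u = \<zero>\<^bsub>M\<^esub>" if "u \<in> carrier L" for u
    unfolding h_def using that xs ij
    by (intro alternating_eq[OF f, of _ i j]) (auto simp: length_tuples)
  have cl: "h u v \<in> carrier M" if "u \<in> carrier L" "v \<in> carrier L" for u v
    unfolding h_def using that xs by (intro alternating_closed[OF f]) auto
  have "\<zero>\<^bsub>M\<^esub> = h (x \<oplus>\<^bsub>L\<^esub> y) (x \<oplus>\<^bsub>L\<^esub> y)" by (simp add: diag L_add xy)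
  also have "\<dots> = h x y \<oplus>\<^bsub>M\<^esub> h y x"
    using xy by (simp add: add1 add2 L_add diag[OF xy(1)] diag[OF xy(2)] cl M.a_comm)
  finally have "h x y = \<ominus>\<^bsub>M\<^esub> h y x" using cl xy by (metis M.minus_equality)
  then show ?thesis by (simp add: h_def)
qed

lemma alternating_head_swap:
  assumes "f \<in> alternating_maps F L M (Suc (Suc n))" "x \<in> carrier L" "y \<in> carrier L"
    and "xs \<in> tuples (carrier L) n"
  shows "f (x # y # xs) = \<ominus>\<^bsub>M\<^esub> f (y # x # xs)"
  using alternating_swap[of f "Suc (Suc n)" "x # y # xs" 0 1 x y] assms by simp

lemma insertion_alternating:
  assumes f: "f \<in> alternating_maps F L M (Suc n)" and x: "x \<in> carrier L"
  shows "insertion (carrier L) n x f \<in> alternating_maps F L M n"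
proof -
  have add: "f (x # xs[i := y \<oplus>\<^bsub>L\<^esub> z]) = f (x # xs[i := y]) \<oplus>\<^bsub>M\<^esub> f (x # xs[i := z])"
    if "xs \<in> tuples (carrier L) n" "i < n" "y \<in> carrier L" "z \<in> carrier L" for xs i y z
    using alternating_add[OF f, of "x # xs" "Suc i" y z] that x by simp
  have sm: "f (x # xs[i := a \<odot>\<^bsub>L\<^esub> y]) = a \<odot>\<^bsub>M\<^esub> f (x # xs[i := y])"
    if "xs \<in> tuples (carrier L) n" "i < n" "y \<in> carrier L" "a \<in> carrier F" "a \<odot>\<^bsub>L\<^esub> y \<in> carrier L" for xs i y a
    using alternating_smult[OF f, of "x # xs" "Suc i" y a] that x by simp
  have eq: "f (x # xs) = \<zero>\<^bsub>M\<^esub>"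
    if "xs \<in> tuples (carrier L) n" "i < j" "j < n" "xs ! i = xs ! j" for xs i j
    using alternating_eq[OF f, of "x # xs" "Suc i" "Suc j"] that x by simp
  have "f (x # xs) \<in> carrier M" if "xs \<in> tuples (carrier L) n" for xs
    using that x by (intro alternating_closed[OF f]) simp
  with add sm eq show ?thesis
    unfolding alternating_maps_def[of F L M n] insertion_def
    by (auto simp: L_add L_smult)
qed

text \<open>Moving y between the front and position m costs m adjacent transpositions. The induction
  swaps y past the first entry z and applies the hypothesis to the insertion of z.\<close>

lemma alternating_move:
  assumes "f \<in> alternating_maps F L M (Suc n)" "xs \<in> tuples (carrier L) (Suc n)" "m \<le> n"
    and "y \<in> carrier L"
  shows "f (y # nths xs (- {m})) = alt_sign M m (f (xs[m := y]))"
  using assms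
proof (induction m arbitrary: n f xs)
  case 0
  then show ?case by (elim tuples_SucE) (simp add: nths_Cons_delete)
next
  case (Suc m)
  then obtain k where n: "n = Suc k" by (cases n) auto
  from Suc.prems(2) obtain z zs where xs: "xs = z # zs" "z \<in> carrier L" "zs \<in> tuples (carrier L) n"
    by (rule tuples_SucE)
  let ?f = "insertion (carrier L) n z f"
  have nths: "nths zs (- {m}) \<in> tuples (carrier L) k"
    using xs n Suc.prems by (intro nths_tuples1) auto
  have cl: "f (z # zs[m := y]) \<in> carrier M"
    using Suc.prems xs by (intro alternating_closed[OF Suc.prems(1)]) simp
  have "f (y # nths xs (- {Suc m})) = \<ominus>\<^bsub>M\<^esub> f (z # y # nths zs (- {m}))"
    using Suc.prems xs nths n
    by (simp add: nths_Cons_delete alternating_head_swap[of f k y z])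
  also have "f (z # y # nths zs (- {m})) = ?f (y # nths zs (- {m}))"
    using nths n Suc.prems by (simp add: insertion_def)
  also have "\<dots> = alt_sign M m (?f (zs[m := y]))"
    using Suc.prems xs n by (intro Suc.IH) (auto intro: insertion_alternating)
  also have "?f (zs[m := y]) = f (z # zs[m := y])"
    using xs Suc.prems by (simp add: insertion_def)
  finally show ?case using xs cl by (simp add: M.alt_sign_Suc)
qed

lemma ce_diff_closed:
  assumes f: "f \<in> tuples (carrier L) n \<rightarrow> carrier M" and xs: "xs \<in> tuples (carrier L) (Suc n)"
  shows "ce_diff L M act n f xs \<in> carrier M"
proof -
  have "f (nths xs (- {i})) \<in> carrier M" if "i \<le> n" for i
    using f nths_tuples1[OF xs that] by auto
  moreover have "f (bracket L (xs ! i) (xs ! j) # nths xs (- {i, j})) \<in> carrier M"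
    if ij: "j \<le> n" "i < j" for i j
    using ij xs by (intro funcset_mem[OF f] nths_tuples2[OF xs]) (auto intro!: L_bracket)
  ultimately show ?thesis using xs
    by (auto simp: ce_diff_def intro!: M.a_closed M.finsum_closed M.alt_sign_closed L_act)
qed

text \<open>In degree 0 there is nothing to insert into, so the formula loses its second
  term.\<close>

lemma cartan_0:
  assumes "f \<in> alternating_maps F L M 0" "x \<in> carrier L"
  shows "ce_diff L M act 0 f [x] = lie_deriv L M act (carrier L) 0 x f []"
  using assms alternating_closed[of f 0 "[]"] L_act
  by (simp add: ce_diff_def lie_deriv_def nths_Cons_delete a_minus_def M.finsum_0 Pi_def M.finsum_empty)

text \<open>The terms of the differential at x # xs that keep x as an argument of f are, up to sign,
  those of the differential of i_x f at xs. The terms that consume x, by action or by bracket, add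
  up to \<theta>_x f.\<close>

lemma cartan:
  assumes f: "f \<in> alternating_maps F L M (Suc n)" and x: "x \<in> carrier L"
    and xs: "xs \<in> tuples (carrier L) (Suc n)"
  shows "ce_diff L M act (Suc n) f (x # xs)
    = lie_deriv L M act (carrier L) (Suc n) x f xs
        \<ominus>\<^bsub>M\<^esub> ce_diff L M act n (insertion (carrier L) n x f) xs"
proof -
  define g where "g = insertion (carrier L) n x f"
  have g: "g \<in> alternating_maps F L M n" unfolding g_def by (rule insertion_alternating[OF f x])
  define A where "A zs f i = alt_sign M i (act (zs ! i) (f (nths zs (- {i}))))" for zs f i
  define B where "B zs f j i = alt_sign M (i + j) (f (bracket L (zs ! i) (zs ! j) # nths zs (- {i, j})))"
    for zs f j i
  note cl = alternating_closed[OF f] alternating_closed[OF g]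
  have Ag_cl: "A xs g i \<in> carrier M" if "i < Suc n" for i
    unfolding A_def using that xs nths_tuples1[OF xs] by (auto intro!: L_act cl)
  have nths2: "bracket L (xs ! i) (xs ! j) # nths xs (- {i, j}) \<in> tuples (carrier L) n"
    if ij: "j < Suc n" "i < j" for i j
    using ij xs by (intro nths_tuples2[OF xs] L_bracket) auto
  have Bg_cl: "B xs g j i \<in> carrier M" if "j < Suc n" "i < j" for i j
    unfolding B_def using nths2[OF that] by (auto intro!: cl)
  have A_0: "A (x # xs) f 0 = act x (f xs)" by (simp add: A_def nths_Cons_delete)
  \<comment> \<open>The shift of the index by one gives the minus sign; x stays in front, so no
    transposition occurs.\<close>
  have A_Suc: "A (x # xs) f (Suc i) = \<ominus>\<^bsub>M\<^esub> A xs g i" if "i < Suc n" for i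
  proof -
    have "nths xs (- {i}) \<in> tuples (carrier L) n" using that xs by (intro nths_tuples1) auto
    then show ?thesis using that xs x
      by (simp add: A_def nths_Cons_delete g_def insertion_def M.alt_sign_Suc L_act cl)
  qed
  \<comment> \<open>Both indices shift, so the sign of the position is unchanged; the minus comes
    from moving x in front of the bracket.\<close>
  have B_Suc: "B (x # xs) f (Suc j) (Suc i) = \<ominus>\<^bsub>M\<^esub> B xs g j i" if ij: "j < Suc n" "i < j" for i j
  proof -
    from ij obtain k where k: "n = Suc k" by (cases n) auto
    then have n2: "nths xs (- {i, j}) \<in> tuples (carrier L) k"
      using nths2[OF ij] by simp
    have "f (bracket L (xs ! i) (xs ! j) # x # nths xs (- {i, j}))
        = \<ominus>\<^bsub>M\<^esub> f (x # bracket L (xs ! i) (xs ! j) # nths xs (- {i, j}))"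
      using n2 k f x ij xs by (intro alternating_head_swap[of f k]) (auto intro!: L_bracket)
    also have "\<dots> = \<ominus>\<^bsub>M\<^esub> g (bracket L (xs ! i) (xs ! j) # nths xs (- {i, j}))"
      using nths2[OF ij] by (simp add: g_def insertion_def)
    finally show ?thesis
      using cl(2)[OF nths2[OF ij]] by (simp add: B_def nths_Cons_delete M.alt_sign_Suc M.alt_sign_minus)
  qed
  \<comment> \<open>The sign at positions 0 and j + 1 is (-1)^(j+1). Moving the bracket to position
    j, where \<theta> has it, contributes (-1)^j, so every term ends up with sign -1.\<close>
  have B_0: "B (x # xs) f (Suc j) 0 = \<ominus>\<^bsub>M\<^esub> f (xs[j := bracket L x (xs ! j)])" if j: "j < Suc n" for j
  proof -
    have "f (xs[j := bracket L x (xs ! j)]) \<in> carrier M"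
      using j x xs by (intro cl) (auto intro!: update_tuples L_bracket)
    moreover have "alt_sign M j (alt_sign M j u) = u" if "u \<in> carrier M" for u
      using that by (simp add: alt_sign_def)
    ultimately show ?thesis
      using alternating_move[OF f xs, of j "bracket L x (xs ! j)"] j x xs
      by (simp add: B_def nths_Cons_delete M.alt_sign_Suc L_bracket)
  qed
  define S where "S = (\<Oplus>\<^bsub>M\<^esub>j\<in>{..<Suc n}. f (xs[j := bracket L x (xs ! j)]))"
  have f_cl: "f (xs[j := bracket L x (xs ! j)]) \<in> carrier M" if "j < Suc n" for j
    using that x xs by (intro cl) (auto intro!: update_tuples L_bracket)
  then have S_cl: "S \<in> carrier M" unfolding S_def by (auto intro!: M.finsum_closed)
  define A' where "A' = (\<Oplus>\<^bsub>M\<^esub>i\<in>{..<Suc n}. A xs g i)"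
  define B' where "B' = (\<Oplus>\<^bsub>M\<^esub>j\<in>{..<Suc n}. \<Oplus>\<^bsub>M\<^esub>i\<in>{..<j}. B xs g j i)"
  have A'_cl: "A' \<in> carrier M" unfolding A'_def using Ag_cl by (auto intro!: M.finsum_closed)
  have Bi_cl: "(\<Oplus>\<^bsub>M\<^esub>i\<in>{..<j}. B xs g j i) \<in> carrier M" if "j < Suc n" for j
    using that Bg_cl by (auto intro!: M.finsum_closed)
  then have B'_cl: "B' \<in> carrier M" unfolding B'_def by (auto intro!: M.finsum_closed)
  have "(\<Oplus>\<^bsub>M\<^esub>i\<in>{..<Suc (Suc n)}. A (x # xs) f i) = A (x # xs) f 0 \<oplus>\<^bsub>M\<^esub> (\<Oplus>\<^bsub>M\<^esub>i\<in>{..<Suc n}. A (x # xs) f (Suc i))"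
  proof (rule M.finsum_lessThan_Suc2, safe)
    fix i assume "i < Suc (Suc n)"
    then show "A (x # xs) f i \<in> carrier M"
      using x xs f by (cases i) (auto simp: A_0 A_Suc Ag_cl intro!: L_act cl M.a_inv_closed)
  qed
  also have "(\<Oplus>\<^bsub>M\<^esub>i\<in>{..<Suc n}. A (x # xs) f (Suc i)) = (\<Oplus>\<^bsub>M\<^esub>i\<in>{..<Suc n}. \<ominus>\<^bsub>M\<^esub> A xs g i)"
    using A_Suc Ag_cl by (intro M.finsum_cong') auto
  also have "\<dots> = \<ominus>\<^bsub>M\<^esub> A'"
    unfolding A'_def using Ag_cl by (intro M.finsum_a_inv) auto
  finally have SA: "(\<Oplus>\<^bsub>M\<^esub>i\<in>{..<Suc (Suc n)}. A (x # xs) f i) = act x (f xs) \<oplus>\<^bsub>M\<^esub> \<ominus>\<^bsub>M\<^esub> A'"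
    by (simp add: A_0)
  have inner: "(\<Oplus>\<^bsub>M\<^esub>i\<in>{..<Suc j}. B (x # xs) f (Suc j) i)
      = \<ominus>\<^bsub>M\<^esub> f (xs[j := bracket L x (xs ! j)]) \<oplus>\<^bsub>M\<^esub> \<ominus>\<^bsub>M\<^esub> (\<Oplus>\<^bsub>M\<^esub>i\<in>{..<j}. B xs g j i)"
    if j: "j < Suc n" for j
  proof -
    have "(\<Oplus>\<^bsub>M\<^esub>i\<in>{..<Suc j}. B (x # xs) f (Suc j) i)
        = B (x # xs) f (Suc j) 0 \<oplus>\<^bsub>M\<^esub> (\<Oplus>\<^bsub>M\<^esub>i\<in>{..<j}. B (x # xs) f (Suc j) (Suc i))"
    proof (rule M.finsum_lessThan_Suc2, safe)
      fix i assume "i < Suc j"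
      then show "B (x # xs) f (Suc j) i \<in> carrier M"
        using j by (cases i) (auto simp: B_0 B_Suc Bg_cl f_cl intro!: M.a_inv_closed)
    qed
    also have "(\<Oplus>\<^bsub>M\<^esub>i\<in>{..<j}. B (x # xs) f (Suc j) (Suc i)) = (\<Oplus>\<^bsub>M\<^esub>i\<in>{..<j}. \<ominus>\<^bsub>M\<^esub> B xs g j i)"
      using j B_Suc Bg_cl by (intro M.finsum_cong') auto
    also have "\<dots> = \<ominus>\<^bsub>M\<^esub> (\<Oplus>\<^bsub>M\<^esub>i\<in>{..<j}. B xs g j i)"
      using j Bg_cl by (intro M.finsum_a_inv) auto
    finally show ?thesis using j by (simp add: B_0)
  qed
  \<comment> \<open>The row j = 0 has no index below it, hence the zero summand.\<close>
  have "(\<Oplus>\<^bsub>M\<^esub>j\<in>{..<Suc (Suc n)}. \<Oplus>\<^bsub>M\<^esub>i\<in>{..<j}. B (x # xs) f j i)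
      = \<zero>\<^bsub>M\<^esub> \<oplus>\<^bsub>M\<^esub> (\<Oplus>\<^bsub>M\<^esub>j\<in>{..<Suc n}. \<Oplus>\<^bsub>M\<^esub>i\<in>{..<Suc j}. B (x # xs) f (Suc j) i)"
  proof (subst M.finsum_lessThan_Suc2, safe)
    fix j assume "j < Suc (Suc n)"
    then show "(\<Oplus>\<^bsub>M\<^esub>i\<in>{..<j}. B (x # xs) f j i) \<in> carrier M"
      using inner Bi_cl f_cl by (cases j) (auto intro!: M.a_closed M.a_inv_closed)
  qed simp
  also have "(\<Oplus>\<^bsub>M\<^esub>j\<in>{..<Suc n}. \<Oplus>\<^bsub>M\<^esub>i\<in>{..<Suc j}. B (x # xs) f (Suc j) i)
     = (\<Oplus>\<^bsub>M\<^esub>j\<in>{..<Suc n}. \<ominus>\<^bsub>M\<^esub> f (xs[j := bracket L x (xs ! j)]) \<oplus>\<^bsub>M\<^esub> \<ominus>\<^bsub>M\<^esub> (\<Oplus>\<^bsub>M\<^esub>i\<in>{..<j}. B xs g j i))"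
    using inner f_cl Bi_cl by (intro M.finsum_cong') auto
  also have "\<dots> = \<ominus>\<^bsub>M\<^esub> S \<oplus>\<^bsub>M\<^esub> \<ominus>\<^bsub>M\<^esub> B'"
    unfolding S_def B'_def using f_cl Bi_cl
    by (subst M.finsum_addf) (auto simp: M.finsum_a_inv)
  finally have SB: "(\<Oplus>\<^bsub>M\<^esub>j\<in>{..<Suc (Suc n)}. \<Oplus>\<^bsub>M\<^esub>i\<in>{..<j}. B (x # xs) f j i) = \<ominus>\<^bsub>M\<^esub> S \<oplus>\<^bsub>M\<^esub> \<ominus>\<^bsub>M\<^esub> B'"
    using S_cl B'_cl by simp
  have "ce_diff L M act (Suc n) f (x # xs) = (act x (f xs) \<oplus>\<^bsub>M\<^esub> \<ominus>\<^bsub>M\<^esub> A') \<oplus>\<^bsub>M\<^esub> (\<ominus>\<^bsub>M\<^esub> S \<oplus>\<^bsub>M\<^esub> \<ominus>\<^bsub>M\<^esub> B')"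
    using SA SB x xs by (simp add: ce_diff_def A_def B_def lessThan_Suc_atMost)
  moreover have "ce_diff L M act n g xs = A' \<oplus>\<^bsub>M\<^esub> B'"
    using xs by (simp add: ce_diff_def A_def B_def A'_def B'_def lessThan_Suc_atMost)
  moreover have "lie_deriv L M act (carrier L) (Suc n) x f xs = act x (f xs) \<oplus>\<^bsub>M\<^esub> \<ominus>\<^bsub>M\<^esub> S"
    using xs by (simp add: lie_deriv_def S_def a_minus_def)
  moreover have "act x (f xs) \<in> carrier M" using x xs by (intro L_act cl)
  ultimately show ?thesis
    unfolding g_def[symmetric] using A'_cl B'_cl S_cl by (simp add: a_minus_def M.minus_add M.a_ac)
qed

end

section \<open>Modules of functions on tuples\<close>

context abelian_group
begin

lemma minus_minus_eq: "\<lbrakk>a \<in> carrier G; b \<in> carrier G; c \<in> carrier G\<rbrakk> \<Longrightarrow> a \<ominus> (b \<ominus> c) = (a \<oplus> c) \<ominus> b"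
  by (simp add: a_minus_def minus_add a_ac)

lemma minus_minus_eq': "\<lbrakk>a \<in> carrier G; b \<in> carrier G; c \<in> carrier G\<rbrakk> \<Longrightarrow> (a \<ominus> b) \<ominus> c = a \<ominus> (b \<oplus> c)"
  by (simp add: a_minus_def minus_add a_ac)

lemma add_minus_eq: "\<lbrakk>a \<in> carrier G; b \<in> carrier G; c \<in> carrier G\<rbrakk> \<Longrightarrow> a \<oplus> (b \<ominus> c) = (a \<oplus> b) \<ominus> c"
  by (simp add: a_minus_def a_ac)

lemma minus_add_eq: "\<lbrakk>a \<in> carrier G; b \<in> carrier G; c \<in> carrier G\<rbrakk> \<Longrightarrow> (a \<ominus> b) \<oplus> c = (a \<oplus> c) \<ominus> b"
  by (simp add: a_minus_def a_ac)

lemma minus_eq_iff: "\<lbrakk>a \<in> carrier G; b \<in> carrier G; c \<in> carrier G\<rbrakk> \<Longrightarrow> a \<ominus> b = c \<longleftrightarrow> a = c \<oplus> b"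
  by (metis a_minus_def add.inv_solve_right')

lemma eq_minus_iff: "\<lbrakk>a \<in> carrier G; b \<in> carrier G; c \<in> carrier G\<rbrakk> \<Longrightarrow> c = a \<ominus> b \<longleftrightarrow> a = c \<oplus> b"
  using minus_eq_iff by metis

lemmas minus_simps = minus_minus_eq minus_minus_eq' add_minus_eq minus_add_eq minus_eq_iff eq_minus_iff a_ac

lemma a_minus_self: "x \<in> carrier G \<Longrightarrow> x \<ominus> x = \<zero>"
  by (simp add: a_minus_def r_neg)

end

context bracket_action
begin

text \<open>A recursive test for maps such as \<theta>_x f and d f that are accessible through their
  insertions: the first slot is tested directly, all later slots inside an insertion. The link
  between them is a repetition of the first entry, for which the adjacent case suffices.\<close>

lemma alternating_SucI:
  assumes f: "f \<in> tuples (carrier L) (Suc n) \<rightarrow>\<^sub>E carrier M"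
    and ins: "\<And>x. x \<in> carrier L \<Longrightarrow> insertion (carrier L) n x f \<in> alternating_maps F L M n"
    and add: "\<And>x y ys. x \<in> carrier L \<Longrightarrow> y \<in> carrier L \<Longrightarrow> ys \<in> tuples (carrier L) n
      \<Longrightarrow> f ((x \<oplus>\<^bsub>L\<^esub> y) # ys) = f (x # ys) \<oplus>\<^bsub>M\<^esub> f (y # ys)"
    and smult: "\<And>a x ys. a \<in> carrier F \<Longrightarrow> x \<in> carrier L \<Longrightarrow> ys \<in> tuples (carrier L) n
      \<Longrightarrow> f ((a \<odot>\<^bsub>L\<^esub> x) # ys) = a \<odot>\<^bsub>M\<^esub> f (x # ys)"
    and diag: "\<And>m x ys. n = Suc m \<Longrightarrow> x \<in> carrier L \<Longrightarrow> ys \<in> tuples (carrier L) m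
      \<Longrightarrow> f (x # x # ys) = \<zero>\<^bsub>M\<^esub>"
  shows "f \<in> alternating_maps F L M (Suc n)"
proof -
  have ins_eq: "f (z # zs) = insertion (carrier L) n z f zs" if "zs \<in> tuples (carrier L) n" for z zs
    using that by (simp add: insertion_def)
  have 1: "f (xs[i := x \<oplus>\<^bsub>L\<^esub> y]) = f (xs[i := x]) \<oplus>\<^bsub>M\<^esub> f (xs[i := y])"
    if "xs \<in> tuples (carrier L) (Suc n)" "i < Suc n" "x \<in> carrier L" "y \<in> carrier L" for xs i x y
  proof -
    from that obtain z zs where xs: "xs = z # zs" "z \<in> carrier L" "zs \<in> tuples (carrier L) n"
      by (elim tuples_SucE)
    show ?thesis
    proof (cases i)
      case (Suc j)
      then show ?thesis using that xs alternating_add[OF ins[OF xs(2)] xs(3), of j x y]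
        by (simp add: ins_eq L_add)
    qed (use that xs in \<open>simp add: add\<close>)
  qed
  have 2: "f (xs[i := a \<odot>\<^bsub>L\<^esub> x]) = a \<odot>\<^bsub>M\<^esub> f (xs[i := x])"
    if "xs \<in> tuples (carrier L) (Suc n)" "i < Suc n" "x \<in> carrier L" "a \<in> carrier F" for xs i x a
  proof -
    from that obtain z zs where xs: "xs = z # zs" "z \<in> carrier L" "zs \<in> tuples (carrier L) n"
      by (elim tuples_SucE)
    show ?thesis
    proof (cases i)
      case (Suc j)
      then show ?thesis using that xs alternating_smult[OF ins[OF xs(2)] xs(3), of j x a]
        by (simp add: ins_eq L_smult)
    qed (use that xs in \<open>simp add: smult\<close>)
  qed
  have 3: "f xs = \<zero>\<^bsub>M\<^esub>"
    if "xs \<in> tuples (carrier L) (Suc n)" "i < j" "j < Suc n" "xs ! i = xs ! j" for xs i j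
  proof -
    from that obtain x ys where xs: "xs = x # ys" "x \<in> carrier L" "ys \<in> tuples (carrier L) n"
      by (elim tuples_SucE)
    note alt = ins[OF xs(2)]
    show ?thesis
    proof (cases i)
      case (Suc i')
      then obtain j' where "j = Suc j'" using \<open>i < j\<close> by (cases j) auto
      with Suc show ?thesis using that xs alternating_eq[OF alt xs(3), of i' j'] by (simp add: ins_eq)
    next
      case 0
      then obtain j' where j: "j = Suc j'" "j' < n" "ys ! j' = x"
        using \<open>i < j\<close> \<open>j < Suc n\<close> \<open>xs ! i = xs ! j\<close> xs by (cases j) auto
      then obtain m where m: "n = Suc m" by (cases n) auto
      with xs obtain y zs where ys: "ys = y # zs" "y \<in> carrier L" "zs \<in> tuples (carrier L) m"
        by (auto elim: tuples_SucE)
      show ?thesis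
      proof (cases j')
        case 0
        then show ?thesis using diag[OF m] xs ys j by simp
      next
        case (Suc k)
        have upd: "zs[k := x] = zs" using j Suc ys by auto
        \<comment> \<open>The entries in slots 1 and k + 2 of xs are exchanged inside the insertion
          of x, which turns a distant repetition of x into an adjacent one.\<close>
        have "insertion (carrier L) n x f (ys[0 := y, Suc k := x])
            = \<ominus>\<^bsub>M\<^esub> insertion (carrier L) n x f (ys[0 := x, Suc k := y])"
          using j Suc xs ys by (intro alternating_swap[OF alt]) auto
        moreover have "f (x # x # zs[k := y]) = \<zero>\<^bsub>M\<^esub>" using diag[OF m] xs ys by simp
        ultimately show ?thesis using xs ys m upd by (simp add: insertion_def)
      qed
    qed
  qed
  from f 1 2 3 show ?thesis unfolding alternating_maps_def by blast
qed

end

section \<open>Submodules, and the module of all functions on tuples\<close>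

lemma (in module) submodule_smultI:
  assumes "H \<subseteq> carrier M" "\<zero>\<^bsub>M\<^esub> \<in> H" "\<And>a b. a \<in> H \<Longrightarrow> b \<in> H \<Longrightarrow> a \<oplus>\<^bsub>M\<^esub> b \<in> H"
    "\<And>a x. a \<in> carrier R \<Longrightarrow> x \<in> H \<Longrightarrow> a \<odot>\<^bsub>M\<^esub> x \<in> H"
  shows "submodule H R M"
proof (rule submoduleI)
  fix x assume x: "x \<in> H"
  then have "\<ominus>\<^bsub>M\<^esub> x = (\<ominus>\<^bsub>R\<^esub> \<one>\<^bsub>R\<^esub>) \<odot>\<^bsub>M\<^esub> x"
    using assms(1) by (auto simp: smult_l_minus)
  then show "\<ominus>\<^bsub>M\<^esub> x \<in> H" using assms(4) x by simp
qed (use assms in auto)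

text \<open>Matches the linear combination lemmas for \<theta> and d; the coefficients 1, 1 and a, 0
  recover sums and multiples.\<close>

lemma (in module) submodule_lincombI:
  assumes sub: "H \<subseteq> carrier M" and zero: "\<zero>\<^bsub>M\<^esub> \<in> H"
    and lin: "\<And>a b x y. a \<in> carrier R \<Longrightarrow> b \<in> carrier R \<Longrightarrow> x \<in> H \<Longrightarrow> y \<in> H
      \<Longrightarrow> a \<odot>\<^bsub>M\<^esub> x \<oplus>\<^bsub>M\<^esub> b \<odot>\<^bsub>M\<^esub> y \<in> H"
  shows "submodule H R M"
proof (rule submodule_smultI[OF sub zero])
  fix x y assume "x \<in> H" "y \<in> H"
  then show "x \<oplus>\<^bsub>M\<^esub> y \<in> H" using lin[of "\<one>\<^bsub>R\<^esub>" "\<one>\<^bsub>R\<^esub>" x y] sub by (simp add: subset_iff)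
next
  fix a x assume "a \<in> carrier R" "x \<in> H"
  then show "a \<odot>\<^bsub>M\<^esub> x \<in> H" using lin[of a "\<zero>\<^bsub>R\<^esub>" x x] sub by (simp add: subset_iff)
qed

text \<open>The common ambient space of all cochain spaces of degree n on \<open>D\<close>: relative
  cochains, cocycles, coboundaries and filtration steps are submodules of it. The meaningless fields
  \<open>mult\<close> and \<open>one\<close> are \<open>undefined\<close> as in
  \<open>cochain_module\<close>, which makes \<open>cochain_module_eq\<close> an equation between
  records.\<close>

definition fun_module ::
    "('a, 'm, 'e) module_scheme \<Rightarrow> 'b set \<Rightarrow> nat \<Rightarrow> ('a, 'b list \<Rightarrow> 'm) module" where
  "fun_module M D n =
     \<lparr>carrier = tuples D n \<rightarrow>\<^sub>E carrier M, mult = undefined, one = undefined,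
      zero = zero_cochain M D n,
      add = (\<lambda>f g. \<lambda>xs\<in>tuples D n. f xs \<oplus>\<^bsub>M\<^esub> g xs),
      smult = (\<lambda>a f. \<lambda>xs\<in>tuples D n. a \<odot>\<^bsub>M\<^esub> f xs)\<rparr>"

lemma cochain_module_eq:
  "cochain_module F L K M act n = (fun_module M (carrier L) n)\<lparr>carrier := rel_cochains F L K M act n\<rparr>"
  by (simp add: cochain_module_def fun_module_def)

context module
begin

lemma fun_module_carrier: "carrier (fun_module M D n) = tuples D n \<rightarrow>\<^sub>E carrier M"
  by (simp add: fun_module_def)

lemma fun_module_apply:
  assumes "xs \<in> tuples D n"
  shows "\<zero>\<^bsub>fun_module M D n\<^esub> xs = \<zero>\<^bsub>M\<^esub>"
    and "(f \<oplus>\<^bsub>fun_module M D n\<^esub> h) xs = f xs \<oplus>\<^bsub>M\<^esub> h xs"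
    and "(a \<odot>\<^bsub>fun_module M D n\<^esub> f) xs = a \<odot>\<^bsub>M\<^esub> f xs"
  using assms by (simp_all add: fun_module_def zero_cochain_def)

lemma fun_module_ext:
  assumes "f \<in> carrier (fun_module M D n)" "h \<in> carrier (fun_module M D n)"
    and "\<And>xs. xs \<in> tuples D n \<Longrightarrow> f xs = h xs"
  shows "f = h"
  using assms by (auto simp: fun_module_carrier PiE_def intro: extensionalityI)

lemma fun_module_closed: "f \<in> carrier (fun_module M D n) \<Longrightarrow> xs \<in> tuples D n \<Longrightarrow> f xs \<in> carrier M"
  by (auto simp: fun_module_carrier)

lemma fun_module_module: "module R (fun_module M D n)"
proof -
  have cl: "\<zero>\<^bsub>fun_module M D n\<^esub> \<in> carrier (fun_module M D n)"
    "\<And>f h. f \<in> carrier (fun_module M D n) \<Longrightarrow> h \<in> carrier (fun_module M D n)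
      \<Longrightarrow> f \<oplus>\<^bsub>fun_module M D n\<^esub> h \<in> carrier (fun_module M D n)"
    "\<And>a f. a \<in> carrier R \<Longrightarrow> f \<in> carrier (fun_module M D n)
      \<Longrightarrow> a \<odot>\<^bsub>fun_module M D n\<^esub> f \<in> carrier (fun_module M D n)"
    by (auto simp: fun_module_def zero_cochain_def)
  note [simp] = fun_module_apply fun_module_closed cl
  show ?thesis
  proof (intro moduleI abelian_groupI)
    fix f assume f: "f \<in> carrier (fun_module M D n)"
    show "\<exists>h\<in>carrier (fun_module M D n). h \<oplus>\<^bsub>fun_module M D n\<^esub> f = \<zero>\<^bsub>fun_module M D n\<^esub>"
    proof
      show "(\<ominus>\<^bsub>R\<^esub> \<one>\<^bsub>R\<^esub>) \<odot>\<^bsub>fun_module M D n\<^esub> f \<in> carrier (fun_module M D n)" using f by simp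
      show "((\<ominus>\<^bsub>R\<^esub> \<one>\<^bsub>R\<^esub>) \<odot>\<^bsub>fun_module M D n\<^esub> f) \<oplus>\<^bsub>fun_module M D n\<^esub> f = \<zero>\<^bsub>fun_module M D n\<^esub>"
        by (rule fun_module_ext[of _ D n]) (use f in \<open>simp_all add: smult_l_minus M.l_neg\<close>)
    qed
  qed (auto intro!: fun_module_ext[of _ D n] simp: M.a_ac smult_l_distr smult_r_distr smult_assoc1 R.is_cring)
qed


lemma fun_module_a_inv:
  assumes "f \<in> carrier (fun_module M D n)" "xs \<in> tuples D n"
  shows "(\<ominus>\<^bsub>fun_module M D n\<^esub> f) xs = \<ominus>\<^bsub>M\<^esub> f xs"
proof -
  interpret W: module R "fun_module M D n" by (rule fun_module_module)
  have "(\<ominus>\<^bsub>R\<^esub> \<one>\<^bsub>R\<^esub>) \<odot>\<^bsub>fun_module M D n\<^esub> f = \<ominus>\<^bsub>fun_module M D n\<^esub> f"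
    using assms by (simp add: W.smult_l_minus)
  then show ?thesis using assms fun_module_apply(3)[OF assms(2), of "\<ominus>\<^bsub>R\<^esub> \<one>\<^bsub>R\<^esub>" f]
    by (simp add: smult_l_minus fun_module_closed)
qed

lemma fun_module_minus:
  assumes "f \<in> carrier (fun_module M D n)" "h \<in> carrier (fun_module M D n)" "xs \<in> tuples D n"
  shows "(f \<ominus>\<^bsub>fun_module M D n\<^esub> h) xs = f xs \<ominus>\<^bsub>M\<^esub> h xs"
  using assms by (simp add: a_minus_def fun_module_apply fun_module_a_inv)

lemma fun_module_finsum:
  assumes "finite A" "u \<in> A \<rightarrow> carrier (fun_module M D n)" "xs \<in> tuples D n"
  shows "(finsum (fun_module M D n) u A) xs = (\<Oplus>\<^bsub>M\<^esub>i\<in>A. u i xs)"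
proof -
  interpret W: module R "fun_module M D n" by (rule fun_module_module)
  show ?thesis using assms(1,2)
  proof (induction rule: finite_induct)
    case (insert i A)
    then have "u i xs \<in> carrier M" "(\<lambda>i. u i xs) \<in> A \<rightarrow> carrier M"
      using assms(3) by (auto intro!: fun_module_closed[of _ D n])
    with insert show ?case using assms(3)
      by (subst W.finsum_insert) (simp_all add: Pi_def fun_module_apply)
  qed (simp add: assms(3) fun_module_apply)
qed

lemma fun_module_alt_sign:
  assumes "f \<in> carrier (fun_module M D n)" "xs \<in> tuples D n"
  shows "(alt_sign (fun_module M D n) i f) xs = alt_sign M i (f xs)"
  using assms by (simp add: alt_sign_def fun_module_a_inv)

end

text \<open>Shrinking the carrier changes the record from which \<open>finsum\<close> is defined, so
  equality with the ambient sum is not definitional. It serves to compute sums in the quotient of a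
  submodule.\<close>

lemma (in module) submodule_finsum:
  assumes "submodule H R M" "finite A" "u \<in> A \<rightarrow> H"
  shows "finsum (M\<lparr>carrier := H\<rparr>) u A = finsum M u A"
proof -
  interpret H: module R "M\<lparr>carrier := H\<rparr>"
    by (rule submodule.submodule_is_module[OF assms(1)]) (rule module_axioms)
  have H: "H \<subseteq> carrier M" using assms(1) by (rule submoduleE)
  show ?thesis using assms(2,3)
  proof (induction rule: finite_induct)
    case (insert i A)
    then have "u \<in> A \<rightarrow> H" "u i \<in> H" by auto
    moreover from this have "u \<in> A \<rightarrow> carrier M" "u i \<in> carrier M" using H by auto
    ultimately show ?case using insert H.finsum_insert[of A i u] by simp
  qed (use H.finsum_empty[of u] in simp)
qed

lemma (in module) submodule_a_inv:
  assumes "submodule H R M" "x \<in> H"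
  shows "\<ominus>\<^bsub>M\<lparr>carrier := H\<rparr>\<^esub> x = \<ominus>\<^bsub>M\<^esub> x"
proof -
  interpret H: module R "M\<lparr>carrier := H\<rparr>"
    by (rule submodule.submodule_is_module[OF assms(1)]) (rule module_axioms)
  have H: "H \<subseteq> carrier M" using assms(1) by (rule submoduleE)
  have "\<ominus>\<^bsub>M\<^esub> x \<in> H" using assms by (auto dest: submoduleE)
  then show ?thesis using assms(2) H by (intro H.minus_equality) (auto simp: M.l_neg)
qed

section \<open>The Lie derivative and the differential on cochains of an ideal\<close>

text \<open>Instantiated twice, with \<open>D\<close> an ideal and with \<open>D\<close> the whole
  algebra. Elements of \<open>L\<close> outside \<open>D\<close> act on cochains of \<open>D\<close>
  through \<theta>, while only elements of \<open>D\<close> can be inserted.\<close>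

locale lie_ideal_module =
  fixes F :: "('a, 'c) ring_scheme" and L :: "('a, 'b, 'd) lie_scheme"
    and M :: "('a, 'm, 'e) module_scheme" and act :: "'b \<Rightarrow> 'm \<Rightarrow> 'm" and D :: "'b set"
  assumes lie_module: "lie_module F L M act" and lie_ideal: "lie_ideal F L D"

sublocale lie_ideal_module \<subseteq> M: signed_group M
  using lie_module by (simp add: signed_group_def lie_module_def module_def)

sublocale lie_ideal_module \<subseteq> Mm: module F M
  using lie_module by (simp add: lie_module_def)

sublocale lie_ideal_module \<subseteq> L: module F L
  using lie_module by (simp add: lie_module_def lie_algebra_def)

sublocale lie_ideal_module \<subseteq> Lie: lie_algebra F L
  using lie_module by (simp add: lie_module_def)

context lie_ideal_module
begin

lemma D_submodule: "submodule D F L"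
  using lie_ideal by (simp add: lie_ideal_def)

lemma D_carrier: "x \<in> D \<Longrightarrow> x \<in> carrier L"
  using L.submoduleE(1)[OF D_submodule] by auto

lemma D_closed [simp]:
  "x \<in> D \<Longrightarrow> y \<in> D \<Longrightarrow> x \<oplus>\<^bsub>L\<^esub> y \<in> D"
  "a \<in> carrier F \<Longrightarrow> x \<in> D \<Longrightarrow> a \<odot>\<^bsub>L\<^esub> x \<in> D"
  "x \<in> carrier L \<Longrightarrow> y \<in> D \<Longrightarrow> bracket L x y \<in> D"
  using L.submoduleE[OF D_submodule] lie_ideal by (auto simp: lie_ideal_def)

lemma bracket_anti:
  assumes "x \<in> carrier L" "y \<in> carrier L"
  shows "bracket L y x = \<ominus>\<^bsub>L\<^esub> bracket L x y"
proof -
  have "\<zero>\<^bsub>L\<^esub> = bracket L (x \<oplus>\<^bsub>L\<^esub> y) (x \<oplus>\<^bsub>L\<^esub> y)" using assms by (simp add: Lie.bracket_self)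
  also have "\<dots> = bracket L y x \<oplus>\<^bsub>L\<^esub> bracket L x y"
    using assms by (simp add: Lie.bracket_add_left Lie.bracket_add_right
        Lie.bracket_self[of x] Lie.bracket_self[of y] Lie.bracket_closed L.M.a_comm)
  finally show ?thesis using assms by (metis Lie.bracket_closed L.M.minus_equality)
qed

lemma bracket_minus_right:
  assumes "x \<in> carrier L" "y \<in> carrier L"
  shows "bracket L x (\<ominus>\<^bsub>L\<^esub> y) = \<ominus>\<^bsub>L\<^esub> bracket L x y"
proof -
  have "\<ominus>\<^bsub>L\<^esub> u = (\<ominus>\<^bsub>F\<^esub> \<one>\<^bsub>F\<^esub>) \<odot>\<^bsub>L\<^esub> u" if "u \<in> carrier L" for u
    using that by (simp add: L.smult_l_minus)
  then show ?thesis using assms by (simp add: Lie.bracket_smult_right Lie.bracket_closed)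
qed

lemma D_bracket': "x \<in> D \<Longrightarrow> y \<in> carrier L \<Longrightarrow> bracket L x y \<in> D"
  using bracket_anti[of y x] L.submoduleE(3)[OF D_submodule] by (simp add: D_carrier)

lemma act_closed: "x \<in> carrier L \<Longrightarrow> u \<in> carrier M \<Longrightarrow> act x u \<in> carrier M"
  using lie_module by (rule lie_module.act_closed)

lemmas act_linear = lie_module.act_add_left[OF lie_module] lie_module.act_add_right[OF lie_module]
  lie_module.act_smult_left[OF lie_module] lie_module.act_smult_right[OF lie_module]

lemmas act_bracket = lie_module.act_bracket[OF lie_module]

end

text \<open>\<open>lie_deriv\<close> reads only the bracket of its first record, so it does not see
  the restriction of the carrier. The rewrites present every fact about the restricted record in
  terms of \<open>L\<close> and \<open>D\<close>.\<close>

sublocale lie_ideal_module \<subseteq> B: bracket_action F "L\<lparr>carrier := D\<rparr>" M act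
  rewrites "carrier (L\<lparr>carrier := D\<rparr>) = D"
    and "bracket (L\<lparr>carrier := D\<rparr>) = bracket L"
    and "add (L\<lparr>carrier := D\<rparr>) = add L"
    and "smult (L\<lparr>carrier := D\<rparr>) = smult L"
    and "lie_deriv (L\<lparr>carrier := D\<rparr>) = lie_deriv L"
  by unfold_locales
    (auto simp: D_bracket' D_carrier act_closed lie_deriv_def fun_eq_iff)

context lie_ideal_module
begin

abbreviation "\<A> n \<equiv> alternating_maps F (L\<lparr>carrier := D\<rparr>) M n"
abbreviation "\<F> n \<equiv> fun_module M D n"
abbreviation "\<theta> n \<equiv> lie_deriv L M act D n"
abbreviation "\<iota> n \<equiv> insertion D n"
abbreviation "\<delta> n \<equiv> ce_diff (L\<lparr>carrier := D\<rparr>) M act n"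

lemma \<iota>_apply: "ys \<in> tuples D n \<Longrightarrow> \<iota> n y f ys = f (y # ys)"
  by (simp add: insertion_def)

lemma alternating_fun: "f \<in> \<A> n \<Longrightarrow> f \<in> carrier (\<F> n)"
  by (auto simp: alternating_maps_def Mm.fun_module_carrier)

lemma \<iota>_fun: "f \<in> carrier (\<F> (Suc n)) \<Longrightarrow> y \<in> D \<Longrightarrow> \<iota> n y f \<in> carrier (\<F> n)"
  by (auto simp: Mm.fun_module_carrier insertion_def)

lemma \<theta>_fun:
  assumes "f \<in> carrier (\<F> n)" "x \<in> carrier L"
  shows "\<theta> n x f \<in> carrier (\<F> n)"
proof -
  have "f (xs[j := bracket L x (xs ! j)]) \<in> carrier M" if "xs \<in> tuples D n" "j < n" for xs j
    using assms that by (intro Mm.fun_module_closed[OF assms(1)]) auto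
  with assms show ?thesis
    unfolding Mm.fun_module_carrier
    by (auto simp: lie_deriv_def intro!: M.minus_closed act_closed M.finsum_closed)
qed

lemma \<delta>_fun: "f \<in> carrier (\<F> n) \<Longrightarrow> \<delta> n f \<in> carrier (\<F> (Suc n))"
  using B.ce_diff_closed[of f n] unfolding Mm.fun_module_carrier
  by (auto simp: ce_diff_def)

lemma \<theta>_0: "f \<in> carrier (\<F> 0) \<Longrightarrow> x \<in> carrier L \<Longrightarrow> \<theta> 0 x f [] = act x (f [])"
  using act_closed[of x "f []"] Mm.fun_module_closed[of f D 0 "[]"]
  by (simp add: lie_deriv_def a_minus_def M.finsum_empty)

text \<open>The commutation rule i_y \<theta>_x = \<theta>_x i_y - i_[x,y], evaluated at one tuple:
  the summand at position 0 is the one that \<theta>_x i_y lacks. It is the recursion behind the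
  inductions below.\<close>

lemma \<theta>_Cons:
  assumes f: "f \<in> carrier (\<F> (Suc n))" and x: "x \<in> carrier L" and y: "y \<in> D" and ys: "ys \<in> tuples D n"
  shows "\<theta> (Suc n) x f (y # ys) = \<theta> n x (\<iota> n y f) ys \<ominus>\<^bsub>M\<^esub> f (bracket L x y # ys)"
proof -
  let ?u = "\<lambda>j. f ((y # ys)[j := bracket L x ((y # ys) ! j)])"
  have u: "?u \<in> {..<Suc n} \<rightarrow> carrier M"
    using x y ys by (intro funcsetI Mm.fun_module_closed[OF f] update_tuples D_closed nth_tuples) auto
  have eq: "(\<Oplus>\<^bsub>M\<^esub>j\<in>{..<n}. ?u (Suc j)) = (\<Oplus>\<^bsub>M\<^esub>j\<in>{..<n}. \<iota> n y f (ys[j := bracket L x (ys ! j)]))"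
    using x y ys by (intro M.finsum_cong') (auto simp: insertion_def intro!: Mm.fun_module_closed[OF f])
  have cl: "f (y # ys) \<in> carrier M" "?u 0 \<in> carrier M" "(\<Oplus>\<^bsub>M\<^esub>j\<in>{..<n}. ?u (Suc j)) \<in> carrier M"
    using u x y ys by (auto intro!: Mm.fun_module_closed[OF f] M.finsum_closed)
  then show ?thesis using x y ys M.finsum_lessThan_Suc2[OF u] eq
    by (simp add: lie_deriv_def insertion_def M.minus_simps act_closed)
qed

text \<open>The combination k is described by its values only. It may then be an insertion or a
  derivative whose values come from another formula, without first being identified as a sum in the
  function module.\<close>

lemma \<theta>_lincomb:
  assumes f: "f \<in> carrier (\<F> n)" and h: "h \<in> carrier (\<F> n)" and x: "x \<in> carrier L"
    and a: "a \<in> carrier F" and b: "b \<in> carrier F"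
    and k: "\<And>zs. zs \<in> tuples D n \<Longrightarrow> k zs = a \<odot>\<^bsub>M\<^esub> f zs \<oplus>\<^bsub>M\<^esub> b \<odot>\<^bsub>M\<^esub> h zs"
    and xs: "xs \<in> tuples D n"
  shows "\<theta> n x k xs = a \<odot>\<^bsub>M\<^esub> \<theta> n x f xs \<oplus>\<^bsub>M\<^esub> b \<odot>\<^bsub>M\<^esub> \<theta> n x h xs"
proof -
  have up: "xs[j := bracket L x (xs ! j)] \<in> tuples D n" if "j < n" for j using that x xs by simp
  note cl = Mm.fun_module_closed[OF f] Mm.fun_module_closed[OF h]
  let ?S = "\<lambda>f. \<Oplus>\<^bsub>M\<^esub>j\<in>{..<n}. f (xs[j := bracket L x (xs ! j)])"
  have "?S k = (\<Oplus>\<^bsub>M\<^esub>j\<in>{..<n}. a \<odot>\<^bsub>M\<^esub> f (xs[j := bracket L x (xs ! j)])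
      \<oplus>\<^bsub>M\<^esub> b \<odot>\<^bsub>M\<^esub> h (xs[j := bracket L x (xs ! j)]))"
    using k up cl a b by (intro M.finsum_cong') auto
  also have "\<dots> = a \<odot>\<^bsub>M\<^esub> ?S f \<oplus>\<^bsub>M\<^esub> b \<odot>\<^bsub>M\<^esub> ?S h"
    using up cl a b by (simp add: M.finsum_addf Mm.finsum_smult_ldistr Pi_def)
  finally have "?S k = a \<odot>\<^bsub>M\<^esub> ?S f \<oplus>\<^bsub>M\<^esub> b \<odot>\<^bsub>M\<^esub> ?S h" .
  moreover have "?S f \<in> carrier M" "?S h \<in> carrier M" using up cl by (auto intro!: M.finsum_closed)
  moreover have "act x (f xs) \<in> carrier M" "act x (h xs) \<in> carrier M" using x cl xs by (auto intro: act_closed)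
  ultimately show ?thesis using xs x cl a b
    by (simp add: lie_deriv_def k act_linear a_minus_def Mm.smult_r_distr Mm.smult_r_minus M.minus_add M.a_ac)
qed

lemma \<theta>_add:
  assumes f: "f \<in> carrier (\<F> n)" and h: "h \<in> carrier (\<F> n)" and x: "x \<in> carrier L"
    and k: "\<And>zs. zs \<in> tuples D n \<Longrightarrow> k zs = f zs \<oplus>\<^bsub>M\<^esub> h zs" and xs: "xs \<in> tuples D n"
  shows "\<theta> n x k xs = \<theta> n x f xs \<oplus>\<^bsub>M\<^esub> \<theta> n x h xs"
  using \<theta>_lincomb[OF f h x Mm.R.one_closed Mm.R.one_closed _ xs, of k] k xs
    \<theta>_fun[OF f x] \<theta>_fun[OF h x] f h by (simp add: Mm.fun_module_closed)

lemma \<theta>_smult: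
  assumes f: "f \<in> carrier (\<F> n)" and a: "a \<in> carrier F" and x: "x \<in> carrier L"
    and k: "\<And>zs. zs \<in> tuples D n \<Longrightarrow> k zs = a \<odot>\<^bsub>M\<^esub> f zs" and xs: "xs \<in> tuples D n"
  shows "\<theta> n x k xs = a \<odot>\<^bsub>M\<^esub> \<theta> n x f xs"
  using \<theta>_lincomb[OF f f x a Mm.R.zero_closed _ xs, of k] k xs \<theta>_fun[OF f x] f a
  by (simp add: Mm.fun_module_closed)

lemma \<theta>_minus:
  assumes f: "f \<in> carrier (\<F> n)" and h: "h \<in> carrier (\<F> n)" and x: "x \<in> carrier L"
    and k: "\<And>zs. zs \<in> tuples D n \<Longrightarrow> k zs = f zs \<ominus>\<^bsub>M\<^esub> h zs" and xs: "xs \<in> tuples D n"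
  shows "\<theta> n x k xs = \<theta> n x f xs \<ominus>\<^bsub>M\<^esub> \<theta> n x h xs"
  using \<theta>_lincomb[OF f h x Mm.R.one_closed Mm.R.a_inv_closed[OF Mm.R.one_closed] _ xs, of k] k xs
    \<theta>_fun[OF f x] \<theta>_fun[OF h x] f h
  by (simp add: Mm.fun_module_closed Mm.smult_l_minus a_minus_def)

lemma alternating_lincomb:
  assumes f: "f \<in> \<A> n" and h: "h \<in> \<A> n" and k: "k \<in> carrier (\<F> n)"
    and a: "a \<in> carrier F" and b: "b \<in> carrier F"
    and eq: "\<And>zs. zs \<in> tuples D n \<Longrightarrow> k zs = a \<odot>\<^bsub>M\<^esub> f zs \<oplus>\<^bsub>M\<^esub> b \<odot>\<^bsub>M\<^esub> h zs"
  shows "k \<in> \<A> n"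
proof -
  note cl = B.alternating_closed[OF f] B.alternating_closed[OF h]
  have "k (xs[i := x \<oplus>\<^bsub>L\<^esub> y]) = k (xs[i := x]) \<oplus>\<^bsub>M\<^esub> k (xs[i := y])"
    if "xs \<in> tuples D n" "i < n" "x \<in> D" "y \<in> D" for xs i x y
    using that a b
    by (simp add: eq cl B.alternating_add[OF f] B.alternating_add[OF h] Mm.smult_r_distr M.a_ac)
  moreover have "k (xs[i := c \<odot>\<^bsub>L\<^esub> x]) = c \<odot>\<^bsub>M\<^esub> k (xs[i := x])"
    if "xs \<in> tuples D n" "i < n" "x \<in> D" "c \<in> carrier F" for xs i x c
    using that a b by (simp add: eq cl B.alternating_smult[OF f] B.alternating_smult[OF h]
        Mm.smult_r_distr Mm.smult_assoc1[symmetric] Mm.m_comm)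
  moreover have "k xs = \<zero>\<^bsub>M\<^esub>"
    if "xs \<in> tuples D n" "i < j" "j < n" "xs ! i = xs ! j" for xs i j
    using that a b by (simp add: eq B.alternating_eq[OF f that] B.alternating_eq[OF h that])
  ultimately show ?thesis using k
    unfolding alternating_maps_def Mm.fun_module_carrier by auto
qed

lemma alternating_minus:
  assumes f: "f \<in> \<A> n" and h: "h \<in> \<A> n" and k: "k \<in> carrier (\<F> n)"
    and eq: "\<And>zs. zs \<in> tuples D n \<Longrightarrow> k zs = f zs \<ominus>\<^bsub>M\<^esub> h zs"
  shows "k \<in> \<A> n"
  using eq B.alternating_closed[OF f] B.alternating_closed[OF h]
  by (intro alternating_lincomb[OF f h k Mm.R.one_closed Mm.R.a_inv_closed[OF Mm.R.one_closed]])
    (simp add: a_minus_def Mm.smult_l_minus)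

lemma submodule_alternating: "submodule (\<A> n) F (\<F> n)"
proof -
  interpret W: module F "\<F> n" by (rule Mm.fun_module_module)
  show ?thesis
  proof (rule W.submodule_lincombI)
    show "\<A> n \<subseteq> carrier (\<F> n)" using alternating_fun by auto
    show "\<zero>\<^bsub>\<F> n\<^esub> \<in> \<A> n"
      unfolding alternating_maps_def
      using W.zero_closed by (auto simp: Mm.fun_module_apply Mm.fun_module_carrier)
    show "a \<odot>\<^bsub>\<F> n\<^esub> f \<oplus>\<^bsub>\<F> n\<^esub> b \<odot>\<^bsub>\<F> n\<^esub> h \<in> \<A> n"
      if "a \<in> carrier F" "b \<in> carrier F" "f \<in> \<A> n" "h \<in> \<A> n" for a b f h
      using that by (intro alternating_lincomb[OF that(3,4) _ that(1,2)])
        (simp_all add: alternating_fun Mm.fun_module_apply)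
  qed
qed

text \<open>Additivity in the Lie algebra element rests on multilinearity of f, since x also enters
  through the arguments [x, xs_j].\<close>

lemma \<theta>_left_add:
  assumes f: "f \<in> \<A> n" and x: "x \<in> carrier L" and y: "y \<in> carrier L" and xs: "xs \<in> tuples D n"
  shows "\<theta> n (x \<oplus>\<^bsub>L\<^esub> y) f xs = \<theta> n x f xs \<oplus>\<^bsub>M\<^esub> \<theta> n y f xs"
proof -
  note cl = B.alternating_closed[OF f]
  have up: "xs[j := bracket L z (xs ! j)] \<in> tuples D n" if "j < n" "z \<in> carrier L" for j z using that xs by simp
  have "(\<Oplus>\<^bsub>M\<^esub>j\<in>{..<n}. f (xs[j := bracket L (x \<oplus>\<^bsub>L\<^esub> y) (xs ! j)]))
      = (\<Oplus>\<^bsub>M\<^esub>j\<in>{..<n}. f (xs[j := bracket L x (xs ! j)]) \<oplus>\<^bsub>M\<^esub> f (xs[j := bracket L y (xs ! j)]))"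
    using up x y cl xs by (intro M.finsum_cong')
      (auto simp: Lie.bracket_add_left D_carrier B.alternating_add[OF f])
  also have "\<dots> = (\<Oplus>\<^bsub>M\<^esub>j\<in>{..<n}. f (xs[j := bracket L x (xs ! j)]))
      \<oplus>\<^bsub>M\<^esub> (\<Oplus>\<^bsub>M\<^esub>j\<in>{..<n}. f (xs[j := bracket L y (xs ! j)]))"
    using up cl x y by (intro M.finsum_addf) auto
  finally show ?thesis using xs x y cl up
    by (simp add: lie_deriv_def act_linear M.minus_simps act_closed M.finsum_closed Pi_def)
qed

lemma \<theta>_left_smult:
  assumes f: "f \<in> \<A> n" and x: "x \<in> carrier L" and a: "a \<in> carrier F" and xs: "xs \<in> tuples D n"
  shows "\<theta> n (a \<odot>\<^bsub>L\<^esub> x) f xs = a \<odot>\<^bsub>M\<^esub> \<theta> n x f xs"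
proof -
  note cl = B.alternating_closed[OF f]
  have up: "xs[j := bracket L x (xs ! j)] \<in> tuples D n" if "j < n" for j using that x xs by simp
  have "(\<Oplus>\<^bsub>M\<^esub>j\<in>{..<n}. f (xs[j := bracket L (a \<odot>\<^bsub>L\<^esub> x) (xs ! j)]))
      = (\<Oplus>\<^bsub>M\<^esub>j\<in>{..<n}. a \<odot>\<^bsub>M\<^esub> f (xs[j := bracket L x (xs ! j)]))"
    using up x a cl xs by (intro M.finsum_cong')
      (auto simp: Lie.bracket_smult_left D_carrier B.alternating_smult[OF f])
  also have "\<dots> = a \<odot>\<^bsub>M\<^esub> (\<Oplus>\<^bsub>M\<^esub>j\<in>{..<n}. f (xs[j := bracket L x (xs ! j)]))"
    using up cl a by (intro Mm.finsum_smult_ldistr[symmetric]) auto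
  finally show ?thesis using xs x cl up a
    by (simp add: lie_deriv_def act_linear a_minus_def Mm.smult_r_distr Mm.smult_r_minus
        act_closed M.finsum_closed Pi_def)
qed

lemma \<iota>_\<theta>:
  assumes "f \<in> carrier (\<F> (Suc n))" "x \<in> carrier L" "y \<in> D" "ys \<in> tuples D n"
  shows "\<iota> n y (\<theta> (Suc n) x f) ys = \<theta> n x (\<iota> n y f) ys \<ominus>\<^bsub>M\<^esub> \<iota> n (bracket L x y) f ys"
  using \<theta>_Cons[OF assms] assms by (simp add: insertion_def)

text \<open>By the commutation rule, i_y \<theta>_x f is the difference of \<theta>_x i_y f,
  alternating by induction, and i_[x,y] f. The first slot is checked by computation.\<close>

lemma \<theta>_alternating:
  assumes "f \<in> \<A> n" "x \<in> carrier L"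
  shows "\<theta> n x f \<in> \<A> n"
  using assms
proof (induction n arbitrary: f)
  case 0
  then have "\<theta> 0 x f \<in> carrier (\<F> 0)" by (intro \<theta>_fun alternating_fun)
  then show ?case by (simp add: alternating_maps_def Mm.fun_module_carrier)
next
  case (Suc n)
  note f = Suc.prems(1) and x = Suc.prems(2)
  note ff = alternating_fun[OF f]
  note \<theta>f = \<theta>_fun[OF ff x]
  have ins: "\<iota> n y f \<in> \<A> n" if "y \<in> D" for y by (rule B.insertion_alternating[OF f that])
  note cl = B.alternating_closed[OF f]
  have tcl: "\<theta> n x (\<iota> n y f) ys \<in> carrier M" if "y \<in> D" "ys \<in> tuples D n" for y ys
    using Mm.fun_module_closed[OF \<theta>_fun[OF alternating_fun[OF ins]]] that x by blast
  show ?case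
  proof (rule B.alternating_SucI)
    show "\<theta> (Suc n) x f \<in> tuples D (Suc n) \<rightarrow>\<^sub>E carrier M" using \<theta>f by (simp add: Mm.fun_module_carrier)
    show "\<iota> n y (\<theta> (Suc n) x f) \<in> \<A> n" if "y \<in> D" for y
      using ff \<theta>f x that by (intro alternating_minus[OF Suc.IH[OF ins[OF that] x] ins[of "bracket L x y"]])
        (auto intro: \<iota>_fun \<iota>_\<theta>)
  next
    fix y z ys assume y: "y \<in> D" and z: "z \<in> D" and ys: "ys \<in> tuples D n"
    have "\<theta> n x (\<iota> n (y \<oplus>\<^bsub>L\<^esub> z) f) ys = \<theta> n x (\<iota> n y f) ys \<oplus>\<^bsub>M\<^esub> \<theta> n x (\<iota> n z f) ys"
      using x y z ys by (intro \<theta>_add) (auto simp: \<iota>_apply B.alternating_head_add[OF f] intro!: \<iota>_fun ff)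
    then show "\<theta> (Suc n) x f ((y \<oplus>\<^bsub>L\<^esub> z) # ys) = \<theta> (Suc n) x f (y # ys) \<oplus>\<^bsub>M\<^esub> \<theta> (Suc n) x f (z # ys)"
      using x y z ys
      by (simp add: \<theta>_Cons[OF ff] Lie.bracket_add_right D_carrier B.alternating_head_add[OF f] tcl cl M.minus_simps)
  next
    fix a y ys assume a: "a \<in> carrier F" and y: "y \<in> D" and ys: "ys \<in> tuples D n"
    have "\<theta> n x (\<iota> n (a \<odot>\<^bsub>L\<^esub> y) f) ys = a \<odot>\<^bsub>M\<^esub> \<theta> n x (\<iota> n y f) ys"
      using x y a ys by (intro \<theta>_smult) (auto simp: \<iota>_apply B.alternating_head_smult[OF f] intro!: \<iota>_fun ff)
    then show "\<theta> (Suc n) x f ((a \<odot>\<^bsub>L\<^esub> y) # ys) = a \<odot>\<^bsub>M\<^esub> \<theta> (Suc n) x f (y # ys)"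
      using x y a ys
      by (simp add: \<theta>_Cons[OF ff] Lie.bracket_smult_right D_carrier B.alternating_head_smult[OF f] tcl cl
          a_minus_def Mm.smult_r_distr Mm.smult_r_minus)
  next
    fix m y ys assume n: "n = Suc m" and y: "y \<in> D" and ys: "ys \<in> tuples D m"
    have yy: "\<iota> m y (\<iota> n y f) zs = \<zero>\<^bsub>M\<^esub>" if "zs \<in> tuples D m" for zs
      using that y n B.alternating_eq[OF f, of "y # y # zs" 0 1] by (simp add: insertion_def)
    \<comment> \<open>The function i_y i_y f is zero, hence its own double; additivity turns this
      into an equation a = a + a.\<close>
    have "\<theta> m x (\<iota> m y (\<iota> n y f)) ys = \<theta> m x (\<iota> m y (\<iota> n y f)) ys \<oplus>\<^bsub>M\<^esub> \<theta> m x (\<iota> m y (\<iota> n y f)) ys"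
      using n x y ys ff by (intro \<theta>_add) (auto simp: yy[unfolded n] intro!: \<iota>_fun)
    moreover have "\<theta> m x (\<iota> m y (\<iota> n y f)) ys \<in> carrier M"
      using n x y ys ff by (intro Mm.fun_module_closed[of _ D m] \<theta>_fun \<iota>_fun[of _ m]) (auto intro: \<iota>_fun)
    ultimately have z: "\<theta> m x (\<iota> m y (\<iota> n y f)) ys = \<zero>\<^bsub>M\<^esub>"
      by (metis M.add.r_cancel_one')
    \<comment> \<open>Expanding \<theta>_x f in two slots at y, y leaves the zero term above and two
      terms with one y replaced by [x, y]; these cancel.\<close>
    have "f (y # bracket L x y # ys) = \<ominus>\<^bsub>M\<^esub> f (bracket L x y # y # ys)"
      using f n x y ys by (intro B.alternating_head_swap[of f m]) auto
    then show "\<theta> (Suc n) x f (y # y # ys) = \<zero>\<^bsub>M\<^esub>"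
      using n x y ys z cl[of "bracket L x y # y # ys"] ff
      by (simp add: \<theta>_Cons[OF ff[unfolded n]] \<theta>_Cons[OF \<iota>_fun] \<iota>_apply a_minus_def M.r_neg M.l_neg M.l_zero)
  qed
qed

text \<open>Degree 0 is the action law of \<open>M\<close>. In higher degree, inserting z reduces
  the claim to the same one for i_z f together with the Jacobi identity.\<close>

lemma \<theta>_bracket:
  assumes "f \<in> \<A> n" "x \<in> carrier L" "y \<in> carrier L" "zs \<in> tuples D n"
  shows "\<theta> n (bracket L x y) f zs = \<theta> n x (\<theta> n y f) zs \<ominus>\<^bsub>M\<^esub> \<theta> n y (\<theta> n x f) zs"
  using assms
proof (induction n arbitrary: f zs)
  case 0
  then have "f \<in> carrier (\<F> 0)" "f [] \<in> carrier M" "zs = []"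
    using alternating_fun[of f 0] B.alternating_closed[of f 0 "[]"] by (auto simp: tuples_0)
  with 0 show ?case
    by (simp add: \<theta>_0 \<theta>_fun act_bracket Lie.bracket_closed)
next
  case (Suc n)
  note f = Suc.prems(1) and x = Suc.prems(2) and y = Suc.prems(3)
  note ff = alternating_fun[OF f]
  from Suc.prems(4) obtain z ws where zs: "zs = z # ws" "z \<in> D" "ws \<in> tuples D n" by (rule tuples_SucE)
  have ins: "\<iota> n v f \<in> \<A> n" if "v \<in> D" for v by (rule B.insertion_alternating[OF f that])
  \<comment> \<open>The two middle terms together are symmetric in u and v. They drop out of the
    commutator, which leaves the induction hypothesis and the double brackets.\<close>
  have expand: "\<theta> (Suc n) u (\<theta> (Suc n) v f) zs
      = (\<theta> n u (\<theta> n v (\<iota> n z f)) ws \<ominus>\<^bsub>M\<^esub> \<theta> n u (\<iota> n (bracket L v z) f) ws)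
        \<ominus>\<^bsub>M\<^esub> (\<theta> n v (\<iota> n (bracket L u z) f) ws \<ominus>\<^bsub>M\<^esub> f (bracket L v (bracket L u z) # ws))"
    if u: "u \<in> carrier L" and v: "v \<in> carrier L" for u v
  proof -
    have "\<theta> n u (\<iota> n z (\<theta> (Suc n) v f)) ws
        = \<theta> n u (\<theta> n v (\<iota> n z f)) ws \<ominus>\<^bsub>M\<^esub> \<theta> n u (\<iota> n (bracket L v z) f) ws"
      using u v zs ff by (intro \<theta>_minus) (auto intro!: \<theta>_fun \<iota>_fun \<iota>_\<theta>)
    then show ?thesis using u v zs
      by (simp add: \<theta>_Cons[OF \<theta>_fun[OF ff v]] \<theta>_Cons[OF ff])
  qed
  have jac: "bracket L (bracket L x y) z \<oplus>\<^bsub>L\<^esub> bracket L y (bracket L x z) = bracket L x (bracket L y z)"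
  proof -
    have zc: "z \<in> carrier L" using zs D_carrier by simp
    have e1: "bracket L z (bracket L x y) = \<ominus>\<^bsub>L\<^esub> bracket L (bracket L x y) z"
      using x y zc by (intro bracket_anti) (auto intro: Lie.bracket_closed)
    have "bracket L z x = \<ominus>\<^bsub>L\<^esub> bracket L x z" using x zc by (intro bracket_anti)
    then have e2: "bracket L y (bracket L z x) = \<ominus>\<^bsub>L\<^esub> bracket L y (bracket L x z)"
      using x y zc by (simp add: bracket_minus_right Lie.bracket_closed)
    show ?thesis using Lie.jacobi[OF x y zc] x y zc
      by (simp add: e1 e2 a_minus_def[symmetric] Lie.bracket_closed L.M.minus_simps)
  qed
  have "f (bracket L x (bracket L y z) # ws)
      = f (bracket L (bracket L x y) z # ws) \<oplus>\<^bsub>M\<^esub> f (bracket L y (bracket L x z) # ws)"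
    unfolding jac[symmetric] using x y zs by (intro B.alternating_head_add[OF f]) (simp_all add: Lie.bracket_closed)
  moreover have "\<theta> n (bracket L x y) (\<iota> n z f) ws
      = \<theta> n x (\<theta> n y (\<iota> n z f)) ws \<ominus>\<^bsub>M\<^esub> \<theta> n y (\<theta> n x (\<iota> n z f)) ws"
    using zs by (intro Suc.IH ins x y) auto
  moreover have "\<theta> n u (\<theta> n v (\<iota> n w f)) ws \<in> carrier M" "\<theta> n u (\<iota> n w f) ws \<in> carrier M"
    if "u \<in> carrier L" "v \<in> carrier L" "w \<in> D" for u v w
    using that zs ff by (auto intro!: Mm.fun_module_closed[of _ D n] \<theta>_fun \<iota>_fun)
  moreover have "f (w # ws) \<in> carrier M" if "w \<in> D" for w
    using that zs by (intro B.alternating_closed[OF f]) auto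
  ultimately show ?case
    using x y zs expand[OF x y] expand[OF y x]
    by (simp add: \<theta>_Cons[OF ff] Lie.bracket_closed M.minus_simps)
qed


section \<open>The Chevalley-Eilenberg differential on cochains of \<open>D\<close>\<close>

lemma \<delta>_lincomb:
  assumes f: "f \<in> carrier (\<F> n)" and h: "h \<in> carrier (\<F> n)"
    and a: "a \<in> carrier F" and b: "b \<in> carrier F"
    and k: "\<And>zs. zs \<in> tuples D n \<Longrightarrow> k zs = a \<odot>\<^bsub>M\<^esub> f zs \<oplus>\<^bsub>M\<^esub> b \<odot>\<^bsub>M\<^esub> h zs"
    and xs: "xs \<in> tuples D (Suc n)"
  shows "\<delta> n k xs = a \<odot>\<^bsub>M\<^esub> \<delta> n f xs \<oplus>\<^bsub>M\<^esub> b \<odot>\<^bsub>M\<^esub> \<delta> n h xs"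
proof -
  define A where "A f i = alt_sign M i (act (xs ! i) (f (nths xs (- {i}))))" for f :: "'b list \<Rightarrow> 'm" and i
  define B where "B f j i = alt_sign M (i + j) (f (bracket L (xs ! i) (xs ! j) # nths xs (- {i, j})))"
    for f :: "'b list \<Rightarrow> 'm" and i j
  let ?A = "\<lambda>f. \<Oplus>\<^bsub>M\<^esub>i\<in>{..n}. A f i" and ?b = "\<lambda>f j. \<Oplus>\<^bsub>M\<^esub>i\<in>{..<j}. B f j i"
  have n1: "nths xs (- {i}) \<in> tuples D n" "xs ! i \<in> carrier L" if "i \<le> n" for i
    using that xs by (auto intro: nths_tuples1 D_carrier)
  have n2: "bracket L (xs ! i) (xs ! j) # nths xs (- {i, j}) \<in> tuples D n" if "j \<le> n" "i < j" for i j
    using that xs by (intro nths_tuples2[OF xs]) (auto simp: D_carrier)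
  note cl = Mm.fun_module_closed[OF f] Mm.fun_module_closed[OF h]
  have sg: "alt_sign M i (a \<odot>\<^bsub>M\<^esub> u \<oplus>\<^bsub>M\<^esub> b \<odot>\<^bsub>M\<^esub> v) = a \<odot>\<^bsub>M\<^esub> alt_sign M i u \<oplus>\<^bsub>M\<^esub> b \<odot>\<^bsub>M\<^esub> alt_sign M i v"
    if "u \<in> carrier M" "v \<in> carrier M" for i u v
    using that a b by (simp add: alt_sign_def Mm.smult_r_minus M.minus_add M.a_comm)
  have Acl: "A f i \<in> carrier M" "A h i \<in> carrier M" if "i \<le> n" for i
    using that n1 cl by (auto simp: A_def intro!: act_closed M.alt_sign_closed)
  have Bcl: "B f j i \<in> carrier M" "B h j i \<in> carrier M" if "j \<le> n" "i < j" for i j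
    using n2[OF that] cl by (auto simp: B_def intro!: M.alt_sign_closed)
  have "?A k = (\<Oplus>\<^bsub>M\<^esub>i\<in>{..n}. a \<odot>\<^bsub>M\<^esub> A f i \<oplus>\<^bsub>M\<^esub> b \<odot>\<^bsub>M\<^esub> A h i)"
    using Acl n1 cl k a b by (intro M.finsum_cong') (auto simp: A_def act_linear sg act_closed)
  also have "\<dots> = a \<odot>\<^bsub>M\<^esub> ?A f \<oplus>\<^bsub>M\<^esub> b \<odot>\<^bsub>M\<^esub> ?A h"
    using Acl a b by (simp add: M.finsum_addf Mm.finsum_smult_ldistr Pi_def)
  finally have 1: "?A k = \<dots>" .
  have inner: "?b k j = a \<odot>\<^bsub>M\<^esub> ?b f j \<oplus>\<^bsub>M\<^esub> b \<odot>\<^bsub>M\<^esub> ?b h j" if j: "j \<le> n" for j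
  proof -
    have "?b k j = (\<Oplus>\<^bsub>M\<^esub>i\<in>{..<j}. a \<odot>\<^bsub>M\<^esub> B f j i \<oplus>\<^bsub>M\<^esub> b \<odot>\<^bsub>M\<^esub> B h j i)"
      using Bcl j k n2 cl a b by (intro M.finsum_cong') (auto simp: B_def sg)
    also have "\<dots> = a \<odot>\<^bsub>M\<^esub> ?b f j \<oplus>\<^bsub>M\<^esub> b \<odot>\<^bsub>M\<^esub> ?b h j"
      using Bcl j a b by (simp add: M.finsum_addf Mm.finsum_smult_ldistr Pi_def)
    finally show ?thesis .
  qed
  have icl: "?b f j \<in> carrier M" "?b h j \<in> carrier M" if "j \<le> n" for j
    using that Bcl by (auto intro!: M.finsum_closed)
  have "(\<Oplus>\<^bsub>M\<^esub>j\<in>{..n}. ?b k j) = (\<Oplus>\<^bsub>M\<^esub>j\<in>{..n}. a \<odot>\<^bsub>M\<^esub> ?b f j \<oplus>\<^bsub>M\<^esub> b \<odot>\<^bsub>M\<^esub> ?b h j)"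
    using inner icl a b by (intro M.finsum_cong') auto
  also have "\<dots> = a \<odot>\<^bsub>M\<^esub> (\<Oplus>\<^bsub>M\<^esub>j\<in>{..n}. ?b f j) \<oplus>\<^bsub>M\<^esub> b \<odot>\<^bsub>M\<^esub> (\<Oplus>\<^bsub>M\<^esub>j\<in>{..n}. ?b h j)"
    using icl a b by (simp add: M.finsum_addf Mm.finsum_smult_ldistr Pi_def)
  finally have 2: "(\<Oplus>\<^bsub>M\<^esub>j\<in>{..n}. ?b k j) = \<dots>" .
  have "?A f \<in> carrier M" "?A h \<in> carrier M"
    "(\<Oplus>\<^bsub>M\<^esub>j\<in>{..n}. ?b f j) \<in> carrier M" "(\<Oplus>\<^bsub>M\<^esub>j\<in>{..n}. ?b h j) \<in> carrier M"
    using Acl icl by (auto intro!: M.finsum_closed)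
  then show ?thesis using xs 1 2 a b
    by (simp add: ce_diff_def A_def B_def Mm.smult_r_distr M.a_ac)
qed

lemma \<delta>_add:
  assumes f: "f \<in> carrier (\<F> n)" and h: "h \<in> carrier (\<F> n)"
    and k: "\<And>zs. zs \<in> tuples D n \<Longrightarrow> k zs = f zs \<oplus>\<^bsub>M\<^esub> h zs" and xs: "xs \<in> tuples D (Suc n)"
  shows "\<delta> n k xs = \<delta> n f xs \<oplus>\<^bsub>M\<^esub> \<delta> n h xs"
  using \<delta>_lincomb[OF f h Mm.R.one_closed Mm.R.one_closed _ xs, of k] k xs
    \<delta>_fun[OF f] \<delta>_fun[OF h] f h by (simp add: Mm.fun_module_closed)

lemma \<delta>_smult:
  assumes f: "f \<in> carrier (\<F> n)" and a: "a \<in> carrier F"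
    and k: "\<And>zs. zs \<in> tuples D n \<Longrightarrow> k zs = a \<odot>\<^bsub>M\<^esub> f zs" and xs: "xs \<in> tuples D (Suc n)"
  shows "\<delta> n k xs = a \<odot>\<^bsub>M\<^esub> \<delta> n f xs"
  using \<delta>_lincomb[OF f f a Mm.R.zero_closed _ xs, of k] k xs \<delta>_fun[OF f] f a
  by (simp add: Mm.fun_module_closed)

lemma \<delta>_minus:
  assumes f: "f \<in> carrier (\<F> n)" and h: "h \<in> carrier (\<F> n)"
    and k: "\<And>zs. zs \<in> tuples D n \<Longrightarrow> k zs = f zs \<ominus>\<^bsub>M\<^esub> h zs" and xs: "xs \<in> tuples D (Suc n)"
  shows "\<delta> n k xs = \<delta> n f xs \<ominus>\<^bsub>M\<^esub> \<delta> n h xs"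
  using \<delta>_lincomb[OF f h Mm.R.one_closed Mm.R.a_inv_closed[OF Mm.R.one_closed] _ xs, of k] k xs
    \<delta>_fun[OF f] \<delta>_fun[OF h] f h
  by (simp add: Mm.fun_module_closed Mm.smult_l_minus a_minus_def)

lemma \<delta>_zero:
  assumes "\<And>zs. zs \<in> tuples D n \<Longrightarrow> f zs = \<zero>\<^bsub>M\<^esub>" "xs \<in> tuples D (Suc n)"
  shows "\<delta> n f xs = \<zero>\<^bsub>M\<^esub>"
proof -
  have z: "\<zero>\<^bsub>\<F> n\<^esub> \<in> carrier (\<F> n)" by (auto simp: fun_module_def zero_cochain_def)
  have "\<delta> n f xs = \<zero>\<^bsub>F\<^esub> \<odot>\<^bsub>M\<^esub> \<delta> n \<zero>\<^bsub>\<F> n\<^esub> xs"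
    using assms by (intro \<delta>_smult z) (auto simp: Mm.fun_module_apply)
  also have "\<dots> = \<zero>\<^bsub>M\<^esub>" using \<delta>_fun[OF z] assms by (simp add: Mm.fun_module_closed)
  finally show ?thesis .
qed

lemma \<iota>_alternating: "f \<in> \<A> (Suc n) \<Longrightarrow> y \<in> D \<Longrightarrow> \<iota> n y f \<in> \<A> n"
  by (rule B.insertion_alternating)

lemma cartan_0:
  assumes "f \<in> \<A> 0" "x \<in> D" "xs \<in> tuples D 0"
  shows "\<delta> 0 f (x # xs) = \<theta> 0 x f xs"
  using B.cartan_0[OF assms(1,2)] assms(3) by (simp add: tuples_0)

lemmas cartan = B.cartan

text \<open>Since x may lie outside \<open>D\<close>, Cartan's formula for \<theta>_x is not at
  hand. Both sides are compared after inserting y from \<open>D\<close> instead: Cartan's formula at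
  y and the rule for i_y \<theta>_x leave the commutator of \<theta>_x and \<theta>_y, which is
  \<theta>_[x,y], and the induction hypothesis for i_y f.\<close>

lemma \<theta>_\<delta>:
  assumes "f \<in> \<A> n" "x \<in> carrier L" "zs \<in> tuples D (Suc n)"
  shows "\<theta> (Suc n) x (\<delta> n f) zs = \<delta> n (\<theta> n x f) zs"
  using assms
proof (induction n arbitrary: f zs)
  case 0
  then obtain y where zs: "zs = [y]" "y \<in> D" by (elim tuples_SucE) (auto simp: tuples_0)
  note f = alternating_fun[OF 0(1)]
  have \<delta>0: "\<delta> 0 h [v] = act v (h [])" if "h \<in> \<A> 0" "v \<in> D" for h v
    using cartan_0[of h v "[]"] that by (simp add: \<theta>_0 alternating_fun D_carrier)
  have u: "f [] \<in> carrier M" using Mm.fun_module_closed[OF f] by simp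
  have "\<theta> (Suc 0) x (\<delta> 0 f) [y] = act x (\<delta> 0 f [y]) \<ominus>\<^bsub>M\<^esub> \<delta> 0 f [bracket L x y]"
    using zs 0 f by (simp add: \<theta>_Cons \<theta>_0 \<delta>_fun \<iota>_fun \<iota>_apply)
  also have "\<dots> = act x (act y (f [])) \<ominus>\<^bsub>M\<^esub> act (bracket L x y) (f [])"
    using zs 0 by (simp add: \<delta>0)
  also have "\<dots> = act y (act x (f []))"
    using zs 0 u by (simp add: act_bracket act_closed D_carrier M.minus_simps)
  also have "\<dots> = \<delta> 0 (\<theta> 0 x f) [y]"
    using zs 0 f by (simp add: \<delta>0 \<theta>_alternating \<theta>_0)
  finally show ?case by (simp add: zs)
next
  case (Suc m)
  note f = Suc.prems(1) and x = Suc.prems(2)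
  note ff = alternating_fun[OF f]
  from Suc.prems(3) obtain y ys where zs: "zs = y # ys" "y \<in> D" "ys \<in> tuples D (Suc m)" by (rule tuples_SucE)
  have yL: "y \<in> carrier L" using zs D_carrier by simp
  have "\<theta> (Suc m) x (\<iota> (Suc m) y (\<delta> (Suc m) f)) ys
      = \<theta> (Suc m) x (\<theta> (Suc m) y f) ys \<ominus>\<^bsub>M\<^esub> \<theta> (Suc m) x (\<delta> m (\<iota> m y f)) ys"
    using x yL zs ff cartan[OF f]
    by (intro \<theta>_minus) (auto intro!: \<theta>_fun \<delta>_fun \<iota>_fun simp: \<iota>_apply)
  also have "\<theta> (Suc m) x (\<delta> m (\<iota> m y f)) ys = \<delta> m (\<theta> m x (\<iota> m y f)) ys"
    using Suc.IH[OF \<iota>_alternating[OF f] x] zs by simp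
  finally have 1: "\<theta> (Suc m) x (\<iota> (Suc m) y (\<delta> (Suc m) f)) ys
      = \<theta> (Suc m) x (\<theta> (Suc m) y f) ys \<ominus>\<^bsub>M\<^esub> \<delta> m (\<theta> m x (\<iota> m y f)) ys" .
  have 2: "\<delta> (Suc m) f (bracket L x y # ys)
      = \<theta> (Suc m) x (\<theta> (Suc m) y f) ys \<ominus>\<^bsub>M\<^esub> \<theta> (Suc m) y (\<theta> (Suc m) x f) ys
        \<ominus>\<^bsub>M\<^esub> \<delta> m (\<iota> m (bracket L x y) f) ys"
    using x zs yL cartan[OF f] by (simp add: \<theta>_bracket[OF f])
  have 3: "\<delta> m (\<iota> m y (\<theta> (Suc m) x f)) ys
      = \<delta> m (\<theta> m x (\<iota> m y f)) ys \<ominus>\<^bsub>M\<^esub> \<delta> m (\<iota> m (bracket L x y) f) ys"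
    using x zs ff by (intro \<delta>_minus) (auto intro!: \<theta>_fun \<iota>_fun simp: \<iota>_\<theta>)
  have cl: "\<theta> (Suc m) x (\<theta> (Suc m) y f) ys \<in> carrier M" "\<theta> (Suc m) y (\<theta> (Suc m) x f) ys \<in> carrier M"
    "\<delta> m (\<theta> m x (\<iota> m y f)) ys \<in> carrier M" "\<delta> m (\<iota> m (bracket L x y) f) ys \<in> carrier M"
    using x yL zs ff by (auto intro!: Mm.fun_module_closed[of _ D "Suc m"] \<theta>_fun \<delta>_fun \<iota>_fun)
  have "\<theta> (Suc (Suc m)) x (\<delta> (Suc m) f) zs
      = \<theta> (Suc m) x (\<iota> (Suc m) y (\<delta> (Suc m) f)) ys \<ominus>\<^bsub>M\<^esub> \<delta> (Suc m) f (bracket L x y # ys)"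
    using x zs ff by (simp add: \<theta>_Cons \<delta>_fun)
  moreover have "\<delta> (Suc m) (\<theta> (Suc m) x f) zs
      = \<theta> (Suc m) y (\<theta> (Suc m) x f) ys \<ominus>\<^bsub>M\<^esub> \<delta> m (\<iota> m y (\<theta> (Suc m) x f)) ys"
    using x zs by (simp add: cartan[OF \<theta>_alternating[OF f x]])
  ultimately show ?case using 1 2 3 cl by (simp add: M.minus_simps)
qed

text \<open>Cartan's formula gives i_x d f as a difference of two maps, the second alternating by
  induction, and yields linearity in x. On a repeated first entry x both of its terms equal
  \<theta>_x i_x f.\<close>

lemma \<delta>_alternating: "f \<in> \<A> n \<Longrightarrow> \<delta> n f \<in> \<A> (Suc n)"
proof (induction n arbitrary: f)
  case 0
  then have 1: "\<delta> 0 f (x # xs) = \<theta> 0 x f xs" if "x \<in> D" "xs \<in> tuples D 0" for x xs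
    using cartan_0 that by simp
  note ff = alternating_fun[OF 0]
  show ?case
  proof (rule B.alternating_SucI)
    show "\<delta> 0 f \<in> tuples D (Suc 0) \<rightarrow>\<^sub>E carrier M" using \<delta>_fun[OF ff] by (simp add: Mm.fun_module_carrier)
    show "\<iota> 0 x (\<delta> 0 f) \<in> \<A> 0" if "x \<in> D" for x
      using \<iota>_fun[OF \<delta>_fun[OF ff] that] by (simp add: alternating_maps_def Mm.fun_module_carrier)
  qed (simp_all add: 1 \<theta>_left_add[OF 0] \<theta>_left_smult[OF 0] D_carrier)
next
  case (Suc m)
  note f = Suc.prems
  note ff = alternating_fun[OF f]
  have ins: "\<iota> m x f \<in> \<A> m" if "x \<in> D" for x by (rule \<iota>_alternating[OF f that])
  note \<theta>cl = Mm.fun_module_closed[OF \<theta>_fun[OF ff]]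
  note \<delta>cl = Mm.fun_module_closed[OF \<delta>_fun[OF \<iota>_fun[OF ff]]]
  show ?case
  proof (rule B.alternating_SucI)
    show "\<delta> (Suc m) f \<in> tuples D (Suc (Suc m)) \<rightarrow>\<^sub>E carrier M"
      using \<delta>_fun[OF ff] by (simp add: Mm.fun_module_carrier)
    show "\<iota> (Suc m) x (\<delta> (Suc m) f) \<in> \<A> (Suc m)" if "x \<in> D" for x
      using that by (intro alternating_minus[OF \<theta>_alternating[OF f] Suc.IH[OF ins]])
        (auto simp: D_carrier \<iota>_apply cartan[OF f] intro!: \<iota>_fun \<delta>_fun ff)
  next
    fix x y ys assume x: "x \<in> D" and y: "y \<in> D" and ys: "ys \<in> tuples D (Suc m)"
    have "\<delta> m (\<iota> m (x \<oplus>\<^bsub>L\<^esub> y) f) ys = \<delta> m (\<iota> m x f) ys \<oplus>\<^bsub>M\<^esub> \<delta> m (\<iota> m y f) ys"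
      using x y ys by (intro \<delta>_add) (auto simp: \<iota>_apply B.alternating_head_add[OF f] intro!: \<iota>_fun ff)
    then show "\<delta> (Suc m) f ((x \<oplus>\<^bsub>L\<^esub> y) # ys) = \<delta> (Suc m) f (x # ys) \<oplus>\<^bsub>M\<^esub> \<delta> (Suc m) f (y # ys)"
      using x y ys by (simp add: cartan[OF f] \<theta>_left_add[OF f] D_carrier \<theta>cl \<delta>cl M.minus_simps)
  next
    fix a x ys assume a: "a \<in> carrier F" and x: "x \<in> D" and ys: "ys \<in> tuples D (Suc m)"
    have "\<delta> m (\<iota> m (a \<odot>\<^bsub>L\<^esub> x) f) ys = a \<odot>\<^bsub>M\<^esub> \<delta> m (\<iota> m x f) ys"
      using x a ys by (intro \<delta>_smult) (auto simp: \<iota>_apply B.alternating_head_smult[OF f] intro!: \<iota>_fun ff)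
    then show "\<delta> (Suc m) f ((a \<odot>\<^bsub>L\<^esub> x) # ys) = a \<odot>\<^bsub>M\<^esub> \<delta> (Suc m) f (x # ys)"
      using x a ys by (simp add: cartan[OF f] \<theta>_left_smult[OF f] D_carrier \<theta>cl \<delta>cl
          a_minus_def Mm.smult_r_distr Mm.smult_r_minus)
  next
    fix k x ys assume "Suc m = Suc k" and x: "x \<in> D" and ys: "ys \<in> tuples D k"
    then have [simp]: "k = m" by simp
    have xL: "x \<in> carrier L" using x D_carrier by simp
    have "bracket L x x # ys \<in> tuples D (Suc m)" using x xL ys by simp
    \<comment> \<open>[x, x] = 0 is written as the zero multiple of itself, so that linearity in the
      first slot makes the value zero.\<close>
    then have "f (bracket L x x # ys) = \<zero>\<^bsub>F\<^esub> \<odot>\<^bsub>M\<^esub> f (bracket L x x # ys)"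
      using B.alternating_head_smult[OF f, of "bracket L x x" "\<zero>\<^bsub>F\<^esub>" ys] x xL ys
      by (simp add: Lie.bracket_self)
    then have "f (bracket L x x # ys) = \<zero>\<^bsub>M\<^esub>"
      using \<open>bracket L x x # ys \<in> tuples D (Suc m)\<close> B.alternating_closed[OF f] by simp
    moreover have \<theta>icl: "\<theta> m x (\<iota> m x f) ys \<in> carrier M"
      using x xL ys ff by (auto intro!: Mm.fun_module_closed[of _ D m] \<theta>_fun \<iota>_fun)
    ultimately have 1: "\<theta> (Suc m) x f (x # ys) = \<theta> m x (\<iota> m x f) ys"
      using x xL ys by (simp add: \<theta>_Cons[OF ff] a_minus_def)
    \<comment> \<open>Cartan's formula again, now for i_x f at x; its second term contains i_x i_x f
      = 0.\<close>
    have 2: "\<delta> m (\<iota> m x f) (x # ys) = \<theta> m x (\<iota> m x f) ys"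
    proof (cases m)
      case 0
      then show ?thesis using ins[OF x] x ys by (simp add: cartan_0)
    next
      case (Suc l)
      have "\<delta> l (\<iota> l x (\<iota> m x f)) ys = \<zero>\<^bsub>M\<^esub>"
      proof (rule \<delta>_zero)
        show "\<iota> l x (\<iota> m x f) zs = \<zero>\<^bsub>M\<^esub>" if "zs \<in> tuples D l" for zs
          using that x Suc B.alternating_eq[OF f, of "x # x # zs" 0 1] by (simp add: \<iota>_apply)
      qed (use ys Suc in simp)
      then show ?thesis using Suc ins[OF x] x ys \<theta>icl cartan[of "\<iota> m x f" l x ys]
        by (simp add: a_minus_def)
    qed
    show "\<delta> (Suc m) f (x # x # ys) = \<zero>\<^bsub>M\<^esub>"
      using cartan[OF f x, of "x # ys"] x ys 1 2 \<theta>icl by (simp add: M.a_minus_self)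
  qed
qed

text \<open>Inserting y turns d d f into \<theta>_y d f - d \<theta>_y f + d d i_y f. The first two
  terms cancel by \<open>\<theta>_\<delta>\<close> and the last vanishes by induction; in degree 0
  it is absent.\<close>

lemma \<delta>_\<delta>:
  assumes "f \<in> \<A> n" "zs \<in> tuples D (Suc (Suc n))"
  shows "\<delta> (Suc n) (\<delta> n f) zs = \<zero>\<^bsub>M\<^esub>"
  using assms
proof (induction n arbitrary: f zs)
  case 0
  note f = 0(1)
  note ff = alternating_fun[OF f]
  from 0(2) obtain y ys where zs: "zs = y # ys" "y \<in> D" "ys \<in> tuples D (Suc 0)" by (rule tuples_SucE)
  have yL: "y \<in> carrier L" using zs D_carrier by simp
  have "\<iota> 0 y (\<delta> 0 f) = \<theta> 0 y f"
    using zs yL by (intro Mm.fun_module_ext[of _ D 0]) (auto intro!: \<iota>_fun \<delta>_fun \<theta>_fun ff simp: \<iota>_apply cartan_0 f)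
  then have "\<delta> (Suc 0) (\<delta> 0 f) zs = \<theta> (Suc 0) y (\<delta> 0 f) ys \<ominus>\<^bsub>M\<^esub> \<delta> 0 (\<theta> 0 y f) ys"
    using zs by (simp add: cartan[OF \<delta>_alternating[OF f]])
  also have "\<theta> (Suc 0) y (\<delta> 0 f) ys = \<delta> 0 (\<theta> 0 y f) ys" by (rule \<theta>_\<delta>[OF f yL zs(3)])
  also have "\<dots> \<ominus>\<^bsub>M\<^esub> \<delta> 0 (\<theta> 0 y f) ys = \<zero>\<^bsub>M\<^esub>"
    using zs yL Mm.fun_module_closed[OF \<delta>_fun[OF \<theta>_fun[OF ff yL]]] by (simp add: M.a_minus_self)
  finally show ?case .
next
  case (Suc m)
  note f = Suc.prems(1)
  note ff = alternating_fun[OF f]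
  from Suc.prems(2) obtain y ys where zs: "zs = y # ys" "y \<in> D" "ys \<in> tuples D (Suc (Suc m))" by (rule tuples_SucE)
  have yL: "y \<in> carrier L" using zs D_carrier by simp
  have cl: "\<delta> (Suc m) (\<theta> (Suc m) y f) ys \<in> carrier M"
    using zs yL Mm.fun_module_closed[OF \<delta>_fun[OF \<theta>_fun[OF ff yL]]] by simp
  have "\<delta> (Suc m) (\<iota> (Suc m) y (\<delta> (Suc m) f)) ys
      = \<delta> (Suc m) (\<theta> (Suc m) y f) ys \<ominus>\<^bsub>M\<^esub> \<delta> (Suc m) (\<delta> m (\<iota> m y f)) ys"
    using zs yL by (intro \<delta>_minus) (auto intro!: \<iota>_fun \<delta>_fun \<theta>_fun ff simp: \<iota>_apply cartan[OF f])
  also have "\<delta> (Suc m) (\<delta> m (\<iota> m y f)) ys = \<zero>\<^bsub>M\<^esub>"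
    using zs by (intro Suc.IH \<iota>_alternating f)
  finally have "\<delta> (Suc m) (\<iota> (Suc m) y (\<delta> (Suc m) f)) ys = \<delta> (Suc m) (\<theta> (Suc m) y f) ys"
    using cl by (simp add: a_minus_def)
  then show ?case
    using zs cl cartan[OF \<delta>_alternating[OF f], of y ys] \<theta>_\<delta>[OF f yL zs(3)] by (simp add: M.a_minus_self)
qed

end

section \<open>Relative cochains\<close>

lemma submodule_zero_mem: "submodule U R M \<Longrightarrow> \<zero>\<^bsub>M\<^esub> \<in> U"
  using subgroup.one_closed[of U "add_monoid M"] by (simp add: submodule_def)

section \<open>Cosets and quotient modules\<close>

context module
begin

lemma quotient_module_abelian_subgroup: "submodule U R M \<Longrightarrow> abelian_subgroup U M"
  by (intro abelian_subgroupI3 M.abelian_group_axioms additive_subgroupI)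
    (simp add: submodule_def)

lemma quotient_module_simps:
  shows "carrier (quotient_module M U) = (\<lambda>x. U +>\<^bsub>M\<^esub> x) ` carrier M"
    and "\<zero>\<^bsub>quotient_module M U\<^esub> = U"
  by (auto simp: quotient_module_def A_RCOSETS_def' a_r_coset_def')

lemma quotient_module_add:
  assumes "submodule U R M" "x \<in> carrier M" "y \<in> carrier M"
  shows "(U +>\<^bsub>M\<^esub> x) \<oplus>\<^bsub>quotient_module M U\<^esub> (U +>\<^bsub>M\<^esub> y) = U +>\<^bsub>M\<^esub> (x \<oplus>\<^bsub>M\<^esub> y)"
proof -
  interpret abelian_subgroup U M using assms(1) by (rule quotient_module_abelian_subgroup)
  show ?thesis using assms(2,3) by (simp add: quotient_module_def a_rcos_sum)
qed

lemma coset_mem: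
  assumes "submodule U R M" "x \<in> carrier M"
  shows "y \<in> U +>\<^bsub>M\<^esub> x \<longleftrightarrow> (\<exists>u\<in>U. y = u \<oplus>\<^bsub>M\<^esub> x)"
  by (auto simp: a_r_coset_def')

lemma coset_eqI:
  assumes "submodule U R M" "x \<in> carrier M" "y \<in> U +>\<^bsub>M\<^esub> x"
  shows "U +>\<^bsub>M\<^esub> y = U +>\<^bsub>M\<^esub> x"
proof -
  have "subgroup U (add_monoid M)" using assms(1) by (simp add: submodule_def)
  then show ?thesis using assms(2,3) M.a_repr_independence by metis
qed

lemma coset_self: "submodule U R M \<Longrightarrow> x \<in> carrier M \<Longrightarrow> x \<in> U +>\<^bsub>M\<^esub> x"
  using coset_mem[of U x x] submodule_zero_mem[of U R M] M.l_zero[of x] by metis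

lemma coset_zero:
  assumes "submodule U R M" "u \<in> U"
  shows "U +>\<^bsub>M\<^esub> u = U"
proof -
  interpret abelian_subgroup U M using assms(1) by (rule quotient_module_abelian_subgroup)
  show ?thesis using assms(2) by (rule a_rcos_const)
qed

lemma coset_add_left:
  assumes "submodule U R M" "u \<in> U" "x \<in> carrier M"
  shows "U +>\<^bsub>M\<^esub> (u \<oplus>\<^bsub>M\<^esub> x) = U +>\<^bsub>M\<^esub> x"
  using assms coset_mem by (intro coset_eqI) auto

lemma quotient_module_smult:
  assumes U: "submodule U R M" and a: "a \<in> carrier R" and x: "x \<in> carrier M"
  shows "a \<odot>\<^bsub>quotient_module M U\<^esub> (U +>\<^bsub>M\<^esub> x) = U +>\<^bsub>M\<^esub> (a \<odot>\<^bsub>M\<^esub> x)"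
proof -
  have "U +>\<^bsub>M\<^esub> (a \<odot>\<^bsub>M\<^esub> y) = U +>\<^bsub>M\<^esub> (a \<odot>\<^bsub>M\<^esub> x)" if "y \<in> U +>\<^bsub>M\<^esub> x" for y
  proof -
    from that obtain u where u: "u \<in> U" "y = u \<oplus>\<^bsub>M\<^esub> x" using coset_mem[OF U x] by auto
    then have "u \<in> carrier M" using submoduleE(1)[OF U] by auto
    then have "a \<odot>\<^bsub>M\<^esub> y = a \<odot>\<^bsub>M\<^esub> u \<oplus>\<^bsub>M\<^esub> a \<odot>\<^bsub>M\<^esub> x" using u a x by (simp add: smult_r_distr)
    then show ?thesis using u a x submoduleE(4)[OF U] by (simp add: coset_add_left[OF U])
  qed
  moreover have "U +>\<^bsub>M\<^esub> x \<noteq> {}" using coset_self[OF U x] by blast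
  ultimately show ?thesis by (simp add: quotient_module_def the_elem_image_unique)
qed

lemma quotient_module_group:
  assumes U: "submodule U R M"
  shows "abelian_group (quotient_module M U)"
proof (rule abelian_groupI)
  note [simp] = quotient_module_simps quotient_module_add[OF U]
  have U0: "U +>\<^bsub>M\<^esub> \<zero>\<^bsub>M\<^esub> = U" by (rule coset_zero[OF U submodule_zero_mem[OF U]])
  show "\<zero>\<^bsub>quotient_module M U\<^esub> \<in> carrier (quotient_module M U)" using U0 by force
  fix X assume "X \<in> carrier (quotient_module M U)"
  then obtain x where x: "x \<in> carrier M" "X = U +>\<^bsub>M\<^esub> x" by auto
  have "\<zero>\<^bsub>quotient_module M U\<^esub> \<oplus>\<^bsub>quotient_module M U\<^esub> X
      = (U +>\<^bsub>M\<^esub> \<zero>\<^bsub>M\<^esub>) \<oplus>\<^bsub>quotient_module M U\<^esub> (U +>\<^bsub>M\<^esub> x)"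
    by (simp add: U0 x(2))
  also have "\<dots> = X" using x by (subst quotient_module_add[OF U]) auto
  finally show "\<zero>\<^bsub>quotient_module M U\<^esub> \<oplus>\<^bsub>quotient_module M U\<^esub> X = X" .
  have "(U +>\<^bsub>M\<^esub> (\<ominus>\<^bsub>M\<^esub> x)) \<oplus>\<^bsub>quotient_module M U\<^esub> X = \<zero>\<^bsub>quotient_module M U\<^esub>"
    using x U0 by (simp add: M.l_neg)
  then show "\<exists>Y\<in>carrier (quotient_module M U). Y \<oplus>\<^bsub>quotient_module M U\<^esub> X = \<zero>\<^bsub>quotient_module M U\<^esub>"
    using x by auto
qed (auto simp: quotient_module_simps quotient_module_add[OF U] M.a_ac)

lemma quotient_module_a_inv:
  assumes U: "submodule U R M" and x: "x \<in> carrier M"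
  shows "\<ominus>\<^bsub>quotient_module M U\<^esub> (U +>\<^bsub>M\<^esub> x) = U +>\<^bsub>M\<^esub> (\<ominus>\<^bsub>M\<^esub> x)"
proof -
  interpret Q: abelian_group "quotient_module M U" using U by (rule quotient_module_group)
  have "U +>\<^bsub>M\<^esub> \<zero>\<^bsub>M\<^esub> = U" using U by (intro coset_zero submodule_zero_mem)
  then show ?thesis using x
    by (intro Q.minus_equality) (auto simp: quotient_module_add[OF U] quotient_module_simps M.l_neg)
qed

lemma quotient_module_finsum:
  assumes U: "submodule U R M" and "finite A" "u \<in> A \<rightarrow> carrier M"
  shows "(\<Oplus>\<^bsub>quotient_module M U\<^esub>i\<in>A. U +>\<^bsub>M\<^esub> u i) = U +>\<^bsub>M\<^esub> (finsum M u A)"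
proof -
  interpret Q: abelian_group "quotient_module M U" using U by (rule quotient_module_group)
  show ?thesis using assms(2,3)
  proof (induction rule: finite_induct)
    case empty
    have "U +>\<^bsub>M\<^esub> \<zero>\<^bsub>M\<^esub> = U" using U by (intro coset_zero submodule_zero_mem)
    then show ?case by (simp add: quotient_module_simps)
  next
    case (insert i A)
    then have "u i \<in> carrier M" "u \<in> A \<rightarrow> carrier M" by auto
    with insert show ?case
      using Q.finsum_insert[of A i "\<lambda>i. U +>\<^bsub>M\<^esub> u i"]
      by (simp add: quotient_module_simps quotient_module_add[OF U] M.finsum_closed Pi_def)
  qed
qed

end

section \<open>Relative cocycles and coboundaries\<close>

context lie_ideal_module
begin

abbreviation "\<R> K n \<equiv> rel_cochains F (L\<lparr>carrier := D\<rparr>) K M act n"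
abbreviation "\<Z> K n \<equiv> rel_cocycles F (L\<lparr>carrier := D\<rparr>) K M act n"
abbreviation "\<B> K n \<equiv> rel_coboundaries F (L\<lparr>carrier := D\<rparr>) K M act n"

lemma eq_zero_cochain_iff:
  assumes "f \<in> carrier (\<F> n)"
  shows "f = zero_cochain M D n \<longleftrightarrow> (\<forall>xs\<in>tuples D n. f xs = \<zero>\<^bsub>M\<^esub>)"
  using Mm.fun_module_ext[OF assms, of "zero_cochain M D n"]
  by (auto simp: zero_cochain_def Mm.fun_module_carrier)

lemma lie_deriv_restrict: "lie_deriv (L\<lparr>carrier := E\<rparr>) M act = lie_deriv L M act"
  by (simp add: lie_deriv_def fun_eq_iff)

lemma rel_cochains_iff:
  assumes "K \<subseteq> D"
  shows "f \<in> \<R> K n \<longleftrightarrow> f \<in> \<A> n \<and>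
    (\<forall>x\<in>K. (\<forall>m. n = Suc m \<longrightarrow> (\<forall>ys\<in>tuples D m. f (x # ys) = \<zero>\<^bsub>M\<^esub>)) \<and>
            (\<forall>xs\<in>tuples D n. \<theta> n x f xs = \<zero>\<^bsub>M\<^esub>))"
proof -
  have "\<iota> m x f = zero_cochain M D m \<longleftrightarrow> (\<forall>ys\<in>tuples D m. f (x # ys) = \<zero>\<^bsub>M\<^esub>)"
    if "f \<in> \<A> n" "x \<in> K" "n = Suc m" for x m
    using that assms alternating_fun[of f n] \<iota>_fun[of f m x]
    by (subst eq_zero_cochain_iff) (auto simp: \<iota>_apply)
  moreover have "\<theta> n x f = zero_cochain M D n \<longleftrightarrow> (\<forall>xs\<in>tuples D n. \<theta> n x f xs = \<zero>\<^bsub>M\<^esub>)"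
    if "f \<in> \<A> n" "x \<in> K" for x
    using that assms by (intro eq_zero_cochain_iff \<theta>_fun alternating_fun) (auto intro: D_carrier)
  ultimately show ?thesis unfolding rel_cochains_def by (auto simp: lie_deriv_restrict)
qed

lemma rel_cocycles_iff:
  assumes "K \<subseteq> D"
  shows "f \<in> \<Z> K n \<longleftrightarrow> f \<in> \<R> K n \<and> (\<forall>xs\<in>tuples D (Suc n). \<delta> n f xs = \<zero>\<^bsub>M\<^esub>)"
proof -
  have "\<delta> n f = zero_cochain M D (Suc n) \<longleftrightarrow> (\<forall>xs\<in>tuples D (Suc n). \<delta> n f xs = \<zero>\<^bsub>M\<^esub>)" if "f \<in> \<R> K n"
    using that assms by (intro eq_zero_cochain_iff \<delta>_fun alternating_fun) (auto simp: rel_cochains_iff)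
  then show ?thesis unfolding rel_cocycles_def by auto
qed

lemma rel_cochains_alternating: "f \<in> \<R> K n \<Longrightarrow> f \<in> \<A> n"
  by (simp add: rel_cochains_def)

lemma rel_cochains_fun: "f \<in> \<R> K n \<Longrightarrow> f \<in> carrier (\<F> n)"
  by (intro alternating_fun rel_cochains_alternating)

lemma \<theta>_zero:
  assumes "\<And>zs. zs \<in> tuples D n \<Longrightarrow> f zs = \<zero>\<^bsub>M\<^esub>" "x \<in> carrier L" "xs \<in> tuples D n"
  shows "\<theta> n x f xs = \<zero>\<^bsub>M\<^esub>"
proof -
  have z: "\<zero>\<^bsub>\<F> n\<^esub> \<in> carrier (\<F> n)" by (auto simp: fun_module_def zero_cochain_def)
  have "\<theta> n x f xs = \<zero>\<^bsub>F\<^esub> \<odot>\<^bsub>M\<^esub> \<theta> n x \<zero>\<^bsub>\<F> n\<^esub> xs"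
    using assms by (intro \<theta>_smult z) (auto simp: Mm.fun_module_apply)
  also have "\<dots> = \<zero>\<^bsub>M\<^esub>" using \<theta>_fun[OF z assms(2)] assms(3) by (simp add: Mm.fun_module_closed)
  finally show ?thesis .
qed

lemma \<theta>_left_zero:
  assumes "f \<in> \<A> n" "xs \<in> tuples D n"
  shows "\<theta> n \<zero>\<^bsub>L\<^esub> f xs = \<zero>\<^bsub>M\<^esub>"
  using \<theta>_left_smult[OF assms(1) L.M.zero_closed Mm.R.zero_closed assms(2)] \<theta>_fun[OF alternating_fun[OF assms(1)] L.M.zero_closed] assms(2)
  by (simp add: Mm.fun_module_closed)

lemma alternating_head_zero:
  assumes "f \<in> \<A> (Suc n)" "xs \<in> tuples D n"
  shows "f (\<zero>\<^bsub>L\<^esub> # xs) = \<zero>\<^bsub>M\<^esub>"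
proof -
  have "\<zero>\<^bsub>L\<^esub> \<in> D" using D_submodule by (rule submodule_zero_mem)
  then show ?thesis
    using B.alternating_head_smult[OF assms(1) _ Mm.R.zero_closed assms(2), of "\<zero>\<^bsub>L\<^esub>"] B.alternating_closed[OF assms(1)] assms(2)
    by simp
qed

text \<open>For x in \<open>K\<close>, Cartan's formula expresses i_x d f through \<theta>_x f and d
  i_x f, and \<theta>_x d f = d \<theta>_x f; all of these vanish.\<close>

lemma \<delta>_rel_cochains:
  assumes K: "K \<subseteq> D" and f: "f \<in> \<R> K n"
  shows "\<delta> n f \<in> \<R> K (Suc n)"
proof -
  note alt = rel_cochains_alternating[OF f]
  have \<theta>z: "\<theta> n x f xs = \<zero>\<^bsub>M\<^esub>" if "x \<in> K" "xs \<in> tuples D n" for x xs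
    using f that by (simp add: rel_cochains_iff[OF K])
  have "\<delta> n f (x # ys) = \<zero>\<^bsub>M\<^esub>" if x: "x \<in> K" and ys: "ys \<in> tuples D n" for x ys
  proof (cases n)
    case 0
    then show ?thesis using alt x ys K \<theta>z by (auto simp: cartan_0)
  next
    case (Suc m)
    have "\<delta> m (\<iota> m x f) ys = \<zero>\<^bsub>M\<^esub>"
      using f x ys Suc by (intro \<delta>_zero) (auto simp: \<iota>_apply rel_cochains_iff[OF K])
    then show ?thesis using cartan[of f m x ys] alt x ys K \<theta>z Suc by (auto simp: M.a_minus_self)
  qed
  moreover have "\<theta> (Suc n) x (\<delta> n f) zs = \<zero>\<^bsub>M\<^esub>" if "x \<in> K" "zs \<in> tuples D (Suc n)" for x zs
  proof -
    have "\<theta> (Suc n) x (\<delta> n f) zs = \<delta> n (\<theta> n x f) zs" using that K by (intro \<theta>_\<delta> alt) (auto intro: D_carrier)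
    also have "\<dots> = \<zero>\<^bsub>M\<^esub>" using that \<theta>z by (intro \<delta>_zero) auto
    finally show ?thesis .
  qed
  ultimately show ?thesis using \<delta>_alternating[OF alt] by (auto simp: rel_cochains_iff[OF K])
qed

text \<open>For y in \<open>K\<close>, the errors in commuting i_y and \<theta>_y past \<theta>_x
  are i_[x,y] f and \<theta>_[y,x] f, which vanish by \<open>comm\<close>. The intended x are
  elements of \<open>J\<close>.\<close>

lemma \<theta>_rel_cochains:
  assumes K: "K \<subseteq> D" and f: "f \<in> \<R> K n" and x: "x \<in> carrier L"
    and comm: "\<And>y. y \<in> K \<Longrightarrow> bracket L y x = \<zero>\<^bsub>L\<^esub>"
  shows "\<theta> n x f \<in> \<R> K n"
proof -
  note alt = rel_cochains_alternating[OF f]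
  have K': "y \<in> D" "y \<in> carrier L" if "y \<in> K" for y using that K D_carrier by auto
  have comm': "bracket L x y = \<zero>\<^bsub>L\<^esub>" if "y \<in> K" for y
    using bracket_anti[of y x] comm[OF that] K'[OF that] x by simp
  have "\<theta> n x f (y # ys) = \<zero>\<^bsub>M\<^esub>" if n: "n = Suc m" and y: "y \<in> K" and ys: "ys \<in> tuples D m" for m y ys
  proof -
    have "\<theta> m x (\<iota> m y f) ys = \<zero>\<^bsub>M\<^esub>"
      using f x y ys n by (intro \<theta>_zero) (auto simp: \<iota>_apply rel_cochains_iff[OF K])
    then show ?thesis using n alt x K'[OF y] ys comm'[OF y]
      by (simp add: \<theta>_Cons alternating_fun alternating_head_zero M.a_minus_self)
  qed
  moreover have "\<theta> n y (\<theta> n x f) zs = \<zero>\<^bsub>M\<^esub>" if y: "y \<in> K" and zs: "zs \<in> tuples D n" for y zs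
  proof -
    have "\<theta> n x (\<theta> n y f) zs = \<zero>\<^bsub>M\<^esub>"
      using f x y zs by (intro \<theta>_zero[where n = n and xs = zs, OF _ x zs]) (auto simp: rel_cochains_iff[OF K])
    moreover have "\<theta> n y (\<theta> n x f) zs \<in> carrier M"
      by (rule Mm.fun_module_closed[OF \<theta>_fun[OF \<theta>_fun[OF alternating_fun[OF alt] x] K'(2)[OF y]] zs])
    ultimately show ?thesis
      using \<theta>_bracket[OF alt K'(2)[OF y] x zs] zs comm[OF y] \<theta>_left_zero[OF alt zs] by (simp add: a_minus_def)
  qed
  ultimately show ?thesis using \<theta>_alternating[OF alt x] by (auto simp: rel_cochains_iff[OF K])
qed

lemma submodule_rel_cochains:
  assumes K: "K \<subseteq> D"
  shows "submodule (\<R> K n) F (\<F> n)"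
proof -
  interpret W: module F "\<F> n" by (rule Mm.fun_module_module)
  note A = W.submoduleE[OF submodule_alternating]
  have KL: "x \<in> carrier L" if "x \<in> K" for x using that K D_carrier by auto
  show ?thesis
  proof (rule W.submodule_lincombI)
    show "\<R> K n \<subseteq> carrier (\<F> n)" using rel_cochains_fun by auto
    show "\<zero>\<^bsub>\<F> n\<^esub> \<in> \<R> K n"
      unfolding rel_cochains_iff[OF K] using submodule_zero_mem[OF submodule_alternating] KL K
      by (auto simp: Mm.fun_module_apply intro!: \<theta>_zero)
  next
    fix a b f h assume ab: "a \<in> carrier F" "b \<in> carrier F" and fh: "f \<in> \<R> K n" "h \<in> \<R> K n"
    let ?k = "a \<odot>\<^bsub>\<F> n\<^esub> f \<oplus>\<^bsub>\<F> n\<^esub> b \<odot>\<^bsub>\<F> n\<^esub> h"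
    have "?k \<in> \<A> n" using fh ab A(4,5) by (simp add: rel_cochains_alternating)
    moreover have "\<theta> n x ?k xs = \<zero>\<^bsub>M\<^esub>" if "x \<in> K" "xs \<in> tuples D n" for x xs
    proof -
      have "\<theta> n x ?k xs = a \<odot>\<^bsub>M\<^esub> \<theta> n x f xs \<oplus>\<^bsub>M\<^esub> b \<odot>\<^bsub>M\<^esub> \<theta> n x h xs"
        using that fh ab by (intro \<theta>_lincomb KL) (auto simp: rel_cochains_fun Mm.fun_module_apply)
      then show ?thesis using fh ab that by (simp add: rel_cochains_iff[OF K])
    qed
    ultimately show "?k \<in> \<R> K n"
      using fh ab K unfolding rel_cochains_iff[OF K] by (auto simp: Mm.fun_module_apply)
  qed
qed

lemma submodule_rel_cocycles:
  assumes K: "K \<subseteq> D"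
  shows "submodule (\<Z> K n) F (\<F> n)"
proof -
  interpret W: module F "\<F> n" by (rule Mm.fun_module_module)
  note sub = submodule_rel_cochains[OF K]
  show ?thesis
  proof (rule W.submodule_lincombI)
    show "\<Z> K n \<subseteq> carrier (\<F> n)" using rel_cochains_fun by (auto simp: rel_cocycles_def)
    show "\<zero>\<^bsub>\<F> n\<^esub> \<in> \<Z> K n"
      using submodule_zero_mem[OF sub]
      by (auto simp: rel_cocycles_iff[OF K] Mm.fun_module_apply intro!: \<delta>_zero)
  next
    fix a b f h assume ab: "a \<in> carrier F" "b \<in> carrier F" and fh: "f \<in> \<Z> K n" "h \<in> \<Z> K n"
    let ?k = "a \<odot>\<^bsub>\<F> n\<^esub> f \<oplus>\<^bsub>\<F> n\<^esub> b \<odot>\<^bsub>\<F> n\<^esub> h"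
    have r: "f \<in> \<R> K n" "h \<in> \<R> K n" using fh by (auto simp: rel_cocycles_def)
    have "\<delta> n ?k xs = a \<odot>\<^bsub>M\<^esub> \<delta> n f xs \<oplus>\<^bsub>M\<^esub> b \<odot>\<^bsub>M\<^esub> \<delta> n h xs" if "xs \<in> tuples D (Suc n)" for xs
      using that r ab by (intro \<delta>_lincomb) (auto simp: rel_cochains_fun Mm.fun_module_apply)
    then show "?k \<in> \<Z> K n"
      using W.submoduleE(4,5)[OF sub] r fh ab by (simp add: rel_cocycles_iff[OF K])
  qed
qed

lemma rel_coboundaries_Suc: "\<B> K (Suc m) = \<delta> m ` \<R> K m"
  by (simp add: rel_coboundaries_def)

lemma rel_coboundaries_0: "\<B> K 0 = {\<zero>\<^bsub>\<F> 0\<^esub>}"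
  by (simp add: rel_coboundaries_def fun_module_def)

lemma rel_coboundaries_cocycles:
  assumes K: "K \<subseteq> D"
  shows "\<B> K n \<subseteq> \<Z> K n"
proof (cases n)
  case 0
  have "\<zero>\<^bsub>\<F> 0\<^esub> \<in> \<Z> K 0"
    using submodule_rel_cocycles[OF K, of 0] by (rule submodule_zero_mem)
  then show ?thesis using 0 by (simp add: rel_coboundaries_0)
next
  case (Suc m)
  have "\<delta> m f \<in> \<Z> K (Suc m)" if f: "f \<in> \<R> K m" for f
    using \<delta>_rel_cochains[OF K f] \<delta>_\<delta>[OF rel_cochains_alternating[OF f]]
    unfolding rel_cocycles_iff[OF K] by blast
  then show ?thesis using Suc by (auto simp: rel_coboundaries_Suc)
qed

lemma submodule_\<delta>_image:
  assumes S: "submodule S F (\<F> n)"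
  shows "submodule (\<delta> n ` S) F (\<F> (Suc n))"
proof -
  interpret W: module F "\<F> n" by (rule Mm.fun_module_module)
  interpret W': module F "\<F> (Suc n)" by (rule Mm.fun_module_module)
  note S' = W.submoduleE[OF S]
  have Sf: "f \<in> carrier (\<F> n)" if "f \<in> S" for f using that S'(1) by auto
  show ?thesis
  proof (rule W'.submodule_lincombI)
    show "\<delta> n ` S \<subseteq> carrier (\<F> (Suc n))" using Sf \<delta>_fun by auto
    have "\<zero>\<^bsub>\<F> (Suc n)\<^esub> = \<delta> n \<zero>\<^bsub>\<F> n\<^esub>"
      using W.zero_closed by (intro Mm.fun_module_ext[of _ D "Suc n"])
        (auto simp: Mm.fun_module_apply \<delta>_zero intro!: \<delta>_fun)
    then show "\<zero>\<^bsub>\<F> (Suc n)\<^esub> \<in> \<delta> n ` S" using submodule_zero_mem[OF S] by auto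
  next
    fix a b u v assume ab: "a \<in> carrier F" "b \<in> carrier F" and "u \<in> \<delta> n ` S" "v \<in> \<delta> n ` S"
    then obtain f h where fh: "f \<in> S" "h \<in> S" "u = \<delta> n f" "v = \<delta> n h" by auto
    let ?k = "a \<odot>\<^bsub>\<F> n\<^esub> f \<oplus>\<^bsub>\<F> n\<^esub> b \<odot>\<^bsub>\<F> n\<^esub> h"
    have "\<delta> n ?k xs = a \<odot>\<^bsub>M\<^esub> \<delta> n f xs \<oplus>\<^bsub>M\<^esub> b \<odot>\<^bsub>M\<^esub> \<delta> n h xs" if "xs \<in> tuples D (Suc n)" for xs
      using that by (intro \<delta>_lincomb Sf fh ab) (simp_all add: Mm.fun_module_apply)
    then have "a \<odot>\<^bsub>\<F> (Suc n)\<^esub> u \<oplus>\<^bsub>\<F> (Suc n)\<^esub> b \<odot>\<^bsub>\<F> (Suc n)\<^esub> v = \<delta> n ?k"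
      unfolding fh(3,4)
      by (intro Mm.fun_module_ext[of _ D "Suc n"] W'.a_closed W'.smult_closed \<delta>_fun W.a_closed
          W.smult_closed Sf fh ab) (simp add: Mm.fun_module_apply)
    then show "a \<odot>\<^bsub>\<F> (Suc n)\<^esub> u \<oplus>\<^bsub>\<F> (Suc n)\<^esub> b \<odot>\<^bsub>\<F> (Suc n)\<^esub> v \<in> \<delta> n ` S"
      using S'(4,5) fh ab by auto
  qed
qed

lemma submodule_rel_coboundaries:
  assumes K: "K \<subseteq> D"
  shows "submodule (\<B> K n) F (\<F> n)"
proof (cases n)
  case 0
  interpret W: module F "\<F> 0" by (rule Mm.fun_module_module)
  show ?thesis unfolding 0 rel_coboundaries_0 by (rule W.submodule_smultI) auto
next
  case (Suc m)
  show ?thesis unfolding Suc rel_coboundaries_Suc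
    by (intro submodule_\<delta>_image submodule_rel_cochains K)
qed

lemma \<theta>_rel_cocycles:
  assumes K: "K \<subseteq> D" and f: "f \<in> \<Z> K n" and x: "x \<in> carrier L"
    and comm: "\<And>y. y \<in> K \<Longrightarrow> bracket L y x = \<zero>\<^bsub>L\<^esub>"
  shows "\<theta> n x f \<in> \<Z> K n"
proof -
  have r: "f \<in> \<R> K n" using f by (simp add: rel_cocycles_def)
  have "\<delta> n (\<theta> n x f) zs = \<zero>\<^bsub>M\<^esub>" if "zs \<in> tuples D (Suc n)" for zs
  proof -
    have "\<delta> n (\<theta> n x f) zs = \<theta> (Suc n) x (\<delta> n f) zs"
      using that x r by (intro \<theta>_\<delta>[symmetric] rel_cochains_alternating)
    also have "\<dots> = \<zero>\<^bsub>M\<^esub>" using f that x by (intro \<theta>_zero) (auto simp: rel_cocycles_iff[OF K])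
    finally show ?thesis .
  qed
  then show ?thesis using \<theta>_rel_cochains[OF K r x comm] by (simp add: rel_cocycles_iff[OF K])
qed

text \<open>\<theta>_x d h = d \<theta>_x h with \<theta>_x h again relative; this lets \<theta>_x
  act on cohomology classes.\<close>

lemma \<theta>_rel_coboundaries:
  assumes K: "K \<subseteq> D" and f: "f \<in> \<B> K n" and x: "x \<in> carrier L"
    and comm: "\<And>y. y \<in> K \<Longrightarrow> bracket L y x = \<zero>\<^bsub>L\<^esub>"
  shows "\<theta> n x f \<in> \<B> K n"
proof (cases n)
  case 0
  have "\<theta> 0 x \<zero>\<^bsub>\<F> 0\<^esub> = \<zero>\<^bsub>\<F> 0\<^esub>"
    using x by (intro Mm.fun_module_ext[of _ D 0] \<theta>_fun)
      (auto simp: Mm.fun_module_apply \<theta>_zero fun_module_def zero_cochain_def)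
  then show ?thesis using f 0 by (simp add: rel_coboundaries_0)
next
  case (Suc m)
  then obtain h where h: "h \<in> \<R> K m" "f = \<delta> m h" using f by (auto simp: rel_coboundaries_Suc)
  have "\<theta> n x f = \<delta> m (\<theta> m x h)" unfolding h(2) Suc
    using x h by (intro Mm.fun_module_ext[of _ D "Suc m"] \<theta>_fun \<delta>_fun)
      (auto intro!: \<theta>_\<delta> intro: rel_cochains_alternating rel_cochains_fun)
  then show ?thesis using \<theta>_rel_cochains[OF K h(1) x comm] Suc by (auto simp: rel_coboundaries_Suc)
qed

end

section \<open>Splitting the arguments of a cochain\<close>

text \<open>\<open>bracket_action\<close> contains no linearity of \<open>act\<close>, so the value
  of \<open>act\<close> at zero is a separate assumption.\<close>

lemma (in bracket_action) ce_diff_zero: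
  assumes act0: "\<And>x. x \<in> carrier L \<Longrightarrow> act x \<zero>\<^bsub>M\<^esub> = \<zero>\<^bsub>M\<^esub>"
    and f: "\<And>zs. zs \<in> tuples (carrier L) n \<Longrightarrow> f zs = \<zero>\<^bsub>M\<^esub>" and xs: "xs \<in> tuples (carrier L) (Suc n)"
  shows "ce_diff L M act n f xs = \<zero>\<^bsub>M\<^esub>"
proof -
  have "f (bracket L (xs ! i) (xs ! j) # nths xs (- {i, j})) = \<zero>\<^bsub>M\<^esub>" if "j \<le> n" "i < j" for i j
    using that xs by (intro f nths_tuples2[OF xs] L_bracket) auto
  moreover have "act (xs ! i) (f (nths xs (- {i}))) = \<zero>\<^bsub>M\<^esub>" if "i \<le> n" for i
    using that xs nths_tuples1[OF xs that] by (simp add: f act0)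
  ultimately have "(\<Oplus>\<^bsub>M\<^esub>i\<in>{..n}. alt_sign M i (act (xs ! i) (f (nths xs (- {i}))))) = \<zero>\<^bsub>M\<^esub>"
    "(\<Oplus>\<^bsub>M\<^esub>j\<in>{..n}. \<Oplus>\<^bsub>M\<^esub>i\<in>{..<j}.
       alt_sign M (i + j) (f (bracket L (xs ! i) (xs ! j) # nths xs (- {i, j})))) = \<zero>\<^bsub>M\<^esub>"
    by (auto intro!: M.finsum_const_zero)
  then show ?thesis using xs by (simp add: ce_diff_def)
qed

section \<open>Cochains of the algebra as cochains with values in functions on the ideal\<close>

locale ideal_pair = I: lie_ideal_module F g M act I
  for F :: "('a, 'c) ring_scheme" and g :: "('a, 'b, 'd) lie_scheme"
    and M :: "('a, 'm, 'e) module_scheme" and act :: "'b \<Rightarrow> 'm \<Rightarrow> 'm" and I :: "'b set"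

lemma (in lie_ideal_module) lie_ideal_carrier: "lie_ideal F L (carrier L)"
  using L.carrier_is_submodule by (auto simp: lie_ideal_def Lie.bracket_closed)

text \<open>The prefix \<open>I.\<close> marks facts about cochains on the ideal, the prefix
  \<open>G.\<close> the same facts for the whole algebra, viewed as an ideal of itself.\<close>

sublocale ideal_pair \<subseteq> G: lie_ideal_module F g M act "carrier g"
  rewrites "g\<lparr>carrier := carrier g\<rparr> = g"
  by (auto intro!: lie_ideal_module.intro I.lie_module I.lie_ideal_carrier)

context ideal_pair
begin

abbreviation "\<C> n \<equiv> alternating_maps F g M n"
abbreviation "\<Delta> n \<equiv> ce_diff g M act n"

text \<open>This is f_xs of the overview, for f of degree \<open>length xs + b\<close>. It is
  restricted to tuples of length b so that it is an element of the function module.\<close>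

definition part :: "'b list \<Rightarrow> nat \<Rightarrow> ('b list \<Rightarrow> 'm) \<Rightarrow> 'b list \<Rightarrow> 'm" where
  "part xs b f = (\<lambda>ys\<in>tuples I b. f (xs @ ys))"

text \<open>The map s_p before passage to cosets: f becomes a cochain of degree a on
  \<open>g\<close> whose values are functions on tuples from \<open>I\<close>. Any splitting a + b
  of the degree is allowed, not only the one given by the filtration.\<close>

definition lift :: "nat \<Rightarrow> nat \<Rightarrow> ('b list \<Rightarrow> 'm) \<Rightarrow> 'b list \<Rightarrow> 'b list \<Rightarrow> 'm" where
  "lift a b f = (\<lambda>xs\<in>tuples (carrier g) a. part xs b f)"

lemma I_tuples: "ys \<in> tuples I n \<Longrightarrow> ys \<in> tuples (carrier g) n"
  by (erule tuples_mono) (auto intro: I.D_carrier)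

lemma part_apply: "ys \<in> tuples I b \<Longrightarrow> part xs b f ys = f (xs @ ys)"
  by (simp add: part_def)

lemma part_fun:
  assumes "f \<in> carrier (G.\<F> (a + b))" "xs \<in> tuples (carrier g) a"
  shows "part xs b f \<in> carrier (I.\<F> b)"
proof -
  have "f (xs @ ys) \<in> carrier M" if "ys \<in> tuples I b" for ys
    using assms that I_tuples by (intro I.Mm.fun_module_closed[OF assms(1)]) simp
  then show ?thesis unfolding I.Mm.fun_module_carrier by (simp add: part_def)
qed

context
  fixes f a b
  assumes f: "f \<in> \<C> (a + b)"
begin

lemma part_add:
  assumes "xs \<in> tuples (carrier g) a" "i < a" "x \<in> carrier g" "y \<in> carrier g"
  shows "part (xs[i := x \<oplus>\<^bsub>g\<^esub> y]) b f = part (xs[i := x]) b f \<oplus>\<^bsub>I.\<F> b\<^esub> part (xs[i := y]) b f"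
  using assms append_tuples[OF assms(1) I_tuples] G.B.alternating_add[OF f]
  by (intro ext) (simp add: part_def fun_module_def length_tuples flip: list_update_append1)

lemma part_smult:
  assumes "xs \<in> tuples (carrier g) a" "i < a" "x \<in> carrier g" "c \<in> carrier F"
  shows "part (xs[i := c \<odot>\<^bsub>g\<^esub> x]) b f = c \<odot>\<^bsub>I.\<F> b\<^esub> part (xs[i := x]) b f"
  using assms append_tuples[OF assms(1) I_tuples] G.B.alternating_smult[OF f]
  by (intro ext) (simp add: part_def fun_module_def length_tuples flip: list_update_append1)

lemma part_eq_zero:
  assumes "xs \<in> tuples (carrier g) a" "i < j" "j < a" "xs ! i = xs ! j"
  shows "part xs b f = \<zero>\<^bsub>I.\<F> b\<^esub>"
proof (rule ext)
  fix ys
  show "part xs b f ys = \<zero>\<^bsub>I.\<F> b\<^esub> ys"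
    using assms append_tuples[OF assms(1) I_tuples] G.B.alternating_eq[OF f, of "xs @ ys" i j]
    by (simp add: part_def fun_module_def zero_cochain_def nth_append length_tuples)
qed

lemma lift_alternating: "lift a b f \<in> alternating_maps F g (I.\<F> b) a"
proof -
  have "lift a b f \<in> tuples (carrier g) a \<rightarrow>\<^sub>E carrier (I.\<F> b)"
    using part_fun[OF G.alternating_fun[OF f]] by (auto simp: lift_def)
  with part_add part_smult part_eq_zero show ?thesis
    unfolding alternating_maps_def lift_def
    by (simp del: PiE_iff) blast
qed

end

lemma W_bracket_action: "bracket_action F g (I.\<F> b) (I.\<theta> b)"
proof -
  interpret W: module F "I.\<F> b" by (rule I.Mm.fun_module_module)
  show ?thesis
    by unfold_locales (auto intro: I.Lie.bracket_closed I.\<theta>_fun)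
qed

lemma insertion_lift:
  assumes "x \<in> carrier g"
  shows "insertion (carrier g) a x (lift (Suc a) b f) = lift a b (G.\<iota> (a + b) x f)"
  using assms I_tuples by (auto simp: insertion_def lift_def part_def fun_eq_iff)

lemma \<delta>_part_Nil:
  assumes "f \<in> carrier (G.\<F> n)" "ys \<in> tuples I (Suc n)"
  shows "I.\<delta> n (part [] n f) ys = \<Delta> n f ys"
proof -
  have p: "part [] n f \<in> carrier (I.\<F> n)" using assms(1) by (intro part_fun[of f 0]) simp_all
  \<comment> \<open>The differential of the ideal reads f only at tuples from \<open>I\<close>,
    where f agrees with its restriction; the factor one brings this into the form of
    \<open>\<delta>_smult\<close>.\<close>
  have "I.\<delta> n f ys = \<one>\<^bsub>F\<^esub> \<odot>\<^bsub>M\<^esub> I.\<delta> n (part [] n f) ys"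
    using I.Mm.fun_module_closed[OF assms(1) I_tuples]
    by (intro I.\<delta>_smult p assms(2) I.Mm.R.one_closed) (simp add: part_apply)
  then show ?thesis
    using assms(2) I_tuples[OF assms(2)] I.Mm.fun_module_closed[OF I.\<delta>_fun[OF p] assms(2)]
    by (simp add: ce_diff_def)
qed

text \<open>Of the a + b bracket terms of \<theta>_x f at xs @ ys, the first a belong to the Lie
  derivative of the lifted cochain and the last b to the action of x on its values.\<close>

lemma lie_deriv_lift:
  assumes f: "f \<in> carrier (G.\<F> (a + b))" and x: "x \<in> carrier g"
    and xs: "xs \<in> tuples (carrier g) a" and ys: "ys \<in> tuples I b"
  shows "lie_deriv g (I.\<F> b) (I.\<theta> b) (carrier g) a x (lift a b f) xs ys = G.\<theta> (a + b) x f (xs @ ys)"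
proof -
  interpret W: module F "I.\<F> b" by (rule I.Mm.fun_module_module)
  let ?u = "\<lambda>j. f ((xs @ ys)[j := bracket g x ((xs @ ys) ! j)])"
  have ap: "zs @ ws \<in> tuples (carrier g) (a + b)" if "zs \<in> tuples (carrier g) a" "ws \<in> tuples I b" for zs ws
    using that I_tuples by simp
  note cl = I.Mm.fun_module_closed[OF f]
  have upx: "xs[j := bracket g x (xs ! j)] \<in> tuples (carrier g) a" if "j < a" for j
    using that x xs by (simp add: I.Lie.bracket_closed)
  have upy: "ys[j := bracket g x (ys ! j)] \<in> tuples I b" if "j < b" for j
    using that x ys by simp
  have ux: "?u j = f (xs[j := bracket g x (xs ! j)] @ ys)" if "j < a" for j
    using that xs by (simp add: list_update_append nth_append length_tuples)
  have uy: "?u (a + j) = f (xs @ ys[j := bracket g x (ys ! j)])" if "j < b" for j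
    using that xs by (simp add: list_update_append nth_append length_tuples)
  have ucl: "?u \<in> {..<a + b} \<rightarrow> carrier M"
    using ap[OF xs ys] x by (auto intro!: cl update_tuples I.Lie.bracket_closed)
  have pcl: "part zs b f \<in> carrier (I.\<F> b)" if "zs \<in> tuples (carrier g) a" for zs
    using part_fun[OF f that] .
  have "(\<Oplus>\<^bsub>I.\<F> b\<^esub>j\<in>{..<a}. lift a b f (xs[j := bracket g x (xs ! j)])) ys
      = (\<Oplus>\<^bsub>M\<^esub>j\<in>{..<a}. lift a b f (xs[j := bracket g x (xs ! j)]) ys)"
    using ys pcl upx by (intro I.Mm.fun_module_finsum) (auto simp: lift_def)
  also have "\<dots> = (\<Oplus>\<^bsub>M\<^esub>j\<in>{..<a}. ?u j)"
    using ucl ys upx ux by (intro I.M.finsum_cong') (auto simp: lift_def part_def)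
  finally have Sx: "(\<Oplus>\<^bsub>I.\<F> b\<^esub>j\<in>{..<a}. lift a b f (xs[j := bracket g x (xs ! j)])) ys = (\<Oplus>\<^bsub>M\<^esub>j\<in>{..<a}. ?u j)" .
  have Sy: "(\<Oplus>\<^bsub>M\<^esub>j\<in>{..<b}. part xs b f (ys[j := bracket g x (ys ! j)])) = (\<Oplus>\<^bsub>M\<^esub>j\<in>{..<b}. ?u (a + j))"
    using ucl ys upy uy by (intro I.M.finsum_cong') (auto simp: part_def)
  have "lie_deriv g (I.\<F> b) (I.\<theta> b) (carrier g) a x (lift a b f) xs ys
      = (I.\<theta> b x (part xs b f) \<ominus>\<^bsub>I.\<F> b\<^esub> (\<Oplus>\<^bsub>I.\<F> b\<^esub>j\<in>{..<a}. lift a b f (xs[j := bracket g x (xs ! j)]))) ys"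
    using xs by (simp add: lie_deriv_def lift_def)
  also have "\<dots> = I.\<theta> b x (part xs b f) ys \<ominus>\<^bsub>M\<^esub> (\<Oplus>\<^bsub>M\<^esub>j\<in>{..<a}. ?u j)"
    unfolding Sx[symmetric] using xs ys x pcl upx
    by (intro I.Mm.fun_module_minus I.\<theta>_fun W.finsum_closed) (auto simp: lift_def)
  also have "I.\<theta> b x (part xs b f) ys = act x (f (xs @ ys)) \<ominus>\<^bsub>M\<^esub> (\<Oplus>\<^bsub>M\<^esub>j\<in>{..<b}. ?u (a + j))"
    using ys Sy by (simp add: lie_deriv_def part_apply)
  also have "\<dots> \<ominus>\<^bsub>M\<^esub> (\<Oplus>\<^bsub>M\<^esub>j\<in>{..<a}. ?u j) = G.\<theta> (a + b) x f (xs @ ys)"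
  proof -
    have "(\<Oplus>\<^bsub>M\<^esub>j\<in>{..<a}. ?u j) \<in> carrier M" "(\<Oplus>\<^bsub>M\<^esub>j\<in>{..<b}. ?u (a + j)) \<in> carrier M"
      using ucl by (auto intro!: I.M.finsum_closed)
    then show ?thesis
      using I.M.finsum_lessThan_add[OF ucl] ap[OF xs ys] x cl[OF ap[OF xs ys]]
      by (simp add: lie_deriv_def I.M.minus_simps I.act_closed)
  qed
  finally show ?thesis .
qed

text \<open>Both sides obey Cartan's recursion in the head x of xs: the \<theta>-terms agree by
  \<open>lie_deriv_lift\<close>, and the subtracted differential is the hypothesis for i_x f, which
  flips the sign of the last term. At a = 0 that term is Cartan's d i_x f, restricted to the ideal;
  for b = 0 there is no lower degree and the term is absent.\<close>

lemma ce_diff_split: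
  assumes "f \<in> \<C> (a + b)" "xs \<in> tuples (carrier g) (Suc a)" "ys \<in> tuples I b"
  shows "\<Delta> (a + b) f (xs @ ys)
    = ce_diff g (I.\<F> b) (I.\<theta> b) a (lift a b f) xs ys
      \<oplus>\<^bsub>M\<^esub> (case b of 0 \<Rightarrow> \<zero>\<^bsub>M\<^esub> | Suc c \<Rightarrow> alt_sign M (Suc a) (I.\<delta> c (part xs c f) ys))"
  using assms
proof (induction a arbitrary: f xs)
  case 0
  interpret W: bracket_action F g "I.\<F> b" "I.\<theta> b" by (rule W_bracket_action)
  from 0 obtain x where x: "xs = [x]" "x \<in> carrier g" by (elim tuples_SucE) (auto simp: tuples_0)
  note f = 0(1)[simplified]
  note ff = G.alternating_fun[OF f]
  have lift: "lift 0 b f \<in> alternating_maps F g (I.\<F> b) 0" using f by (intro lift_alternating) simp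
  have W: "ce_diff g (I.\<F> b) (I.\<theta> b) 0 (lift 0 b f) xs ys = G.\<theta> b x f ys"
    using lie_deriv_lift[of f 0 b x "[]" ys] x ff 0(3) by (simp add: W.cartan_0[OF lift])
  have \<theta>cl: "G.\<theta> b x f ys \<in> carrier M"
    using x ff 0(3) by (auto intro!: I.Mm.fun_module_closed[of _ "carrier g" b] G.\<theta>_fun I_tuples)
  show ?case
  proof (cases b)
    case 0
    then show ?thesis using W x \<theta>cl G.cartan_0[of f x ys] f \<open>ys \<in> tuples I b\<close> I_tuples by simp
  next
    case (Suc c)
    have "part [] c (G.\<iota> c x f) = part [x] c f"
      using x I_tuples by (auto simp: part_def insertion_def fun_eq_iff)
    then have "I.\<delta> c (part xs c f) ys = \<Delta> c (G.\<iota> c x f) ys"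
      using \<delta>_part_Nil[of "G.\<iota> c x f" c ys] G.\<iota>_fun[of f c x] ff x \<open>ys \<in> tuples I b\<close> Suc by simp
    moreover have "\<Delta> c (G.\<iota> c x f) ys \<in> carrier M"
      using x ff \<open>ys \<in> tuples I b\<close> Suc
      by (auto intro!: I.Mm.fun_module_closed[of _ "carrier g" b] G.\<delta>_fun G.\<iota>_fun I_tuples)
    ultimately show ?thesis
      using W x \<theta>cl G.cartan[of f c x ys] f \<open>ys \<in> tuples I b\<close> Suc I_tuples
      by (simp add: I.M.alt_sign_Suc a_minus_def)
  qed
next
  case (Suc a)
  interpret W: bracket_action F g "I.\<F> b" "I.\<theta> b" by (rule W_bracket_action)
  from Suc.prems(2) obtain x zs where xs: "xs = x # zs" "x \<in> carrier g" "zs \<in> tuples (carrier g) (Suc a)"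
    by (rule tuples_SucE)
  note f = Suc.prems(1)[simplified] and ys = Suc.prems(3)
  note ff = G.alternating_fun[OF f]
  let ?h = "G.\<iota> (a + b) x f"
  have h: "?h \<in> \<C> (a + b)" by (rule G.\<iota>_alternating[OF f xs(2)])
  have lift: "lift (Suc a) b f \<in> alternating_maps F g (I.\<F> b) (Suc a)" using f by (intro lift_alternating) simp
  have zys: "zs @ ys \<in> tuples (carrier g) (Suc (a + b))"
    using append_tuples[OF xs(3) I_tuples[OF ys]] by simp
  let ?T = "case b of 0 \<Rightarrow> \<zero>\<^bsub>M\<^esub> | Suc c \<Rightarrow> alt_sign M (Suc a) (I.\<delta> c (part zs c ?h) ys)"
  let ?D = "ce_diff g (I.\<F> b) (I.\<theta> b) a (lift a b ?h) zs"
  have Dcl: "?D \<in> carrier (I.\<F> b)"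
    using lift_alternating[OF h] xs by (intro W.ce_diff_closed) (auto simp: alternating_maps_def)
  have Tcl: "?T \<in> carrier M"
  proof (cases b)
    case (Suc c)
    have "part zs c ?h \<in> carrier (I.\<F> c)"
      using G.alternating_fun[OF h] xs Suc by (intro part_fun[of _ "Suc a"]) auto
    then show ?thesis using Suc ys by (auto intro!: I.M.alt_sign_closed I.Mm.fun_module_closed[OF I.\<delta>_fun])
  qed simp
  have \<theta>cl: "G.\<theta> (Suc (a + b)) x f (zs @ ys) \<in> carrier M"
    using xs ff zys by (auto intro!: I.Mm.fun_module_closed[of _ "carrier g" "Suc (a + b)"] G.\<theta>_fun)
  have \<theta>W: "lie_deriv g (I.\<F> b) (I.\<theta> b) (carrier g) (Suc a) x (lift (Suc a) b f) zs \<in> carrier (I.\<F> b)"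
  proof -
    have up: "zs[j := bracket g x (zs ! j)] \<in> tuples (carrier g) (Suc a)" if "j < Suc a" for j
      using that xs by (simp add: I.Lie.bracket_closed)
    show ?thesis
      using xs up W.alternating_closed[OF lift]
      by (subst lie_deriv_def) (auto intro!: W.M.minus_closed W.M.finsum_closed I.\<theta>_fun)
  qed
  have "ce_diff g (I.\<F> b) (I.\<theta> b) (Suc a) (lift (Suc a) b f) xs
     = lie_deriv g (I.\<F> b) (I.\<theta> b) (carrier g) (Suc a) x (lift (Suc a) b f) zs \<ominus>\<^bsub>I.\<F> b\<^esub> ?D"
    unfolding xs(1) using W.cartan[OF lift xs(2,3)] xs(2) by (simp add: insertion_lift)
  then have 1: "ce_diff g (I.\<F> b) (I.\<theta> b) (Suc a) (lift (Suc a) b f) xs ys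
     = G.\<theta> (Suc (a + b)) x f (zs @ ys) \<ominus>\<^bsub>M\<^esub> ?D ys"
    using lie_deriv_lift[of f "Suc a" b x zs ys] ff xs ys
    by (simp add: I.Mm.fun_module_minus[OF \<theta>W Dcl])
  have 2: "(case b of 0 \<Rightarrow> \<zero>\<^bsub>M\<^esub> | Suc c \<Rightarrow> alt_sign M (Suc (Suc a)) (I.\<delta> c (part xs c f) ys)) = \<ominus>\<^bsub>M\<^esub> ?T"
  proof (cases b)
    case (Suc c)
    have "part zs c ?h = part xs c f"
      using xs I_tuples append_tuples[OF xs(3)] Suc by (auto simp: part_def insertion_def fun_eq_iff)
    moreover have "part xs c f \<in> carrier (I.\<F> c)"
      using ff xs Suc by (intro part_fun[of _ "Suc (Suc a)"]) auto
    ultimately show ?thesis using Suc ys by (simp add: I.M.alt_sign_Suc I.Mm.fun_module_closed[OF I.\<delta>_fun])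
  qed simp
  have "\<Delta> (Suc a + b) f (xs @ ys)
      = G.\<theta> (Suc (a + b)) x f (zs @ ys) \<ominus>\<^bsub>M\<^esub> \<Delta> (a + b) ?h (zs @ ys)"
    using G.cartan[OF f xs(2) zys] xs by simp
  also have "\<Delta> (a + b) ?h (zs @ ys) = ?D ys \<oplus>\<^bsub>M\<^esub> ?T" by (rule Suc.IH[OF h xs(3) ys])
  finally show ?case
    unfolding 1 2 using \<theta>cl Tcl I.Mm.fun_module_closed[OF Dcl ys]
    by (simp add: a_minus_def I.M.minus_add I.M.a_ac)
qed

end

section \<open>Subquotients and the quotient Lie algebra\<close>

text \<open>The situation S / U with U inside S inside an ambient module. The quotient restricts the
  carrier to S, but a coset depends only on addition, so classes are written as ambient cosets; see
  \<open>coset_restrict\<close>.\<close>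

locale subquotient = module R M for R (structure) and M (structure) +
  fixes S U
  assumes S: "submodule S R M" and U: "submodule U R M" and U_subset: "U \<subseteq> S"
begin

abbreviation "Q \<equiv> quotient_module (M\<lparr>carrier := S\<rparr>) U"

lemma S_carrier: "x \<in> S \<Longrightarrow> x \<in> carrier M"
  using submoduleE(1)[OF S] by auto

lemma S_module: "module R (M\<lparr>carrier := S\<rparr>)"
  by (rule submodule.submodule_is_module[OF S module_axioms])

lemma S_U: "submodule U R (M\<lparr>carrier := S\<rparr>)"
proof -
  interpret S: module R "M\<lparr>carrier := S\<rparr>" by (rule S_module)
  show ?thesis
    using U_subset submodule_zero_mem[OF U] submoduleE(4,5)[OF U] by (intro S.submodule_smultI) auto
qed

lemma coset_restrict: "U +>\<^bsub>M\<lparr>carrier := S\<rparr>\<^esub> x = U +>\<^bsub>M\<^esub> x"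
  by (simp add: a_r_coset_def')

lemma S_closed:
  "x \<in> S \<Longrightarrow> y \<in> S \<Longrightarrow> x \<oplus>\<^bsub>M\<^esub> y \<in> S"
  "x \<in> S \<Longrightarrow> \<ominus>\<^bsub>M\<^esub> x \<in> S"
  "x \<in> S \<Longrightarrow> alt_sign M i x \<in> S"
  "x \<in> S \<Longrightarrow> y \<in> S \<Longrightarrow> x \<ominus>\<^bsub>M\<^esub> y \<in> S"
  using submoduleE(3,5)[OF S] by (auto simp: alt_sign_def a_minus_def)

lemma S_finsum_closed: "finite A \<Longrightarrow> u \<in> A \<rightarrow> S \<Longrightarrow> finsum M u A \<in> S"
proof -
  interpret S: module R "M\<lparr>carrier := S\<rparr>" by (rule S_module)
  show "finite A \<Longrightarrow> u \<in> A \<rightarrow> S \<Longrightarrow> finsum M u A \<in> S"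
    using submodule_finsum[OF S, of A u] S.finsum_closed[of u A] by simp
qed

lemma Q_group: "abelian_group Q"
  by (rule module.quotient_module_group[OF S_module S_U])

lemma Q_carrier: "carrier Q = (\<lambda>x. U +>\<^bsub>M\<^esub> x) ` S"
  by (simp add: module.quotient_module_simps[OF S_module] coset_restrict)

lemma Q_zero: "\<zero>\<^bsub>Q\<^esub> = U"
  by (simp add: module.quotient_module_simps[OF S_module])

lemma Q_add: "x \<in> S \<Longrightarrow> y \<in> S \<Longrightarrow> (U +>\<^bsub>M\<^esub> x) \<oplus>\<^bsub>Q\<^esub> (U +>\<^bsub>M\<^esub> y) = U +>\<^bsub>M\<^esub> (x \<oplus>\<^bsub>M\<^esub> y)"
  using module.quotient_module_add[OF S_module S_U, of x y] by (simp add: coset_restrict)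

lemma Q_smult: "a \<in> carrier R \<Longrightarrow> x \<in> S \<Longrightarrow> a \<odot>\<^bsub>Q\<^esub> (U +>\<^bsub>M\<^esub> x) = U +>\<^bsub>M\<^esub> (a \<odot>\<^bsub>M\<^esub> x)"
  using module.quotient_module_smult[OF S_module S_U, of a x] by (simp add: coset_restrict)

lemma Q_a_inv: "x \<in> S \<Longrightarrow> \<ominus>\<^bsub>Q\<^esub> (U +>\<^bsub>M\<^esub> x) = U +>\<^bsub>M\<^esub> (\<ominus>\<^bsub>M\<^esub> x)"
  using module.quotient_module_a_inv[OF S_module S_U, of x]
  by (simp add: coset_restrict submodule_a_inv[OF S])

lemma Q_minus: "x \<in> S \<Longrightarrow> y \<in> S \<Longrightarrow> (U +>\<^bsub>M\<^esub> x) \<ominus>\<^bsub>Q\<^esub> (U +>\<^bsub>M\<^esub> y) = U +>\<^bsub>M\<^esub> (x \<ominus>\<^bsub>M\<^esub> y)"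
  by (simp add: a_minus_def Q_a_inv Q_add S_closed)

lemma Q_alt_sign: "x \<in> S \<Longrightarrow> alt_sign Q i (U +>\<^bsub>M\<^esub> x) = U +>\<^bsub>M\<^esub> (alt_sign M i x)"
  by (simp add: alt_sign_def Q_a_inv)

lemma Q_finsum:
  "finite A \<Longrightarrow> u \<in> A \<rightarrow> S \<Longrightarrow> (\<Oplus>\<^bsub>Q\<^esub>i\<in>A. U +>\<^bsub>M\<^esub> u i) = U +>\<^bsub>M\<^esub> (finsum M u A)"
  using module.quotient_module_finsum[OF S_module S_U, of A u]
  by (simp add: coset_restrict submodule_finsum[OF S])

lemma coset_U: "u \<in> U \<Longrightarrow> U +>\<^bsub>M\<^esub> u = U"
  by (rule coset_zero[OF U])

end

lemma set_addI: "u \<in> U \<Longrightarrow> v \<in> V \<Longrightarrow> u \<oplus>\<^bsub>G\<^esub> v \<in> U <+>\<^bsub>G\<^esub> V"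
  by (auto simp: set_add_def')

lemma (in module) submodule_set_add:
  assumes U: "submodule U R M" and V: "submodule V R M"
  shows "submodule (U <+>\<^bsub>M\<^esub> V) R M"
proof -
  have sub: "x \<in> carrier M" if "x \<in> U \<or> x \<in> V" for x
    using that submoduleE(1)[OF U] submoduleE(1)[OF V] by auto
  show ?thesis
  proof (rule submodule_lincombI)
    show "U <+>\<^bsub>M\<^esub> V \<subseteq> carrier M" using sub by (auto simp: set_add_def')
    show "\<zero>\<^bsub>M\<^esub> \<in> U <+>\<^bsub>M\<^esub> V"
      using set_addI[OF submodule_zero_mem[OF U] submodule_zero_mem[OF V], of M] by simp
  next
    fix a b x y assume ab: "a \<in> carrier R" "b \<in> carrier R" and "x \<in> U <+>\<^bsub>M\<^esub> V" "y \<in> U <+>\<^bsub>M\<^esub> V"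
    then obtain u v u' v' where uv: "u \<in> U" "v \<in> V" "u' \<in> U" "v' \<in> V" "x = u \<oplus>\<^bsub>M\<^esub> v" "y = u' \<oplus>\<^bsub>M\<^esub> v'"
      by (auto simp: set_add_def')
    then have "a \<odot>\<^bsub>M\<^esub> x \<oplus>\<^bsub>M\<^esub> b \<odot>\<^bsub>M\<^esub> y
        = (a \<odot>\<^bsub>M\<^esub> u \<oplus>\<^bsub>M\<^esub> b \<odot>\<^bsub>M\<^esub> u') \<oplus>\<^bsub>M\<^esub> (a \<odot>\<^bsub>M\<^esub> v \<oplus>\<^bsub>M\<^esub> b \<odot>\<^bsub>M\<^esub> v')"
      using sub ab by (simp add: smult_r_distr M.a_ac)
    then show "a \<odot>\<^bsub>M\<^esub> x \<oplus>\<^bsub>M\<^esub> b \<odot>\<^bsub>M\<^esub> y \<in> U <+>\<^bsub>M\<^esub> V"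
      using uv ab by (simp add: set_addI submoduleE(4,5)[OF U] submoduleE(4,5)[OF V])
  qed
qed

section \<open>The quotient Lie algebra and descent of filtered cochains to cosets\<close>

context ideal_pair
begin

abbreviation "cls x \<equiv> I +>\<^bsub>g\<^esub> x"
abbreviation "gI \<equiv> quotient_lie g I"

lemma gI_simps: "carrier gI = cls ` carrier g" "\<zero>\<^bsub>gI\<^esub> = I"
  by (auto simp: quotient_lie_def A_RCOSETS_def' a_r_coset_def')

lemma cls_add: "x \<in> carrier g \<Longrightarrow> y \<in> carrier g \<Longrightarrow> cls x \<oplus>\<^bsub>gI\<^esub> cls y = cls (x \<oplus>\<^bsub>g\<^esub> y)"
  using I.L.quotient_module_add[OF I.D_submodule, of x y]
  by (simp add: quotient_lie_def quotient_module_def)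

lemma cls_smult: "a \<in> carrier F \<Longrightarrow> x \<in> carrier g \<Longrightarrow> a \<odot>\<^bsub>gI\<^esub> cls x = cls (a \<odot>\<^bsub>g\<^esub> x)"
  using I.L.quotient_module_smult[OF I.D_submodule, of a x]
  by (simp add: quotient_lie_def quotient_module_def)

lemma cls_mem: "x \<in> carrier g \<Longrightarrow> x' \<in> cls x \<longleftrightarrow> (\<exists>i\<in>I. x' = i \<oplus>\<^bsub>g\<^esub> x)"
  by (rule I.L.coset_mem[OF I.D_submodule])

lemma cls_self: "x \<in> carrier g \<Longrightarrow> x \<in> cls x"
  by (rule I.L.coset_self[OF I.D_submodule])

lemma cls_memD: "x \<in> carrier g \<Longrightarrow> x' \<in> cls x \<Longrightarrow> x' \<in> carrier g \<and> cls x' = cls x"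
  using I.L.coset_eqI[OF I.D_submodule, of x x'] cls_mem[of x x'] by (auto simp: I.D_carrier)

lemma cls_eqD: "x \<in> carrier g \<Longrightarrow> x' \<in> carrier g \<Longrightarrow> cls x' = cls x \<Longrightarrow> \<exists>i\<in>I. x' = i \<oplus>\<^bsub>g\<^esub> x"
  using cls_self[of x'] cls_mem[of x x'] by auto

text \<open>Changing the representatives by i and j in \<open>I\<close> changes the bracket by
  [i, y'] + [x, j], which is again in \<open>I\<close>.\<close>

lemma cls_bracket:
  assumes x: "x \<in> carrier g" and y: "y \<in> carrier g"
  shows "bracket gI (cls x) (cls y) = cls (bracket g x y)"
proof -
  have "cls (bracket g x' y') = cls (bracket g x y)" if xy: "x' \<in> cls x" "y' \<in> cls y" for x' y'
  proof -
    obtain i j where ij: "i \<in> I" "j \<in> I" "x' = i \<oplus>\<^bsub>g\<^esub> x" "y' = j \<oplus>\<^bsub>g\<^esub> y"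
      using xy cls_mem[OF x] cls_mem[OF y] by blast
    have c: "i \<in> carrier g" "j \<in> carrier g" "y' \<in> carrier g"
      using ij y by (auto simp: I.D_carrier)
    have "bracket g x' y' = bracket g i y' \<oplus>\<^bsub>g\<^esub> bracket g x y'"
      unfolding ij(3) using c x by (simp add: I.Lie.bracket_add_left)
    also have "bracket g x y' = bracket g x j \<oplus>\<^bsub>g\<^esub> bracket g x y"
      unfolding ij(4) using c x y by (simp add: I.Lie.bracket_add_right)
    finally have "bracket g x' y' = bracket g i y' \<oplus>\<^bsub>g\<^esub> (bracket g x j \<oplus>\<^bsub>g\<^esub> bracket g x y)" .
    then show ?thesis using ij(1,2) x y c
      by (simp add: I.L.coset_add_left[OF I.D_submodule] I.D_bracket' I.Lie.bracket_closed)
  qed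
  then have "the_elem ((\<lambda>(x, y). cls (bracket g x y)) ` (cls x \<times> cls y)) = (\<lambda>(x, y). cls (bracket g x y)) (x, y)"
  proof (intro the_elem_image_unique)
    show "cls x \<times> cls y \<noteq> {}" using cls_self[OF x] cls_self[OF y] by blast
  qed (metis (no_types, lifting) SigmaE2 case_prod_conv surj_pair)
  then show ?thesis by (simp add: quotient_lie_def)
qed

lemma map_cls_tuples: "xs \<in> tuples (carrier g) n \<Longrightarrow> map cls xs \<in> tuples (carrier gI) n"
  by (auto simp: tuples_def gI_simps)

lemma listset_map_cls:
  "xs \<in> tuples (carrier g) n \<Longrightarrow>
    xs' \<in> listset (map cls xs) \<longleftrightarrow> xs' \<in> tuples (carrier g) n \<and> map cls xs' = map cls xs"
proof (induction n arbitrary: xs xs')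
  case (Suc n)
  then obtain y ys where xs: "xs = y # ys" "y \<in> carrier g" "ys \<in> tuples (carrier g) n" by (elim tuples_SucE)
  have "y' \<in> cls y \<longleftrightarrow> y' \<in> carrier g \<and> cls y' = cls y" for y'
    using cls_memD[OF xs(2)] cls_self by blast
  then show ?case using Suc.IH[OF xs(3)] xs
    by (cases xs') (auto simp: set_Cons_def)
qed (auto simp: tuples_0)

text \<open>The condition under which the image in the definition of \<open>s_map\<close> is a
  singleton, so that \<open>the_elem\<close> returns an actual value.\<close>

definition descends :: "nat \<Rightarrow> nat \<Rightarrow> ('b list \<Rightarrow> 'm) \<Rightarrow> bool" where
  "descends p b f \<longleftrightarrow> (\<forall>xs\<in>tuples (carrier g) p. \<forall>xs'\<in>tuples (carrier g) p.
     map cls xs = map cls xs' \<longrightarrow> part xs b f = part xs' b f)"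

lemma s_map_part:
  assumes "descends p q f" "xs \<in> tuples (carrier g) p"
  shows "s_map g I p q f (map cls xs) = part xs q f"
proof -
  have "the_elem ((\<lambda>xs. part xs q f) ` listset (map cls xs)) = part xs q f"
  proof (rule the_elem_image_unique)
    show "listset (map cls xs) \<noteq> {}" using listset_map_cls[OF assms(2), of xs] assms(2) by auto
    show "part xs' q f = part xs q f" if "xs' \<in> listset (map cls xs)" for xs'
      using that assms unfolding listset_map_cls[OF assms(2)] descends_def by blast
  qed
  then show ?thesis using map_cls_tuples[OF assms(2)] by (simp add: s_map_def part_def)
qed

text \<open>Two tuples of representatives are joined by hybrids that take the first m entries from
  xs' and the others from xs. Each step changes one entry by an element of \<open>I\<close>, whose
  contribution is zero by \<open>van\<close>.\<close>

lemma descendsI: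
  assumes f: "f \<in> \<C> (p + b)"
    and van: "\<And>xs ys i. xs \<in> tuples (carrier g) p \<Longrightarrow> ys \<in> tuples I b \<Longrightarrow> i < p \<Longrightarrow> xs ! i \<in> I
      \<Longrightarrow> f (xs @ ys) = \<zero>\<^bsub>M\<^esub>"
  shows "descends p b f"
  unfolding descends_def
proof (intro ballI impI)
  fix xs xs' assume xs: "xs \<in> tuples (carrier g) p" and xs': "xs' \<in> tuples (carrier g) p"
    and eq: "map cls xs = map cls xs'"
  have "part (take m xs' @ drop m xs) b f = part xs b f" if "m \<le> p" for m
    using that
  proof (induction m)
    case (Suc m)
    then have m: "m < p" by simp
    define z where "z = take m xs' @ drop m xs"
    have z_tup: "z \<in> tuples (carrier g) p"
      using xs xs' m by (auto simp: z_def tuples_def dest: in_set_takeD in_set_dropD)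
    have z': "take (Suc m) xs' @ drop (Suc m) xs = z[m := xs' ! m]"
      using xs xs' m by (intro nth_equalityI) (auto simp: z_def length_tuples nth_append nth_list_update less_Suc_eq)
    have zm: "z[m := xs ! m] = z" using xs xs' m by (simp add: z_def list_update_append length_tuples
          Cons_nth_drop_Suc[symmetric])
    have "cls (xs' ! m) = cls (xs ! m)" using eq m xs xs' by (metis length_tuples nth_map)
    then obtain i where i: "i \<in> I" "xs' ! m = i \<oplus>\<^bsub>g\<^esub> xs ! m"
      using cls_eqD[of "xs ! m" "xs' ! m"] m xs xs' by auto
    have "f (z[m := xs' ! m] @ ys) = f (z @ ys)" if ys: "ys \<in> tuples I b" for ys
    proof -
      have z_ys: "z @ ys \<in> tuples (carrier g) (p + b)" by (rule append_tuples[OF z_tup I_tuples[OF ys]])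
      have upd: "(z @ ys)[m := v] = z[m := v] @ ys" for v
        using z_tup m by (simp only: list_update_append length_tuples if_True)
      have "f ((z @ ys)[m := i \<oplus>\<^bsub>g\<^esub> xs ! m]) = f ((z @ ys)[m := i]) \<oplus>\<^bsub>M\<^esub> f ((z @ ys)[m := xs ! m])"
        using m i xs z_ys by (intro G.B.alternating_add[OF f]) (auto simp: I.D_carrier)
      moreover have "z[m := i] ! m = i" using m length_tuples[OF z_tup] by (simp only: nth_list_update_eq)
      then have "f (z[m := i] @ ys) = \<zero>\<^bsub>M\<^esub>"
        using m i by (intro van[OF update_tuples[OF z_tup] ys m]) (simp_all add: I.D_carrier)
      ultimately show ?thesis
        using G.B.alternating_closed[OF f z_ys] by (simp add: upd i(2) zm)
    qed
    then have "part (z[m := xs' ! m]) b f = part z b f" by (auto simp: part_def fun_eq_iff)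
    then show ?case using Suc z' by (simp add: z_def)
  qed simp
  from this[of p] show "part xs b f = part xs' b f" using xs xs' by (simp add: length_tuples)
qed

text \<open>Any set of positions with entries in \<open>I\<close> bounds their number from below,
  which spares computing the exact count.\<close>

lemma filtration_vanish:
  assumes "f \<in> filtration F g I k M act p n" "zs \<in> tuples (carrier g) n"
    and "S \<subseteq> {i. i < n \<and> zs ! i \<in> I}" "n + 1 \<le> p + card S"
  shows "f zs = \<zero>\<^bsub>M\<^esub>"
proof -
  have "card S \<le> card {i. i < n \<and> zs ! i \<in> I}" using assms(3) by (intro card_mono) auto
  then have "n + 1 \<le> p + card {i. i < n \<and> zs ! i \<in> I}" using assms(4) by linarith
  then show ?thesis using assms(1,2) by (auto simp: filtration_def)
qed

text \<open>The b trailing entries alone reach the bound n + 1 \<le> p + b as soon as a < p.\<close>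

lemma filtration_vanish_append:
  assumes f: "f \<in> filtration F g I k M act p n" and n: "n = a + b" "a + 1 \<le> p"
    and xs: "xs \<in> tuples (carrier g) a" and ys: "ys \<in> tuples I b"
  shows "f (xs @ ys) = \<zero>\<^bsub>M\<^esub>"
proof (rule filtration_vanish[OF f])
  show "xs @ ys \<in> tuples (carrier g) n" using xs ys I_tuples n by simp
  show "{a..<a + b} \<subseteq> {i. i < n \<and> (xs @ ys) ! i \<in> I}"
    using xs ys n by (auto simp: nth_append length_tuples)
qed (use n in simp)

text \<open>Together with the b trailing entries, one further entry in \<open>I\<close> makes n - p
  + 1 of them.\<close>

lemma filtration_descends:
  assumes f: "f \<in> filtration F g I k M act p n" and n: "n = p + b"
  shows "descends p b f"
proof (rule descendsI)
  show "f \<in> \<C> (p + b)" using f n by (simp add: filtration_def rel_cochains_def)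
  fix xs ys i assume xs: "xs \<in> tuples (carrier g) p" and ys: "ys \<in> tuples I b" and i: "i < p" "xs ! i \<in> I"
  show "f (xs @ ys) = \<zero>\<^bsub>M\<^esub>"
  proof (rule filtration_vanish[OF f])
    show "xs @ ys \<in> tuples (carrier g) n" using xs ys I_tuples n by simp
    show "insert i {p..<p + b} \<subseteq> {i. i < n \<and> (xs @ ys) ! i \<in> I}"
      using xs ys n i by (auto simp: nth_append length_tuples)
  qed (use n i in simp)
qed

text \<open>For p = a + 1 the d_W-term of \<open>ce_diff_split\<close> vanishes: with only a entries
  in front, b + 1 = n - p + 1 arguments lie in \<open>I\<close>, so the lifted cochain is zero. For
  p = 0 the claim is restriction to the ideal.\<close>

lemma filtration_diff_part:
  assumes f: "f \<in> filtration F g I k M act p n" and n: "n = p + b"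
    and xs: "xs \<in> tuples (carrier g) p" and ys: "ys \<in> tuples I (Suc b)"
  shows "\<Delta> n f (xs @ ys) = alt_sign M p (I.\<delta> b (part xs b f) ys)"
proof -
  have alt: "f \<in> \<C> (p + b)" using f n by (simp add: filtration_def rel_cochains_def)
  show ?thesis
  proof (cases p)
    case 0
    then show ?thesis using n xs ys \<delta>_part_Nil[of f n ys] G.alternating_fun[of f n] alt
      by (simp add: tuples_0)
  next
    case (Suc a)
    interpret W: bracket_action F g "I.\<F> (Suc b)" "I.\<theta> (Suc b)" by (rule W_bracket_action)
    have W0: "\<zero>\<^bsub>I.\<F> (Suc b)\<^esub> \<in> carrier (I.\<F> (Suc b))" by simp
    have "I.\<theta> (Suc b) x \<zero>\<^bsub>I.\<F> (Suc b)\<^esub> = \<zero>\<^bsub>I.\<F> (Suc b)\<^esub>" if "x \<in> carrier g" for x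
      using that by (intro I.Mm.fun_module_ext[of _ I "Suc b"] I.\<theta>_fun W0)
        (simp_all add: I.Mm.fun_module_apply I.\<theta>_zero)
    moreover have "lift a (Suc b) f zs = \<zero>\<^bsub>I.\<F> (Suc b)\<^esub>" if zs: "zs \<in> tuples (carrier g) a" for zs
      using zs filtration_vanish_append[OF f, of a "Suc b" zs] n Suc
      by (auto simp: lift_def part_def fun_module_def zero_cochain_def fun_eq_iff)
    ultimately have "ce_diff g (I.\<F> (Suc b)) (I.\<theta> (Suc b)) a (lift a (Suc b) f) xs = \<zero>\<^bsub>I.\<F> (Suc b)\<^esub>"
      using xs Suc by (intro W.ce_diff_zero) auto
    moreover have "alt_sign M p (I.\<delta> b (part xs b f) ys) \<in> carrier M"
      using part_fun[OF G.alternating_fun[OF alt] xs] ys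
      by (intro I.M.alt_sign_closed I.Mm.fun_module_closed[OF I.\<delta>_fun])
    ultimately show ?thesis
      using ce_diff_split[of f a "Suc b" xs ys] alt xs ys n Suc by (simp add: I.Mm.fun_module_apply)
  qed
qed

end

section \<open>Consequences of an adapted decomposition\<close>

context ideal_pair
begin

text \<open>Peeling the entries of xs off one by one makes f_xs the restriction of an iterated
  insertion.\<close>

lemma part_alternating:
  assumes "f \<in> \<C> (r + b)" "xs \<in> tuples (carrier g) r"
  shows "part xs b f \<in> I.\<A> b"
  using assms
proof (induction r arbitrary: f xs)
  case 0
  then have f: "f \<in> \<C> b" and xs: "xs = []" by (auto simp: tuples_0)
  have I: "x \<in> I \<Longrightarrow> x \<in> carrier g" for x by (rule I.D_carrier)
  show ?case
    using f I_tuples I unfolding xs alternating_maps_def part_def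
    by (auto simp: PiE_iff extensional_def)
next
  case (Suc r)
  from Suc.prems(2) obtain x zs where xs: "xs = x # zs" "x \<in> carrier g" "zs \<in> tuples (carrier g) r"
    by (rule tuples_SucE)
  have "part xs b f = part zs b (G.\<iota> (r + b) x f)"
    using xs append_tuples[OF xs(3) I_tuples] by (auto simp: part_def insertion_def fun_eq_iff)
  then show ?case using Suc.IH[OF G.\<iota>_alternating] Suc.prems(1) xs by simp
qed

lemma part_zeroI: "(\<And>ys. ys \<in> tuples I b \<Longrightarrow> f (xs @ ys) = \<zero>\<^bsub>M\<^esub>) \<Longrightarrow> part xs b f = \<zero>\<^bsub>I.\<F> b\<^esub>"
  by (auto simp: part_def fun_module_def zero_cochain_def)

text \<open>Rearranged, this measures how far (\<theta>_x f)_xs is from \<theta>_x (f_xs): by the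
  terms in which x acts on an entry of xs.\<close>

lemma \<theta>_part:
  assumes f: "f \<in> \<C> (r + b)" and x: "x \<in> carrier g" and xs: "xs \<in> tuples (carrier g) r"
  shows "(I.\<theta> b x (part xs b f) \<ominus>\<^bsub>I.\<F> b\<^esub>
      (\<Oplus>\<^bsub>I.\<F> b\<^esub>j\<in>{..<r}. part (xs[j := bracket g x (xs ! j)]) b f))
    = (\<lambda>ys\<in>tuples I b. G.\<theta> (r + b) x f (xs @ ys))" (is "?l = ?r")
proof -
  interpret W: module F "I.\<F> b" by (rule I.Mm.fun_module_module)
  have up: "xs[j := bracket g x (xs ! j)] \<in> tuples (carrier g) r" if "j < r" for j
    using that x xs by (simp add: I.Lie.bracket_closed)
  note pcl = part_fun[OF G.alternating_fun[OF f]]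
  have sum: "(\<Oplus>\<^bsub>I.\<F> b\<^esub>j\<in>{..<r}. lift r b f (xs[j := bracket g x (xs ! j)]))
      = (\<Oplus>\<^bsub>I.\<F> b\<^esub>j\<in>{..<r}. part (xs[j := bracket g x (xs ! j)]) b f)"
    using up pcl by (intro W.finsum_cong') (auto simp: lift_def)
  have eq: "lie_deriv g (I.\<F> b) (I.\<theta> b) (carrier g) r x (lift r b f) xs = ?l"
    unfolding sum[symmetric] using xs by (subst lie_deriv_def) (simp add: lift_def)
  show ?thesis
  proof (rule I.Mm.fun_module_ext[of _ I b])
    show "?l \<in> carrier (I.\<F> b)"
      using x xs up pcl by (intro W.M.minus_closed I.\<theta>_fun W.finsum_closed) auto
    have "G.\<theta> (r + b) x f (xs @ ys) \<in> carrier M" if "ys \<in> tuples I b" for ys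
      using that x xs append_tuples[OF xs I_tuples[OF that]]
      by (intro I.Mm.fun_module_closed[OF G.\<theta>_fun[OF G.alternating_fun[OF f]]])
    then show "?r \<in> carrier (I.\<F> b)" by (simp add: I.Mm.fun_module_carrier)
    show "?l ys = ?r ys" if "ys \<in> tuples I b" for ys
      using lie_deriv_lift[OF G.alternating_fun[OF f] x xs that] that eq by simp
  qed
qed

end

lemma (in signed_group) alt_sign_eq_zero: "u \<in> carrier M \<Longrightarrow> alt_sign M i u = \<zero>\<^bsub>M\<^esub> \<Longrightarrow> u = \<zero>\<^bsub>M\<^esub>"
  by (auto simp: alt_sign_def split: if_splits)

section \<open>The complement \<open>J\<close> and the action on cohomology classes\<close>

locale adapted_pair = ideal_pair F g M act I
  for F :: "('a, 'c) ring_scheme" and g :: "('a, 'b, 'd) lie_scheme"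
    and M :: "('a, 'm, 'e) module_scheme" and act :: "'b \<Rightarrow> 'm \<Rightarrow> 'm" and I :: "'b set" +
  fixes k IL Jk JL J :: "'b set"
  assumes subalgebra: "lie_subalgebra F g k" and decomp: "adapted_decomp F g I k IL Jk JL"
    and J: "J = Jk <+>\<^bsub>g\<^esub> JL"
begin

abbreviation "K \<equiv> I \<inter> k"

lemma k_carrier: "k \<subseteq> carrier g"
  using I.L.submoduleE(1) subalgebra by (auto simp: lie_subalgebra_def)

lemma K_subset: "K \<subseteq> I" by auto

lemma J_facts:
  "submodule Jk F g" "submodule JL F g" "\<And>x v. x \<in> k \<Longrightarrow> v \<in> Jk \<Longrightarrow> bracket g x v \<in> Jk"
  "\<And>x v. x \<in> k \<Longrightarrow> v \<in> JL \<Longrightarrow> bracket g x v \<in> JL"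
  "k = K <+>\<^bsub>g\<^esub> Jk" "carrier g = I <+>\<^bsub>g\<^esub> J" "I \<inter> J = {\<zero>\<^bsub>g\<^esub>}"
  using decomp by (auto simp: adapted_decomp_def ad_submodule_def direct_decomp_def J)

lemma J_submodule: "submodule J F g"
  unfolding J by (rule I.L.submodule_set_add[OF J_facts(1,2)])

lemma J_carrier: "x \<in> J \<Longrightarrow> x \<in> carrier g"
  using I.L.submoduleE(1)[OF J_submodule] by auto

lemma K_J_commute:
  assumes y: "y \<in> K" and x: "x \<in> J"
  shows "bracket g y x = \<zero>\<^bsub>g\<^esub>"
proof -
  obtain u v where uv: "u \<in> Jk" "v \<in> JL" "x = u \<oplus>\<^bsub>g\<^esub> v" using x by (auto simp: J set_add_def')
  then have c: "u \<in> carrier g" "v \<in> carrier g" "y \<in> carrier g"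
    using I.L.submoduleE(1)[OF J_facts(1)] I.L.submoduleE(1)[OF J_facts(2)] y by (auto simp: I.D_carrier)
  then have "bracket g y x = bracket g y u \<oplus>\<^bsub>g\<^esub> bracket g y v"
    unfolding uv(3) by (simp add: I.Lie.bracket_add_right)
  also have "\<dots> \<in> J" unfolding J using y uv by (intro set_addI J_facts) auto
  finally have "bracket g y x \<in> J" .
  moreover have "bracket g y x \<in> I" using y J_carrier[OF x] by (auto intro: I.D_bracket')
  ultimately show ?thesis using J_facts(7) by blast
qed

text \<open>Two decompositions of the same element differ by an element of
  \<open>I \<inter> J\<close>, which is zero.\<close>

lemma plus_part_eq:
  assumes i: "i \<in> I" and x: "x \<in> J"
  shows "plus_part g I J (i \<oplus>\<^bsub>g\<^esub> x) = x"
  unfolding plus_part_def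
proof (rule the_equality)
  show "x \<in> J \<and> (\<exists>i'\<in>I. i \<oplus>\<^bsub>g\<^esub> x = i' \<oplus>\<^bsub>g\<^esub> x)" using i x by blast
  fix j assume "j \<in> J \<and> (\<exists>i'\<in>I. i \<oplus>\<^bsub>g\<^esub> x = i' \<oplus>\<^bsub>g\<^esub> j)"
  then obtain i' where j: "j \<in> J" "i' \<in> I" "i \<oplus>\<^bsub>g\<^esub> x = i' \<oplus>\<^bsub>g\<^esub> j" by blast
  have c: "i \<in> carrier g" "i' \<in> carrier g" "x \<in> carrier g" "j \<in> carrier g"
    using i j x by (auto simp: I.D_carrier J_carrier)
  then have e: "i \<ominus>\<^bsub>g\<^esub> i' = j \<ominus>\<^bsub>g\<^esub> x"
    using j(3) by (simp add: I.L.M.minus_simps)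
  have "i \<ominus>\<^bsub>g\<^esub> i' \<in> I"
    using i j by (simp add: a_minus_def I.L.submoduleE(3,5)[OF I.D_submodule])
  moreover have "i \<ominus>\<^bsub>g\<^esub> i' \<in> J"
    unfolding e using x j by (simp add: a_minus_def I.L.submoduleE(3,5)[OF J_submodule])
  ultimately have "j \<ominus>\<^bsub>g\<^esub> x = \<zero>\<^bsub>g\<^esub>" using J_facts(7) e by auto
  then show "j = x" using c by (simp add: I.L.M.minus_simps)
qed

lemma J_rep: "x \<in> carrier g \<Longrightarrow> \<exists>j\<in>J. cls x = cls j"
  using J_facts(6) I.L.coset_add_left[OF I.D_submodule] J_carrier by (fastforce simp: set_add_def')

lemma Jk_subset_J: "Jk \<subseteq> J"
proof
  fix x assume "x \<in> Jk"
  then show "x \<in> J"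
    using set_addI[OF _ submodule_zero_mem[OF J_facts(2)], of x Jk g] I.L.submoduleE(1)[OF J_facts(1)]
    by (auto simp: J)
qed

lemma Jk_subset_k: "Jk \<subseteq> k"
proof
  fix x assume x: "x \<in> Jk"
  have "\<zero>\<^bsub>g\<^esub> \<in> K" using subalgebra I.D_submodule by (auto simp: lie_subalgebra_def intro: submodule_zero_mem)
  then have "\<zero>\<^bsub>g\<^esub> \<oplus>\<^bsub>g\<^esub> x \<in> k" using J_facts(5) x set_addI by metis
  then show "x \<in> k" using x I.L.submoduleE(1)[OF J_facts(1)] by auto
qed

text \<open>Such a representative j lies in \<open>k\<close> and in \<open>J\<close> at once:
  \<theta>_j kills relative cochains, and \<open>action_eq\<close> computes the action of its
  coset.\<close>

lemma k_rep: "x \<in> k \<Longrightarrow> \<exists>j\<in>Jk. cls x = cls j"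
proof -
  assume "x \<in> k"
  then have "x \<in> K <+>\<^bsub>g\<^esub> Jk" using J_facts(5) by simp
  then obtain i j where "i \<in> K" "j \<in> Jk" "x = i \<oplus>\<^bsub>g\<^esub> j" by (auto simp: set_add_def')
  then show ?thesis
    using I.L.coset_add_left[OF I.D_submodule, of i j] I.L.submoduleE(1)[OF J_facts(1)] by auto
qed

lemma tuples_rep:
  "Xs \<in> tuples (carrier gI) n \<Longrightarrow> \<exists>xs\<in>tuples J n. Xs = map cls xs"
proof (induction n arbitrary: Xs)
  case (Suc n)
  then obtain Y Ys where Xs: "Xs = Y # Ys" "Y \<in> carrier gI" "Ys \<in> tuples (carrier gI) n" by (elim tuples_SucE)
  then obtain y where y: "y \<in> J" "Y = cls y" using J_rep by (auto simp: gI_simps)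
  from Suc.IH[OF Xs(3)] obtain ys where ys: "ys \<in> tuples J n" "Ys = map cls ys" by blast
  have "y # ys \<in> tuples J (Suc n)" "Xs = map cls (y # ys)" using y ys Xs by auto
  then show ?case by blast
qed (simp add: tuples_0)

lemma J_tuples: "xs \<in> tuples J n \<Longrightarrow> xs \<in> tuples (carrier g) n"
  by (erule tuples_mono) (auto intro: J_carrier)

lemma subquotient: "subquotient F (I.\<F> q) (I.\<Z> K q) (I.\<B> K q)"
  by (intro subquotient.intro subquotient_axioms.intro I.Mm.fun_module_module
      I.submodule_rel_cocycles I.submodule_rel_coboundaries I.rel_coboundaries_cocycles K_subset)

abbreviation "cl q c \<equiv> I.\<B> K q +>\<^bsub>I.\<F> q\<^esub> c"
abbreviation "H q \<equiv> ideal_cohomology F g I k M act q"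
abbreviation "actH q \<equiv> cohomology_action F g I k M act J q"

lemma cohomology_class_eq: "cohomology_class F g I k M act q c = cl q c"
  by (simp add: cohomology_class_def cochain_module_eq a_r_coset_def')

lemma H_eq: "H q = quotient_module ((I.\<F> q)\<lparr>carrier := I.\<Z> K q\<rparr>) (I.\<B> K q)"
  by (simp add: ideal_cohomology_def rel_cohomology_def cochain_module_eq)

text \<open>Every representative i + x of the coset has plus part x. Changing c by a relative
  coboundary changes \<theta>_x c by another one, because x commutes with \<open>K\<close>; hence
  the formula in the definition has one common value.\<close>

lemma action_eq:
  assumes x: "x \<in> J" and c: "c \<in> I.\<Z> K q"
  shows "actH q (cls x) (cl q c) = cl q (I.\<theta> q x c)"
proof -
  interpret S: subquotient F "I.\<F> q" "I.\<Z> K q" "I.\<B> K q" by (rule subquotient)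
  have xg: "x \<in> carrier g" using x by (rule J_carrier)
  have cf: "c \<in> carrier (I.\<F> q)" using c by (rule S.S_carrier)
  have "cl q (I.\<theta> q (plus_part g I J x') c') = cl q (I.\<theta> q x c)" if x': "x' \<in> cls x" and c': "c' \<in> cl q c" for x' c'
  proof -
    obtain i where i: "i \<in> I" "x' = i \<oplus>\<^bsub>g\<^esub> x" using x' cls_mem[OF xg] by blast
    obtain b where b: "b \<in> I.\<B> K q" "c' = b \<oplus>\<^bsub>I.\<F> q\<^esub> c" using c' S.coset_mem[OF S.U cf] by blast
    have bf: "b \<in> carrier (I.\<F> q)" using b S.U_subset S.S_carrier by blast
    have "I.\<theta> q x c' = I.\<theta> q x b \<oplus>\<^bsub>I.\<F> q\<^esub> I.\<theta> q x c"
    proof (rule I.Mm.fun_module_ext[of _ I q])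
      show "I.\<theta> q x c' zs = (I.\<theta> q x b \<oplus>\<^bsub>I.\<F> q\<^esub> I.\<theta> q x c) zs" if "zs \<in> tuples I q" for zs
        unfolding I.Mm.fun_module_apply(2)[OF that]
        using that by (intro I.\<theta>_add bf cf xg) (simp_all add: b(2) I.Mm.fun_module_apply)
    qed (use b bf cf xg in \<open>auto intro!: I.\<theta>_fun S.M.a_closed\<close>)
    moreover have "I.\<theta> q x b \<in> I.\<B> K q"
      using K_J_commute x by (intro I.\<theta>_rel_coboundaries K_subset b xg)
    ultimately show ?thesis
      using i plus_part_eq[OF i(1) x] I.\<theta>_fun[OF cf xg] by (simp add: S.coset_add_left[OF S.U])
  qed
  note eq = this
  have "the_elem ((\<lambda>(x, c). cl q (I.\<theta> q (plus_part g I J x) c)) ` (cls x \<times> cl q c))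
      = (\<lambda>(x, c). cl q (I.\<theta> q (plus_part g I J x) c)) (x, c)"
  proof (rule the_elem_image_unique)
    have ne: "x \<in> cls x" "c \<in> cl q c" using cls_self[OF xg] S.coset_self[OF S.U cf] by auto
    then show "cls x \<times> cl q c \<noteq> {}" by blast
    fix y assume "y \<in> cls x \<times> cl q c"
    then obtain x' c' where "y = (x', c')" "x' \<in> cls x" "c' \<in> cl q c" by blast
    then show "(case y of (x, c) \<Rightarrow> cl q (I.\<theta> q (plus_part g I J x) c))
        = (case (x, c) of (x, c) \<Rightarrow> cl q (I.\<theta> q (plus_part g I J x) c))"
      using eq[of x' c'] eq[OF ne] by (simp only: case_prod_conv)
  qed
  also have "\<dots> = cl q (I.\<theta> q x c)"
    using eq[OF cls_self[OF xg] S.coset_self[OF S.U cf]] by (simp only: case_prod_conv)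
  finally show ?thesis by (simp add: cohomology_action_def cohomology_class_eq)
qed

text \<open>Since \<theta>_y f = 0, \<open>\<theta>_part\<close> writes \<theta>_y (f_xs) as the sum
  of the terms in \<open>van\<close>. For f in \<open>Fil p\<close> that assumption is met in two
  ways: with r = p the bracket adds an entry in \<open>I\<close>, and with r = p + 1 and entries
  from \<open>J\<close> the bracket is zero.\<close>

lemma part_rel_cochains:
  assumes f: "f \<in> rel_cochains F g k M act (r + b)" and xs: "xs \<in> tuples (carrier g) r"
    and van: "\<And>y j ys. y \<in> K \<Longrightarrow> j < r \<Longrightarrow> ys \<in> tuples I b \<Longrightarrow> f (xs[j := bracket g y (xs ! j)] @ ys) = \<zero>\<^bsub>M\<^esub>"
  shows "part xs b f \<in> I.\<R> K b"
  unfolding I.rel_cochains_iff[OF K_subset]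
proof (intro conjI ballI allI impI)
  note R = f[unfolded G.rel_cochains_iff[OF k_carrier]]
  then have alt: "f \<in> \<C> (r + b)" by blast
  show "part xs b f \<in> I.\<A> b" by (rule part_alternating[OF alt xs])
  fix y assume y: "y \<in> K"
  then have yI: "y \<in> I" "y \<in> k" "y \<in> carrier g" using k_carrier by auto
  {
    fix m ys assume b: "b = Suc m" and ys: "ys \<in> tuples I m"
    let ?z = "xs @ y # ys"
    have yys: "y # ys \<in> tuples I b" using b ys yI by simp
    have z: "?z \<in> tuples (carrier g) (r + b)" by (rule append_tuples[OF xs I_tuples[OF yys]])
    have n: "r + b = Suc (r + m)" using b by simp
    \<comment> \<open>A relative cochain vanishes with y in the first slot; moving y there from
      position r costs only a sign.\<close>
    have "f (y # nths ?z (- {r})) = alt_sign M r (f (?z[r := y]))"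
      using alt z yI unfolding n by (intro G.B.alternating_move) auto
    moreover have "?z[r := y] = ?z" using xs by (simp add: list_update_append length_tuples)
    moreover have "nths ?z (- {r}) \<in> tuples (carrier g) (r + m)" using z unfolding n by (rule nths_tuples1) simp
    then have "f (y # nths ?z (- {r})) = \<zero>\<^bsub>M\<^esub>" using R yI n by blast
    ultimately have "f ?z = \<zero>\<^bsub>M\<^esub>"
      using I.M.alt_sign_eq_zero[of "f ?z" r] G.B.alternating_closed[OF alt z] by simp
    then show "part xs b f (y # ys) = \<zero>\<^bsub>M\<^esub>" using yys by (simp add: part_apply)
  next
    fix ys assume ys: "ys \<in> tuples I b"
    interpret W: module F "I.\<F> b" by (rule I.Mm.fun_module_module)
    have "(\<Oplus>\<^bsub>I.\<F> b\<^esub>j\<in>{..<r}. part (xs[j := bracket g y (xs ! j)]) b f) = \<zero>\<^bsub>I.\<F> b\<^esub>"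
      using van[OF y] by (intro W.finsum_const_zero part_zeroI) auto
    then have "I.\<theta> b y (part xs b f) = (\<lambda>ys\<in>tuples I b. G.\<theta> (r + b) y f (xs @ ys))"
      using \<theta>_part[OF alt yI(3) xs] I.\<theta>_fun[OF part_fun[OF G.alternating_fun[OF alt] xs] yI(3)]
      by (simp add: a_minus_def)
    then show "I.\<theta> b y (part xs b f) ys = \<zero>\<^bsub>M\<^esub>"
      using R yI ys append_tuples[OF xs I_tuples[OF ys]] by simp
  }
qed

end

section \<open>The first page\<close>

context adapted_pair
begin

abbreviation "Fil p n \<equiv> filtration F g I k M act p n"
abbreviation "Z\<^sub>1 p q \<equiv> Z1 F g I k M act p q"
abbreviation "B\<^sub>1 p q \<equiv> B1 F g I k M act p q"
abbreviation "\<Phi> p q c \<equiv> alpha F g I k M act p q (s_map g I p q c)"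

lemma filtration_rel: "f \<in> Fil p n \<Longrightarrow> f \<in> rel_cochains F g k M act n"
  by (simp add: filtration_def)

lemma filtration_alternating: "f \<in> Fil p n \<Longrightarrow> f \<in> \<C> n"
  by (simp add: filtration_def rel_cochains_def)

lemma filtration_fun: "f \<in> Fil p n \<Longrightarrow> f \<in> carrier (G.\<F> n)"
  by (rule G.alternating_fun) (simp add: filtration_alternating)

lemma submodule_filtration: "submodule (Fil p n) F (G.\<F> n)"
proof -
  interpret W: module F "G.\<F> n" by (rule I.Mm.fun_module_module)
  note R = G.submodule_rel_cochains[OF k_carrier, of n]
  show ?thesis
  proof (rule W.submodule_lincombI)
    show "Fil p n \<subseteq> carrier (G.\<F> n)" using filtration_fun by blast
    show "\<zero>\<^bsub>G.\<F> n\<^esub> \<in> Fil p n"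
      using submodule_zero_mem[OF R] by (simp add: filtration_def I.Mm.fun_module_apply)
    show "a \<odot>\<^bsub>G.\<F> n\<^esub> f \<oplus>\<^bsub>G.\<F> n\<^esub> b \<odot>\<^bsub>G.\<F> n\<^esub> h \<in> Fil p n"
      if "a \<in> carrier F" "b \<in> carrier F" "f \<in> Fil p n" "h \<in> Fil p n" for a b f h
      using that W.submoduleE(4,5)[OF R] by (simp add: filtration_def I.Mm.fun_module_apply)
  qed
qed

lemma B1_eq:
  "B\<^sub>1 p q = (case p + q of 0 \<Rightarrow> {\<zero>\<^bsub>G.\<F> 0\<^esub>} | Suc n \<Rightarrow> \<Delta> n ` Fil p n) <+>\<^bsub>G.\<F> (p + q)\<^esub> Fil (p + 1) (p + q)"
proof -
  have "\<zero>\<^bsub>G.\<F> 0\<^esub> = zero_cochain M (carrier g) 0" by (simp add: fun_module_def)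
  then show ?thesis by (cases "p + q") (auto simp: B1_def cochain_module_eq set_add_def')
qed

lemma submodule_B1: "submodule (B\<^sub>1 p q) F (G.\<F> (p + q))"
proof -
  interpret W: module F "G.\<F> (p + q)" by (rule I.Mm.fun_module_module)
  have "submodule (case p + q of 0 \<Rightarrow> {\<zero>\<^bsub>G.\<F> 0\<^esub>} | Suc n \<Rightarrow> \<Delta> n ` Fil p n) F (G.\<F> (p + q))"
  proof (cases "p + q")
    case 0
    then show ?thesis
      using W.zero_closed W.l_zero[OF W.zero_closed] W.smult_r_null by (intro W.submodule_smultI) auto
  next
    case (Suc n)
    then show ?thesis using G.submodule_\<delta>_image[OF submodule_filtration, of n p] by simp
  qed
  then show ?thesis unfolding B1_eq by (rule W.submodule_set_add[OF _ submodule_filtration])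
qed

lemma part_plus:
  assumes "f \<in> carrier (G.\<F> (r + b))" "h \<in> carrier (G.\<F> (r + b))" "xs \<in> tuples (carrier g) r"
  shows "part xs b (f \<oplus>\<^bsub>G.\<F> (r + b)\<^esub> h) = part xs b f \<oplus>\<^bsub>I.\<F> b\<^esub> part xs b h"
  using append_tuples[OF assms(3) I_tuples] by (auto simp: part_def fun_module_def fun_eq_iff)

lemma descends_plus:
  assumes "f \<in> carrier (G.\<F> (r + b))" "h \<in> carrier (G.\<F> (r + b))" "descends r b f" "descends r b h"
  shows "descends r b (f \<oplus>\<^bsub>G.\<F> (r + b)\<^esub> h)"
  using assms(3,4) unfolding descends_def by (metis part_plus[OF assms(1,2)])

text \<open>For y in \<open>K\<close> each [y, xs_j] lies in the ideal, so together with the b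
  trailing entries b + 1 arguments lie in \<open>I\<close>.\<close>

lemma part_filtration_rel:
  assumes f: "f \<in> Fil r (r + b)" and xs: "xs \<in> tuples (carrier g) r"
  shows "part xs b f \<in> I.\<R> K b"
proof (rule part_rel_cochains[OF filtration_rel[OF f] xs])
  fix y j ys assume y: "y \<in> K" and j: "j < r" and ys: "ys \<in> tuples I b"
  let ?z = "xs[j := bracket g y (xs ! j)]"
  have b: "bracket g y (xs ! j) \<in> I" using y j xs by (auto intro: I.D_bracket')
  have z: "?z \<in> tuples (carrier g) r" using xs b by (simp add: I.D_carrier)
  show "f (?z @ ys) = \<zero>\<^bsub>M\<^esub>"
  proof (rule filtration_vanish[OF f])
    show "?z @ ys \<in> tuples (carrier g) (r + b)" by (rule append_tuples[OF z I_tuples[OF ys]])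
    show "insert j {r..<r + b} \<subseteq> {i. i < r + b \<and> (?z @ ys) ! i \<in> I}"
      using xs ys b j by (auto simp: nth_append length_tuples)
  qed (use j in simp)
qed

text \<open>By \<open>filtration_diff_part\<close>, (d f)_xs is up to sign the differential of the
  relative cochain f_xs; that it depends only on cosets is inherited from f.\<close>

lemma diff_filtration_part:
  assumes f: "f \<in> Fil p n" and n: "Suc n = p + q"
  shows "descends p q (\<Delta> n f)" "xs \<in> tuples (carrier g) p \<Longrightarrow> part xs q (\<Delta> n f) \<in> I.\<B> K q"
proof -
  interpret S: subquotient F "I.\<F> q" "I.\<Z> K q" "I.\<B> K q" by (rule subquotient)
  have "descends p q (\<Delta> n f) \<and> (\<forall>xs\<in>tuples (carrier g) p. part xs q (\<Delta> n f) \<in> I.\<B> K q)"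
  proof (cases q)
    case 0
    \<comment> \<open>Here n = p - 1, so the bound n + 1 \<le> p holds with no entry in
      \<open>I\<close> at all: this filtration step is zero.\<close>
    have "f zs = \<zero>\<^bsub>M\<^esub>" if "zs \<in> tuples (carrier g) n" for zs
      by (rule filtration_vanish[OF f that, of "{}"]) (use n 0 in auto)
    then have "\<Delta> n f zs = \<zero>\<^bsub>M\<^esub>" if "zs \<in> tuples (carrier g) (p + q)" for zs
      using that unfolding n[symmetric] by (intro G.\<delta>_zero)
    then have "part xs q (\<Delta> n f) = \<zero>\<^bsub>I.\<F> q\<^esub>" if "xs \<in> tuples (carrier g) p" for xs
      using append_tuples[OF that I_tuples] by (intro part_zeroI) auto
    then show ?thesis using submodule_zero_mem[OF S.U] by (simp add: descends_def)
  next
    case (Suc b)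
    then have nb: "n = p + b" using n by simp
    have eq: "part xs q (\<Delta> n f) = alt_sign (I.\<F> q) p (I.\<delta> b (part xs b f))"
      and mem: "I.\<delta> b (part xs b f) \<in> I.\<B> K q"
      if xs: "xs \<in> tuples (carrier g) p" for xs
    proof -
      have r: "part xs b f \<in> I.\<R> K b" using f xs unfolding nb by (rule part_filtration_rel)
      then show "I.\<delta> b (part xs b f) \<in> I.\<B> K q" using Suc by (simp add: I.rel_coboundaries_Suc)
      note pf = I.\<delta>_fun[OF I.rel_cochains_fun[OF r]]
      show "part xs q (\<Delta> n f) = alt_sign (I.\<F> q) p (I.\<delta> b (part xs b f))"
      proof (rule I.Mm.fun_module_ext[of _ I q])
        have "Suc n = p + q" by (rule n)
        then show "part xs q (\<Delta> n f) \<in> carrier (I.\<F> q)"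
          using part_fun[of "\<Delta> n f" p q xs] G.\<delta>_fun[OF filtration_fun[OF f]] xs by simp
        show "alt_sign (I.\<F> q) p (I.\<delta> b (part xs b f)) \<in> carrier (I.\<F> q)"
          using pf Suc S.a_inv_closed[of "I.\<delta> b (part xs b f)"] by (simp add: alt_sign_def)
        fix ys assume ys: "ys \<in> tuples I q"
        then show "part xs q (\<Delta> n f) ys = alt_sign (I.\<F> q) p (I.\<delta> b (part xs b f)) ys"
          using filtration_diff_part[OF f nb xs, of ys] pf Suc
          by (simp add: part_apply I.Mm.fun_module_alt_sign)
      qed
    qed
    have "descends p b f" using f nb by (rule filtration_descends)
    then have "descends p q (\<Delta> n f)" unfolding descends_def using eq by metis
    moreover have "alt_sign (I.\<F> q) p u \<in> I.\<B> K q" if "u \<in> I.\<B> K q" for u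
      using that S.submoduleE(3)[OF S.U] by (simp add: alt_sign_def)
    ultimately show ?thesis using eq mem by simp
  qed
  then show "descends p q (\<Delta> n f)" "xs \<in> tuples (carrier g) p \<Longrightarrow> part xs q (\<Delta> n f) \<in> I.\<B> K q" by blast+
qed

text \<open>The two summands behave differently: d of \<open>Fil p\<close> yields coboundaries,
  while elements of \<open>Fil (p + 1)\<close> are already killed by q arguments in \<open>I\<close>
  and yield zero.\<close>

lemma B1_part:
  assumes b: "b \<in> B\<^sub>1 p q"
  shows "descends p q b" "xs \<in> tuples (carrier g) p \<Longrightarrow> part xs q b \<in> I.\<B> K q"
proof -
  interpret S: subquotient F "I.\<F> q" "I.\<Z> K q" "I.\<B> K q" by (rule subquotient)
  interpret W: module F "G.\<F> (p + q)" by (rule I.Mm.fun_module_module)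
  obtain u v where uv: "u \<in> (case p + q of 0 \<Rightarrow> {\<zero>\<^bsub>G.\<F> 0\<^esub>} | Suc n \<Rightarrow> \<Delta> n ` Fil p n)"
    "v \<in> Fil (p + 1) (p + q)" "b = u \<oplus>\<^bsub>G.\<F> (p + q)\<^esub> v"
    using b by (auto simp: B1_eq set_add_def')
  have u: "u \<in> carrier (G.\<F> (p + q)) \<and> descends p q u \<and> (\<forall>xs\<in>tuples (carrier g) p. part xs q u \<in> I.\<B> K q)"
  proof (cases "p + q")
    case 0
    then have "u = \<zero>\<^bsub>G.\<F> (p + q)\<^esub>" using uv(1) by simp
    moreover have "part xs q \<zero>\<^bsub>G.\<F> (p + q)\<^esub> = \<zero>\<^bsub>I.\<F> q\<^esub>" if "xs \<in> tuples (carrier g) p" for xs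
      using append_tuples[OF that I_tuples] by (intro part_zeroI) (simp add: I.Mm.fun_module_apply)
    ultimately show ?thesis using submodule_zero_mem[OF S.U] by (simp add: descends_def)
  next
    case (Suc n)
    then obtain f where f: "f \<in> Fil p n" "u = \<Delta> n f" using uv(1) by auto
    then show ?thesis
      using diff_filtration_part[OF f(1) Suc[symmetric]] G.\<delta>_fun[OF filtration_fun[OF f(1)]] Suc by simp
  qed
  have vf: "v \<in> carrier (G.\<F> (p + q))" using uv(2) by (rule filtration_fun)
  have v0: "part xs q v = \<zero>\<^bsub>I.\<F> q\<^esub>" if "xs \<in> tuples (carrier g) p" for xs
    using that uv(2) by (intro part_zeroI filtration_vanish_append) auto
  then have "descends p q v" by (simp add: descends_def)
  then show "descends p q b" unfolding uv(3) using u vf by (intro descends_plus) auto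
  show "part xs q b \<in> I.\<B> K q" if xs: "xs \<in> tuples (carrier g) p"
  proof -
    have "part xs q b = part xs q u" unfolding uv(3)
      using u vf v0[OF xs] part_fun[of u p q xs] xs by (simp add: part_plus)
    then show ?thesis using u xs by simp
  qed
qed

text \<open>Membership of d c in \<open>Fil (p + 1)\<close> makes d c vanish once q + 1 arguments
  lie in \<open>I\<close>; by \<open>filtration_diff_part\<close> this gives the cocycle condition
  for each c_xs.\<close>

lemma Z1_part:
  assumes c: "c \<in> Z\<^sub>1 p q"
  shows "descends p q c" "xs \<in> tuples (carrier g) p \<Longrightarrow> part xs q c \<in> I.\<Z> K q"
proof -
  have f: "c \<in> Fil p (p + q)" and df: "\<Delta> (p + q) c \<in> Fil (p + 1) (p + q + 1)"
    using c by (auto simp: Z1_def)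
  show "descends p q c" by (rule filtration_descends[OF f refl])
  assume xs: "xs \<in> tuples (carrier g) p"
  have r: "part xs q c \<in> I.\<R> K q" by (rule part_filtration_rel[OF f xs])
  have "I.\<delta> q (part xs q c) ys = \<zero>\<^bsub>M\<^esub>" if ys: "ys \<in> tuples I (Suc q)" for ys
  proof -
    have "\<Delta> (p + q) c (xs @ ys) = \<zero>\<^bsub>M\<^esub>"
      by (rule filtration_vanish_append[OF df _ _ xs ys]) auto
    then have "alt_sign M p (I.\<delta> q (part xs q c) ys) = \<zero>\<^bsub>M\<^esub>"
      using filtration_diff_part[OF f refl xs ys] by simp
    then show ?thesis
      using I.M.alt_sign_eq_zero I.Mm.fun_module_closed[OF I.\<delta>_fun[OF I.rel_cochains_fun[OF r]] ys] by blast
  qed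
  then show "part xs q c \<in> I.\<Z> K q" using r by (simp add: I.rel_cocycles_iff[OF K_subset])
qed

lemma Z1_fun: "c \<in> Z\<^sub>1 p q \<Longrightarrow> c \<in> carrier (G.\<F> (p + q))"
  unfolding Z1_def by (auto dest: filtration_fun)

lemma \<Phi>_apply:
  assumes "descends p q c" "xs \<in> tuples (carrier g) p"
  shows "\<Phi> p q c (map cls xs) = cl q (part xs q c)"
  using map_cls_tuples[OF assms(2)] by (simp add: alpha_def cohomology_class_eq s_map_part[OF assms])

text \<open>By \<open>B1_part\<close>, another representative of the class changes each c_xs by a
  relative coboundary.\<close>

lemma phi_coset:
  assumes c: "c \<in> Z\<^sub>1 p q"
  shows "phi F g I k M act p q (B\<^sub>1 p q +>\<^bsub>G.\<F> (p + q)\<^esub> c) = \<Phi> p q c"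
proof -
  interpret S: subquotient F "I.\<F> q" "I.\<Z> K q" "I.\<B> K q" by (rule subquotient)
  interpret W: module F "G.\<F> (p + q)" by (rule I.Mm.fun_module_module)
  note B = submodule_B1[of p q]
  have "\<Phi> p q c' = \<Phi> p q c" if c': "c' \<in> B\<^sub>1 p q +>\<^bsub>G.\<F> (p + q)\<^esub> c" for c'
  proof -
    obtain b where b: "b \<in> B\<^sub>1 p q" "c' = b \<oplus>\<^bsub>G.\<F> (p + q)\<^esub> c"
      using c' W.coset_mem[OF B Z1_fun[OF c]] by blast
    have bf: "b \<in> carrier (G.\<F> (p + q))" using b(1) W.submoduleE(1)[OF B] by blast
    have d: "descends p q c'" unfolding b(2)
      by (intro descends_plus bf Z1_fun[OF c] B1_part(1)[OF b(1)] Z1_part(1)[OF c])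
    have "\<Phi> p q c' (map cls xs) = \<Phi> p q c (map cls xs)" if xs: "xs \<in> tuples (carrier g) p" for xs
    proof -
      have "part xs q c' = part xs q b \<oplus>\<^bsub>I.\<F> q\<^esub> part xs q c"
        unfolding b(2) using bf Z1_fun[OF c] xs by (rule part_plus)
      then show ?thesis
        using S.coset_add_left[OF S.U B1_part(2)[OF b(1) xs] S.S_carrier[OF Z1_part(2)[OF c xs]]]
        by (simp add: \<Phi>_apply[OF d xs] \<Phi>_apply[OF Z1_part(1)[OF c] xs])
    qed
    moreover have "\<exists>xs\<in>tuples (carrier g) p. Xs = map cls xs" if "Xs \<in> tuples (carrier gI) p" for Xs
      using tuples_rep[OF that] J_tuples by blast
    ultimately have "\<Phi> p q c' Xs = \<Phi> p q c Xs" if "Xs \<in> tuples (carrier gI) p" for Xs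
      using that by blast
    then show ?thesis
      by (intro extensionalityI[of _ "tuples (carrier gI) p"]) (simp_all add: alpha_def)
  qed
  moreover have "B\<^sub>1 p q +>\<^bsub>G.\<F> (p + q)\<^esub> c \<noteq> {}" using W.coset_self[OF B Z1_fun[OF c]] by blast
  ultimately show ?thesis unfolding phi_def by (intro the_elem_image_unique)
qed

lemma E1_carrier: "carrier (E1 F g I k M act p q) = (\<lambda>c. B\<^sub>1 p q +>\<^bsub>G.\<F> (p + q)\<^esub> c) ` Z\<^sub>1 p q"
  by (auto simp: E1_def quotient_module_def cochain_module_eq A_RCOSETS_def' a_r_coset_def')

text \<open>The summand that is itself a differential is killed by d, and v in
  \<open>Fil (p + 1)\<close> is sent into the first summand of the next \<open>B1\<close>.\<close>

lemma diff_B1: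
  assumes b: "b \<in> B\<^sub>1 p q"
  shows "\<Delta> (p + q) b \<in> B\<^sub>1 (p + 1) q"
proof -
  interpret W: module F "G.\<F> (p + q)" by (rule I.Mm.fun_module_module)
  interpret W': module F "G.\<F> (Suc (p + q))" by (rule I.Mm.fun_module_module)
  obtain u v where uv: "u \<in> (case p + q of 0 \<Rightarrow> {\<zero>\<^bsub>G.\<F> 0\<^esub>} | Suc n \<Rightarrow> \<Delta> n ` Fil p n)"
    "v \<in> Fil (p + 1) (p + q)" "b = u \<oplus>\<^bsub>G.\<F> (p + q)\<^esub> v"
    using b by (auto simp: B1_eq set_add_def')
  have u: "u \<in> carrier (G.\<F> (p + q)) \<and> (\<forall>zs\<in>tuples (carrier g) (Suc (p + q)). \<Delta> (p + q) u zs = \<zero>\<^bsub>M\<^esub>)"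
  proof (cases "p + q")
    case 0
    then have "u = \<zero>\<^bsub>G.\<F> (p + q)\<^esub>" using uv(1) by simp
    then show ?thesis by (auto simp: I.Mm.fun_module_apply intro!: G.\<delta>_zero)
  next
    case (Suc n)
    then obtain f where f: "f \<in> Fil p n" "u = \<Delta> n f" using uv(1) by auto
    then show ?thesis
      using G.\<delta>_\<delta>[OF filtration_alternating[OF f(1)]] G.\<delta>_fun[OF filtration_fun[OF f(1)]] Suc by simp
  qed
  note vf = filtration_fun[OF uv(2)]
  have dv: "\<Delta> (p + q) v \<in> carrier (G.\<F> (Suc (p + q)))" by (rule G.\<delta>_fun[OF vf])
  \<comment> \<open>The zero is the component in \<open>Fil (p + 2)\<close> of the sum that defines
    the next \<open>B1\<close>.\<close>
  have "\<Delta> (p + q) b = \<Delta> (p + q) v \<oplus>\<^bsub>G.\<F> (Suc (p + q))\<^esub> \<zero>\<^bsub>G.\<F> (Suc (p + q))\<^esub>"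
  proof (rule I.Mm.fun_module_ext[of _ "carrier g" "Suc (p + q)"])
    show "\<Delta> (p + q) b \<in> carrier (G.\<F> (Suc (p + q)))"
      using u vf unfolding uv(3) by (intro G.\<delta>_fun W.a_closed) auto
    fix zs assume zs: "zs \<in> tuples (carrier g) (Suc (p + q))"
    have "\<Delta> (p + q) b zs = \<Delta> (p + q) u zs \<oplus>\<^bsub>M\<^esub> \<Delta> (p + q) v zs"
      using u vf zs by (intro G.\<delta>_add) (auto simp: uv(3) I.Mm.fun_module_apply)
    then show "\<Delta> (p + q) b zs = (\<Delta> (p + q) v \<oplus>\<^bsub>G.\<F> (Suc (p + q))\<^esub> \<zero>\<^bsub>G.\<F> (Suc (p + q))\<^esub>) zs"
      using u zs I.Mm.fun_module_closed[OF dv zs] by (simp add: I.Mm.fun_module_apply)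
  qed (use dv in simp)
  moreover have "\<zero>\<^bsub>G.\<F> (Suc (p + q))\<^esub> \<in> Fil (p + 1 + 1) (Suc (p + q))"
    by (rule submodule_zero_mem[OF submodule_filtration])
  ultimately show ?thesis
    unfolding B1_eq using uv(2) by (auto intro!: set_addI)
qed

text \<open>d d c = 0 lies in every filtration step.\<close>

lemma diff_Z1:
  assumes c: "c \<in> Z\<^sub>1 p q"
  shows "\<Delta> (p + q) c \<in> Z\<^sub>1 (p + 1) q"
proof -
  have alt: "c \<in> \<C> (p + q)" using c unfolding Z1_def by (auto dest: filtration_alternating)
  have "\<Delta> (Suc (p + q)) (\<Delta> (p + q) c) = \<zero>\<^bsub>G.\<F> (Suc (Suc (p + q)))\<^esub>"
    using G.\<delta>_\<delta>[OF alt] G.\<delta>_fun[OF G.\<delta>_fun[OF G.alternating_fun, of c "p + q"]] alt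
    by (intro I.Mm.fun_module_ext[of _ "carrier g" "Suc (Suc (p + q))"])
      (simp_all add: I.Mm.fun_module_apply fun_module_def zero_cochain_def)
  then show ?thesis using c submodule_zero_mem[OF submodule_filtration] by (simp add: Z1_def)
qed

text \<open>The degree is written \<open>p + 1 + q\<close>, the form in which
  \<open>phi_coset\<close> at p + 1 takes it up.\<close>

lemma d1_coset:
  assumes c: "c \<in> Z\<^sub>1 p q"
  shows "d1 F g I k M act p q (B\<^sub>1 p q +>\<^bsub>G.\<F> (p + q)\<^esub> c)
    = B\<^sub>1 (p + 1) q +>\<^bsub>G.\<F> (p + 1 + q)\<^esub> \<Delta> (p + q) c"
proof -
  interpret W: module F "G.\<F> (p + q)" by (rule I.Mm.fun_module_module)
  interpret W': module F "G.\<F> (p + 1 + q)" by (rule I.Mm.fun_module_module)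
  note B = submodule_B1[of p q] and B' = submodule_B1[of "p + 1" q] and cf = Z1_fun[OF c]
  have "B\<^sub>1 (p + 1) q +>\<^bsub>cochain_module F g k M act (p + q + 1)\<^esub> \<Delta> (p + q) c'
      = B\<^sub>1 (p + 1) q +>\<^bsub>G.\<F> (p + 1 + q)\<^esub> \<Delta> (p + q) c"
    if c': "c' \<in> B\<^sub>1 p q +>\<^bsub>G.\<F> (p + q)\<^esub> c" for c'
  proof -
    obtain b where b: "b \<in> B\<^sub>1 p q" "c' = b \<oplus>\<^bsub>G.\<F> (p + q)\<^esub> c"
      using c' W.coset_mem[OF B cf] by blast
    have bf: "b \<in> carrier (G.\<F> (p + q))" using b(1) W.submoduleE(1)[OF B] by blast
    have "\<Delta> (p + q) c' = \<Delta> (p + q) b \<oplus>\<^bsub>G.\<F> (p + 1 + q)\<^esub> \<Delta> (p + q) c"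
    proof (rule I.Mm.fun_module_ext[of _ "carrier g" "p + 1 + q"])
      show "\<Delta> (p + q) c' \<in> carrier (G.\<F> (p + 1 + q))"
        using G.\<delta>_fun[OF W.a_closed[OF bf cf]] b(2) by simp
      show "\<Delta> (p + q) b \<oplus>\<^bsub>G.\<F> (p + 1 + q)\<^esub> \<Delta> (p + q) c \<in> carrier (G.\<F> (p + 1 + q))"
        using G.\<delta>_fun[OF bf] G.\<delta>_fun[OF cf] by (intro W'.a_closed) simp_all
      fix zs assume zs: "zs \<in> tuples (carrier g) (p + 1 + q)"
      then show "\<Delta> (p + q) c' zs = (\<Delta> (p + q) b \<oplus>\<^bsub>G.\<F> (p + 1 + q)\<^esub> \<Delta> (p + q) c) zs"
        unfolding I.Mm.fun_module_apply(2)[OF zs] using bf cf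
        by (intro G.\<delta>_add) (auto simp: b(2) I.Mm.fun_module_apply)
    qed
    then show ?thesis
      using W'.coset_add_left[OF B' diff_B1[OF b(1)]] G.\<delta>_fun[OF cf]
      by (simp add: cochain_module_eq a_r_coset_def')
  qed
  note eq = this
  have self: "c \<in> B\<^sub>1 p q +>\<^bsub>G.\<F> (p + q)\<^esub> c" by (rule W.coset_self[OF B cf])
  have "d1 F g I k M act p q (B\<^sub>1 p q +>\<^bsub>G.\<F> (p + q)\<^esub> c)
      = B\<^sub>1 (p + 1) q +>\<^bsub>cochain_module F g k M act (p + q + 1)\<^esub> \<Delta> (p + q) c"
    unfolding d1_def
  proof (rule the_elem_image_unique)
    show "B\<^sub>1 p q +>\<^bsub>G.\<F> (p + q)\<^esub> c \<noteq> {}" using self by blast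
  qed (simp only: eq eq[OF self])
  then show ?thesis using eq[OF self] by simp
qed

end

section \<open>Comparison of the differentials\<close>

context adapted_pair
begin

text \<open>Multilinearity is inherited from c on representatives. The relative conditions use two
  kinds of them: any x in \<open>k\<close> for the insertion, and x in \<open>Jk\<close> for the Lie
  derivative, where the action on classes is given by \<theta>_x.\<close>

lemma \<Phi>_cochain:
  assumes c: "c \<in> Z\<^sub>1 p q"
  shows "\<Phi> p q c \<in> quotient_cochains F g I k M act J p q"
proof -
  interpret S: subquotient F "I.\<F> q" "I.\<Z> K q" "I.\<B> K q" by (rule subquotient)
  interpret QH: abelian_group S.Q by (rule S.Q_group)
  let ?\<phi> = "\<Phi> p q c"
  have alt: "c \<in> \<C> (p + q)" using c unfolding Z1_def by (auto dest: filtration_alternating)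
  have rel: "c \<in> rel_cochains F g k M act (p + q)" using c unfolding Z1_def by (auto dest: filtration_rel)
  note d = Z1_part(1)[OF c] and Z = Z1_part(2)[OF c]
  note ap = \<Phi>_apply[OF d]
  have rep: "\<exists>xs\<in>tuples (carrier g) n. Xs = map cls xs" if "Xs \<in> tuples (carrier gI) n" for Xs n
    using tuples_rep[OF that] J_tuples by blast
  have ext: "?\<phi> \<in> tuples (carrier gI) p \<rightarrow>\<^sub>E carrier (H q)"
  proof
    fix Xs assume "Xs \<in> tuples (carrier gI) p"
    then obtain xs where "xs \<in> tuples (carrier g) p" "Xs = map cls xs" using rep by blast
    then show "?\<phi> Xs \<in> carrier (H q)" using Z by (auto simp: ap H_eq S.Q_carrier)
  qed (simp add: alpha_def)
  have zero_coset: "cl q \<zero>\<^bsub>I.\<F> q\<^esub> = \<zero>\<^bsub>H q\<^esub>"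
    using S.coset_U[OF submodule_zero_mem[OF S.U]] by (simp add: H_eq S.Q_zero)
  have add: "?\<phi> (Xs[i := X \<oplus>\<^bsub>gI\<^esub> Y]) = ?\<phi> (Xs[i := X]) \<oplus>\<^bsub>H q\<^esub> ?\<phi> (Xs[i := Y])"
    if Xs: "Xs \<in> tuples (carrier gI) p" and i: "i < p" and X: "X \<in> carrier gI" and Y: "Y \<in> carrier gI" for Xs i X Y
  proof -
    obtain xs where xs: "xs \<in> tuples (carrier g) p" "Xs = map cls xs" using rep[OF Xs] by blast
    obtain x y where xy: "x \<in> carrier g" "y \<in> carrier g" "X = cls x" "Y = cls y" using X Y by (auto simp: gI_simps)
    show ?thesis
      using xs xy i Z
      by (simp add: cls_add ap part_add[OF alt] H_eq S.Q_add flip: map_update)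
  qed
  have smult: "?\<phi> (Xs[i := a \<odot>\<^bsub>gI\<^esub> X]) = a \<odot>\<^bsub>H q\<^esub> ?\<phi> (Xs[i := X])"
    if Xs: "Xs \<in> tuples (carrier gI) p" and i: "i < p" and X: "X \<in> carrier gI" and a: "a \<in> carrier F" for Xs i X a
  proof -
    obtain xs where xs: "xs \<in> tuples (carrier g) p" "Xs = map cls xs" using rep[OF Xs] by blast
    obtain x where x: "x \<in> carrier g" "X = cls x" using X by (auto simp: gI_simps)
    show ?thesis
      using xs x i a Z
      by (simp add: cls_smult ap part_smult[OF alt] H_eq S.Q_smult flip: map_update)
  qed
  have diag: "?\<phi> Xs = \<zero>\<^bsub>H q\<^esub>"
    if Xs: "Xs \<in> tuples (carrier gI) p" and ij: "i < j" "j < p" and eq: "Xs ! i = Xs ! j" for Xs i j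
  proof -
    obtain xs where xs: "xs \<in> tuples (carrier g) p" "Xs = map cls xs" using rep[OF Xs] by blast
    \<comment> \<open>Equal cosets need not come with equal representatives; reusing the one at
      position i gives c a genuine repetition.\<close>
    let ?ys = "xs[j := xs ! i]"
    have ys: "?ys \<in> tuples (carrier g) p" using xs ij by simp
    have "map cls ?ys = Xs" using xs ij eq by (simp add: map_update length_tuples list_update_same_conv)
    moreover have "part ?ys q c = \<zero>\<^bsub>I.\<F> q\<^esub>"
      using ij xs by (intro part_eq_zero[OF alt ys ij]) (simp add: length_tuples)
    ultimately show ?thesis using ap[OF ys] zero_coset by simp
  qed
  have ins: "insertion (carrier gI) m X ?\<phi> = zero_cochain (H q) (carrier gI) m"
    if X: "X \<in> cls ` k" and m: "p = Suc m" for X m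
  proof -
    obtain x where x: "x \<in> k" "x \<in> carrier g" "X = cls x" using X k_carrier by blast
    have "?\<phi> (X # Xs) = \<zero>\<^bsub>H q\<^esub>" if Xs: "Xs \<in> tuples (carrier gI) m" for Xs
    proof -
      obtain xs where xs: "xs \<in> tuples (carrier g) m" "Xs = map cls xs" using rep[OF Xs] by blast
      have "c (x # zs) = \<zero>\<^bsub>M\<^esub>" if "zs \<in> tuples (carrier g) (m + q)" for zs
        using rel x that m by (simp add: G.rel_cochains_iff[OF k_carrier])
      then have "part (x # xs) q c = \<zero>\<^bsub>I.\<F> q\<^esub>"
        using append_tuples[OF xs(1) I_tuples] by (intro part_zeroI) simp
      then show ?thesis using ap[of "x # xs"] xs x m zero_coset by simp
    qed
    then show ?thesis by (auto simp: insertion_def zero_cochain_def fun_eq_iff)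
  qed
  have deriv: "lie_deriv gI (H q) (actH q) (carrier gI) p X ?\<phi> = zero_cochain (H q) (carrier gI) p"
    if X: "X \<in> cls ` k" for X
  proof -
    obtain x where x: "x \<in> Jk" "X = cls x" using X k_rep by blast
    then have x': "x \<in> J" "x \<in> k" "x \<in> carrier g" using Jk_subset_J Jk_subset_k k_carrier by auto
    have "lie_deriv gI (H q) (actH q) (carrier gI) p X ?\<phi> Xs = \<zero>\<^bsub>H q\<^esub>"
      if Xs: "Xs \<in> tuples (carrier gI) p" for Xs
    proof -
      obtain xs where xs: "xs \<in> tuples (carrier g) p" "Xs = map cls xs" using rep[OF Xs] by blast
      have up: "xs[j := bracket g x (xs ! j)] \<in> tuples (carrier g) p" if "j < p" for j
        using that x' xs by (simp add: I.Lie.bracket_closed)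
      have summand: "?\<phi> (Xs[j := bracket gI X (Xs ! j)]) = cl q (part (xs[j := bracket g x (xs ! j)]) q c)"
        if "j < p" for j
        using that xs x x' up by (simp add: cls_bracket length_tuples ap flip: map_update)
      have pZ: "part (xs[j := bracket g x (xs ! j)]) q c \<in> I.\<Z> K q" if "j < p" for j
        by (rule Z[OF up[OF that]])
      have "(\<Oplus>\<^bsub>S.Q\<^esub>j\<in>{..<p}. ?\<phi> (Xs[j := bracket gI X (Xs ! j)]))
          = (\<Oplus>\<^bsub>S.Q\<^esub>j\<in>{..<p}. cl q (part (xs[j := bracket g x (xs ! j)]) q c))"
        using summand pZ by (intro QH.finsum_cong') (auto simp: S.Q_carrier)
      also have "\<dots> = cl q (\<Oplus>\<^bsub>I.\<F> q\<^esub>j\<in>{..<p}. part (xs[j := bracket g x (xs ! j)]) q c)"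
        using pZ by (intro S.Q_finsum) auto
      finally have sum: "(\<Oplus>\<^bsub>S.Q\<^esub>j\<in>{..<p}. ?\<phi> (Xs[j := bracket gI X (Xs ! j)])) = \<dots>" .
      have \<theta>Z: "I.\<theta> q x (part xs q c) \<in> I.\<Z> K q"
        using Z[OF xs(1)] x' K_J_commute by (intro I.\<theta>_rel_cocycles K_subset)
      have sZ: "(\<Oplus>\<^bsub>I.\<F> q\<^esub>j\<in>{..<p}. part (xs[j := bracket g x (xs ! j)]) q c) \<in> I.\<Z> K q"
        using pZ by (intro S.S_finsum_closed) auto
      have "lie_deriv gI (H q) (actH q) (carrier gI) p X ?\<phi> Xs
          = actH q X (?\<phi> Xs) \<ominus>\<^bsub>S.Q\<^esub> (\<Oplus>\<^bsub>S.Q\<^esub>j\<in>{..<p}. ?\<phi> (Xs[j := bracket gI X (Xs ! j)]))"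
        using Xs by (simp add: lie_deriv_def H_eq)
      also have "\<dots> = cl q (I.\<theta> q x (part xs q c)
          \<ominus>\<^bsub>I.\<F> q\<^esub> (\<Oplus>\<^bsub>I.\<F> q\<^esub>j\<in>{..<p}. part (xs[j := bracket g x (xs ! j)]) q c))"
        using sum xs x action_eq[OF x'(1) Z[OF xs(1)]] by (simp add: ap S.Q_minus[OF \<theta>Z sZ])
      \<comment> \<open>By \<open>\<theta>_part\<close> the argument of the class is (\<theta>_x
        c)_xs, and \<theta>_x c = 0 since x lies in \<open>k\<close>.\<close>
      also have "\<dots> = cl q \<zero>\<^bsub>I.\<F> q\<^esub>"
      proof -
        have "G.\<theta> (p + q) x c zs = \<zero>\<^bsub>M\<^esub>" if "zs \<in> tuples (carrier g) (p + q)" for zs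
          using rel x' that by (simp add: G.rel_cochains_iff[OF k_carrier])
        then have "(\<lambda>ys\<in>tuples I q. G.\<theta> (p + q) x c (xs @ ys)) = \<zero>\<^bsub>I.\<F> q\<^esub>"
          using append_tuples[OF xs(1) I_tuples] by (auto simp: fun_module_def zero_cochain_def)
        then show ?thesis using \<theta>_part[OF alt x'(3) xs(1)] by simp
      qed
      finally show ?thesis using zero_coset by simp
    qed
    then show ?thesis by (auto simp: lie_deriv_def zero_cochain_def fun_eq_iff)
  qed
  have "?\<phi> \<in> alternating_maps F gI (H q) p"
    unfolding alternating_maps_def
    by (intro CollectI conjI ballI allI impI; (elim conjE)?;
        (rule ext | (rule add; assumption) | (rule smult; assumption) | (rule diag; assumption)))
  then show ?thesis unfolding quotient_cochains_def rel_cochains_def using ins deriv by blast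
qed

text \<open>The comparison is made summand by summand: for entries in \<open>J\<close> the action on
  classes is \<theta> of the representative. Each summand is a cocycle by itself, not only the
  total, which is what allows the classes to be added.\<close>

lemma d_plus_\<Phi>:
  assumes c: "c \<in> Z\<^sub>1 p q" and xs: "xs \<in> tuples J (Suc p)"
  shows "d_plus F g I k M act J p q (\<Phi> p q c) (map cls xs)
      = cl q (ce_diff g (I.\<F> q) (I.\<theta> q) p (lift p q c) xs)"
    and "ce_diff g (I.\<F> q) (I.\<theta> q) p (lift p q c) xs \<in> I.\<Z> K q"
proof -
  interpret S: subquotient F "I.\<F> q" "I.\<Z> K q" "I.\<B> K q" by (rule subquotient)
  interpret QH: abelian_group S.Q by (rule S.Q_group)
  let ?\<phi> = "\<Phi> p q c"
  let ?Xs = "map cls xs"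
  note Z = Z1_part(2)[OF c] and ap = \<Phi>_apply[OF Z1_part(1)[OF c]]
  have xg: "xs \<in> tuples (carrier g) (Suc p)" using xs by (rule J_tuples)
  have Xs: "?Xs \<in> tuples (carrier gI) (Suc p)" by (rule map_cls_tuples[OF xg])
  define u where "u i = alt_sign (I.\<F> q) i (I.\<theta> q (xs ! i) (lift p q c (nths xs (- {i}))))" for i
  define v where "v j i = alt_sign (I.\<F> q) (i + j)
      (lift p q c (bracket g (xs ! i) (xs ! j) # nths xs (- {i, j})))" for i j
  have n1: "nths xs (- {i}) \<in> tuples (carrier g) p" "xs ! i \<in> J" if "i \<le> p" for i
    using that xs nths_tuples1[OF xg that] by auto
  \<comment> \<open>The bracket of two entries need not lie in \<open>J\<close>; membership in the
    carrier of \<open>g\<close> is enough, because \<open>\<Phi>_apply\<close> accepts any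
    representatives.\<close>
  have n2: "bracket g (xs ! i) (xs ! j) # nths xs (- {i, j}) \<in> tuples (carrier g) p" if "j \<le> p" "i < j" for i j
    using that xg by (intro nths_tuples2[OF xg] I.Lie.bracket_closed) auto
  have \<theta>Z: "I.\<theta> q (xs ! i) (part (nths xs (- {i})) q c) \<in> I.\<Z> K q" if "i \<le> p" for i
    using n1[OF that] Z K_J_commute by (intro I.\<theta>_rel_cocycles K_subset) (auto intro: J_carrier)
  have uZ: "u i \<in> I.\<Z> K q" if "i \<le> p" for i
    unfolding u_def using n1[OF that] \<theta>Z[OF that] by (simp add: lift_def S.S_closed)
  have vZ: "v j i \<in> I.\<Z> K q" if "j \<le> p" "i < j" for i j
    unfolding v_def using n2[OF that] Z by (simp add: lift_def S.S_closed)
  have U: "alt_sign S.Q i (actH q (?Xs ! i) (?\<phi> (nths ?Xs (- {i})))) = cl q (u i)" if "i \<le> p" for i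
    using n1[OF that] \<theta>Z[OF that] Z xg that
    by (simp add: nths_map ap action_eq length_tuples u_def lift_def S.Q_alt_sign)
  have V: "alt_sign S.Q (i + j) (?\<phi> (bracket gI (?Xs ! i) (?Xs ! j) # nths ?Xs (- {i, j}))) = cl q (v j i)"
    if ij: "j \<le> p" "i < j" for i j
  proof -
    have "bracket gI (?Xs ! i) (?Xs ! j) # nths ?Xs (- {i, j})
        = map cls (bracket g (xs ! i) (xs ! j) # nths xs (- {i, j}))"
      using ij xg by (simp add: nths_map cls_bracket length_tuples)
    then show ?thesis using n2[OF ij] Z by (simp only: ap) (simp add: v_def lift_def S.Q_alt_sign)
  qed
  have SU: "(\<Oplus>\<^bsub>S.Q\<^esub>i\<in>{..p}. alt_sign S.Q i (actH q (?Xs ! i) (?\<phi> (nths ?Xs (- {i})))))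
      = cl q (\<Oplus>\<^bsub>I.\<F> q\<^esub>i\<in>{..p}. u i)"
  proof -
    have "(\<Oplus>\<^bsub>S.Q\<^esub>i\<in>{..p}. alt_sign S.Q i (actH q (?Xs ! i) (?\<phi> (nths ?Xs (- {i})))))
        = (\<Oplus>\<^bsub>S.Q\<^esub>i\<in>{..p}. cl q (u i))"
      using U uZ by (intro QH.finsum_cong') (auto simp: S.Q_carrier)
    also have "\<dots> = cl q (\<Oplus>\<^bsub>I.\<F> q\<^esub>i\<in>{..p}. u i)" using uZ by (intro S.Q_finsum) auto
    finally show ?thesis .
  qed
  have iZ: "(\<Oplus>\<^bsub>I.\<F> q\<^esub>i\<in>{..<j}. v j i) \<in> I.\<Z> K q" if "j \<le> p" for j
    using that vZ by (intro S.S_finsum_closed) auto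
  have inner: "(\<Oplus>\<^bsub>S.Q\<^esub>i\<in>{..<j}. alt_sign S.Q (i + j) (?\<phi> (bracket gI (?Xs ! i) (?Xs ! j) # nths ?Xs (- {i, j}))))
      = cl q (\<Oplus>\<^bsub>I.\<F> q\<^esub>i\<in>{..<j}. v j i)" if j: "j \<le> p" for j
  proof -
    have "(\<Oplus>\<^bsub>S.Q\<^esub>i\<in>{..<j}. alt_sign S.Q (i + j) (?\<phi> (bracket gI (?Xs ! i) (?Xs ! j) # nths ?Xs (- {i, j}))))
        = (\<Oplus>\<^bsub>S.Q\<^esub>i\<in>{..<j}. cl q (v j i))"
      using V vZ j by (intro QH.finsum_cong') (auto simp: S.Q_carrier)
    also have "\<dots> = cl q (\<Oplus>\<^bsub>I.\<F> q\<^esub>i\<in>{..<j}. v j i)" using vZ j by (intro S.Q_finsum) auto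
    finally show ?thesis .
  qed
  have SV: "(\<Oplus>\<^bsub>S.Q\<^esub>j\<in>{..p}. \<Oplus>\<^bsub>S.Q\<^esub>i\<in>{..<j}.
        alt_sign S.Q (i + j) (?\<phi> (bracket gI (?Xs ! i) (?Xs ! j) # nths ?Xs (- {i, j}))))
      = cl q (\<Oplus>\<^bsub>I.\<F> q\<^esub>j\<in>{..p}. \<Oplus>\<^bsub>I.\<F> q\<^esub>i\<in>{..<j}. v j i)"
  proof -
    have "(\<Oplus>\<^bsub>S.Q\<^esub>j\<in>{..p}. \<Oplus>\<^bsub>S.Q\<^esub>i\<in>{..<j}.
        alt_sign S.Q (i + j) (?\<phi> (bracket gI (?Xs ! i) (?Xs ! j) # nths ?Xs (- {i, j}))))
      = (\<Oplus>\<^bsub>S.Q\<^esub>j\<in>{..p}. cl q (\<Oplus>\<^bsub>I.\<F> q\<^esub>i\<in>{..<j}. v j i))"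
      using inner iZ by (intro QH.finsum_cong') (auto simp: S.Q_carrier)
    also have "\<dots> = cl q (\<Oplus>\<^bsub>I.\<F> q\<^esub>j\<in>{..p}. \<Oplus>\<^bsub>I.\<F> q\<^esub>i\<in>{..<j}. v j i)"
      using iZ by (intro S.Q_finsum) auto
    finally show ?thesis .
  qed
  have D: "ce_diff g (I.\<F> q) (I.\<theta> q) p (lift p q c) xs
      = (\<Oplus>\<^bsub>I.\<F> q\<^esub>i\<in>{..p}. u i) \<oplus>\<^bsub>I.\<F> q\<^esub> (\<Oplus>\<^bsub>I.\<F> q\<^esub>j\<in>{..p}. \<Oplus>\<^bsub>I.\<F> q\<^esub>i\<in>{..<j}. v j i)"
    using xg by (simp add: ce_diff_def u_def v_def)
  have Z12: "(\<Oplus>\<^bsub>I.\<F> q\<^esub>i\<in>{..p}. u i) \<in> I.\<Z> K q"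
    "(\<Oplus>\<^bsub>I.\<F> q\<^esub>j\<in>{..p}. \<Oplus>\<^bsub>I.\<F> q\<^esub>i\<in>{..<j}. v j i) \<in> I.\<Z> K q"
    using uZ iZ by (intro S.S_finsum_closed; simp)+
  then show "ce_diff g (I.\<F> q) (I.\<theta> q) p (lift p q c) xs \<in> I.\<Z> K q"
    unfolding D by (rule S.S_closed)
  show "d_plus F g I k M act J p q ?\<phi> ?Xs = cl q (ce_diff g (I.\<F> q) (I.\<theta> q) p (lift p q c) xs)"
    unfolding D S.Q_add[OF Z12, symmetric] SU[symmetric] SV[symmetric]
    using Xs by (simp add: d_plus_def ce_diff_def H_eq)
qed

lemma \<Phi>_diff:
  assumes c: "c \<in> Z\<^sub>1 p q"
  shows "\<Phi> (p + 1) q (\<Delta> (p + q) c) = d_plus F g I k M act J p q (\<Phi> p q c)"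
proof (rule extensionalityI[of _ "tuples (carrier gI) (p + 1)"])
  fix Xs assume "Xs \<in> tuples (carrier gI) (p + 1)"
  then obtain xs where xs: "xs \<in> tuples J (Suc p)" "Xs = map cls xs" using tuples_rep[of Xs "Suc p"] by auto
  interpret S: subquotient F "I.\<F> q" "I.\<Z> K q" "I.\<B> K q" by (rule subquotient)
  have f: "c \<in> Fil p (p + q)" using c by (simp add: Z1_def)
  have alt: "c \<in> \<C> (p + q)" by (rule filtration_alternating[OF f])
  have xg: "xs \<in> tuples (carrier g) (Suc p)" using xs(1) by (rule J_tuples)
  let ?D = "ce_diff g (I.\<F> q) (I.\<theta> q) p (lift p q c) xs"
  note D = d_plus_\<Phi>[OF c xs(1)]
  have Df: "?D \<in> carrier (I.\<F> q)" by (rule S.S_carrier[OF D(2)])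
  have dcf: "part xs q (\<Delta> (p + q) c) \<in> carrier (I.\<F> q)"
    using G.\<delta>_fun[OF filtration_fun[OF f]] xg by (intro part_fun[of _ "Suc p"]) simp_all
  \<comment> \<open>The witness t is the last term of \<open>ce_diff_split\<close>, with its sign;
    for q = 0 it is zero.\<close>
  have "\<exists>t\<in>I.\<B> K q. part xs q (\<Delta> (p + q) c) = t \<oplus>\<^bsub>I.\<F> q\<^esub> ?D"
  proof (cases q)
    case 0
    have "part xs q (\<Delta> (p + q) c) = \<zero>\<^bsub>I.\<F> q\<^esub> \<oplus>\<^bsub>I.\<F> q\<^esub> ?D"
    proof (rule I.Mm.fun_module_ext[OF dcf])
      fix ys assume ys: "ys \<in> tuples I q"
      then show "part xs q (\<Delta> (p + q) c) ys = (\<zero>\<^bsub>I.\<F> q\<^esub> \<oplus>\<^bsub>I.\<F> q\<^esub> ?D) ys"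
        using ce_diff_split[OF alt xg ys] 0 I.Mm.fun_module_closed[OF Df ys]
        by (simp add: part_apply I.Mm.fun_module_apply)
    qed (use Df in simp)
    then show ?thesis using submodule_zero_mem[OF S.U] by blast
  next
    case (Suc b)
    have r: "part xs b c \<in> I.\<R> K b"
    proof (rule part_rel_cochains[of _ "Suc p", OF _ xg])
      show "c \<in> rel_cochains F g k M act (Suc p + b)" using filtration_rel[OF f] Suc by simp
      fix y j ys assume y: "y \<in> K" and j: "j < Suc p" and ys: "ys \<in> tuples I b"
      \<comment> \<open>The filtration gives nothing here: only q arguments would lie in
        \<open>I\<close>. Entries from \<open>J\<close> make the bracket itself zero.\<close>
      have z: "bracket g y (xs ! j) = \<zero>\<^bsub>g\<^esub>" using K_J_commute[OF y] xs(1) j by simp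
      let ?z = "xs @ ys"
      have zt: "?z \<in> tuples (carrier g) (p + q)" using append_tuples[OF xg I_tuples[OF ys]] Suc by simp
      \<comment> \<open>The zero entry is written as zero times itself, so that linearity in slot j
        makes the value zero.\<close>
      have "c (?z[j := \<zero>\<^bsub>F\<^esub> \<odot>\<^bsub>g\<^esub> \<zero>\<^bsub>g\<^esub>]) = \<zero>\<^bsub>F\<^esub> \<odot>\<^bsub>M\<^esub> c (?z[j := \<zero>\<^bsub>g\<^esub>])"
        using j Suc by (intro G.B.alternating_smult[OF alt zt]) auto
      moreover have "c (?z[j := \<zero>\<^bsub>g\<^esub>]) \<in> carrier M"
        by (rule G.B.alternating_closed[OF alt update_tuples[OF zt]]) simp
      ultimately have "c (?z[j := \<zero>\<^bsub>g\<^esub>]) = \<zero>\<^bsub>M\<^esub>" by simp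
      then show "c (xs[j := bracket g y (xs ! j)] @ ys) = \<zero>\<^bsub>M\<^esub>"
        using j xg z by (simp add: list_update_append length_tuples)
    qed
    have \<delta>B: "I.\<delta> b (part xs b c) \<in> I.\<B> K q" using r Suc by (simp add: I.rel_coboundaries_Suc)
    note \<delta>f = I.\<delta>_fun[OF I.rel_cochains_fun[OF r]]
    let ?t = "alt_sign (I.\<F> q) (Suc p) (I.\<delta> b (part xs b c))"
    have tB: "?t \<in> I.\<B> K q" using \<delta>B S.submoduleE(3)[OF S.U] by (simp add: alt_sign_def)
    have tf: "?t \<in> carrier (I.\<F> q)" using tB S.U_subset S.S_carrier by blast
    have "part xs q (\<Delta> (p + q) c) = ?t \<oplus>\<^bsub>I.\<F> q\<^esub> ?D"
    proof (rule I.Mm.fun_module_ext[OF dcf])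
      show "?t \<oplus>\<^bsub>I.\<F> q\<^esub> ?D \<in> carrier (I.\<F> q)" using tf Df by (rule S.a_closed)
      fix ys assume ys: "ys \<in> tuples I q"
      have t: "?t ys = alt_sign M (Suc p) (I.\<delta> b (part xs b c) ys)"
        using \<delta>f ys Suc by (intro I.Mm.fun_module_alt_sign) simp_all
      then show "part xs q (\<Delta> (p + q) c) ys = (?t \<oplus>\<^bsub>I.\<F> q\<^esub> ?D) ys"
        unfolding I.Mm.fun_module_apply(2)[OF ys]
        using ce_diff_split[OF alt xg ys] Suc I.Mm.fun_module_closed[OF Df ys] I.Mm.fun_module_closed[OF tf ys] ys
        by (simp add: part_apply I.M.a_comm)
    qed
    then show ?thesis using tB by blast
  qed
  then have "cl q (part xs q (\<Delta> (p + q) c)) = cl q ?D"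
    using S.coset_add_left[OF S.U _ Df] by auto
  then show "\<Phi> (p + 1) q (\<Delta> (p + q) c) Xs = d_plus F g I k M act J p q (\<Phi> p q c) Xs"
    using \<Phi>_apply[OF Z1_part(1)[OF diff_Z1[OF c]], of xs] xg xs(2) D(1) by simp
qed (simp_all add: alpha_def d_plus_def ce_diff_def)

end

theorem proposition6p4:
  fixes F :: "('a, 'c) ring_scheme" and g :: "('a, 'b, 'd) lie_scheme"
    and M :: "('a, 'm, 'e) module_scheme" and act :: "'b \<Rightarrow> 'm \<Rightarrow> 'm"
    and I k I\<^sub>L J\<^sub>k J\<^sub>L J :: "'b set" and p q :: nat
  assumes "field F"
    and "lie_algebra F g"
    and "lie_ideal F g I"
    and "lie_subalgebra F g k"
    and "reductive_in F g k"
    and "lie_module F g M act"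
    and "adapted_decomp F g I k I\<^sub>L J\<^sub>k J\<^sub>L"
    and "J = J\<^sub>k <+>\<^bsub>g\<^esub> J\<^sub>L"
  shows "phi F g I k M act p q
           \<in> carrier (E1 F g I k M act p q) \<rightarrow> quotient_cochains F g I k M act J p q
       \<and> (\<forall>e \<in> carrier (E1 F g I k M act p q).
            phi F g I k M act (p + 1) q (d1 F g I k M act p q e)
              = d_plus F g I k M act J p q (phi F g I k M act p q e))"
proof -
  interpret adapted_pair F g M act I k I\<^sub>L J\<^sub>k J\<^sub>L J
    using assms by (intro adapted_pair.intro adapted_pair_axioms.intro ideal_pair.intro lie_ideal_module.intro)
  show ?thesis
  proof (intro conjI funcsetI ballI)
    fix e assume "e \<in> carrier (E1 F g I k M act p q)"
    then obtain c where c: "c \<in> Z1 F g I k M act p q"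
      "e = B1 F g I k M act p q +>\<^bsub>fun_module M (carrier g) (p + q)\<^esub> c"
      by (auto simp: E1_carrier)
    show "phi F g I k M act p q e \<in> quotient_cochains F g I k M act J p q"
      unfolding c(2) phi_coset[OF c(1)] by (rule \<Phi>_cochain[OF c(1)])
    show "phi F g I k M act (p + 1) q (d1 F g I k M act p q e)
        = d_plus F g I k M act J p q (phi F g I k M act p q e)"
      unfolding c(2) d1_coset[OF c(1)] phi_coset[OF c(1)] phi_coset[OF diff_Z1[OF c(1)]]
      by (rule \<Phi>_diff[OF c(1)])
  qed
qed

end
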